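(* There exists a constant $C_{\rm dec}>0$, depending only on $V$, such that for every $0<\varepsilon\le1$ and every solution $u_\varepsilon$ of $-\Delta u_\varepsilon=-\varepsilon^{-2}\nabla_uV(u_\varepsilon)$ on $D^2$, $$\int_{D^2(\frac9{16})}e_\varepsilon(u_\varepsilon)\,dx\le C_{\rm dec}\left[\left(\int_{D^2}e_\varepsilon(u_\varepsilon)\,dx\right)^{\frac32}+\varepsilon\int_{D^2}e_\varepsilon(u_\varepsilon)\,dx\right].$$
   Context: $V:\mathbb R^k\to\mathbb R$ ($k\ge1$) is smooth with $\inf V=0$ and satisfies: (1) the zero set $\Sigma=\{V=0\}$ is finite with at least two elements; (2) $\nabla^2V(\sigma)$ is positive definite at each $\sigma\in\Sigma$; (3) there are $\alpha_\infty,R_\infty>0$ with $y\cdot\nabla V(y)\ge\alpha_\infty|y|^2$ if $|y|>R_\infty$, and $V(y)\to+\infty$ as $|y|\to+\infty$. $D^2(r)$ is the open disk of $\mathbb R^2$ of radius $r$ centered at $0$ and $D^2=D^2(1)$; $e_\varepsilon(u)=\varepsilon\frac{|\nabla u|^2}{2}+\frac1\varepsilon V(u)$. Solutions are $H^1$ maps with values in $\mathbb R^k$, of finite energy and smooth in the open disk. *)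

theory Defs
  imports "HOL-Analysis.Analysis"
begin

text \<open>The Frechet derivative below is the two-sided one at a point, so the following notions are
  meant for open sets \<open>S\<close>.\<close>

primrec Ck_on :: "nat \<Rightarrow> 'a::real_normed_vector set \<Rightarrow> ('a \<Rightarrow> 'b::real_normed_vector) \<Rightarrow> bool" where
  "Ck_on 0 S f \<longleftrightarrow> continuous_on S f"
| "Ck_on (Suc n) S f \<longleftrightarrow>
     (\<forall>x\<in>S. f differentiable (at x)) \<and> (\<forall>v. Ck_on n S (\<lambda>x. frechet_derivative f (at x) v))"

definition smooth_on :: "'a::real_normed_vector set \<Rightarrow> ('a \<Rightarrow> 'b::real_normed_vector) \<Rightarrow> bool" where
  "smooth_on S f \<longleftrightarrow> (\<forall>n. Ck_on n S f)"

definition partial_deriv :: "'n \<Rightarrow> (real^'n \<Rightarrow> 'b::real_normed_vector) \<Rightarrow> real^'n \<Rightarrow> 'b" where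
  "partial_deriv i f x = frechet_derivative f (at x) (axis i 1)"

definition gradient :: "(real^'n \<Rightarrow> real) \<Rightarrow> real^'n \<Rightarrow> real^'n" where
  "gradient f x = (\<chi> i. partial_deriv i f x)"

definition hessian :: "(real^'n \<Rightarrow> real) \<Rightarrow> real^'n \<Rightarrow> real^'n^'n" where
  "hessian f x = (\<chi> i j. partial_deriv i (partial_deriv j f) x)"

definition laplacian :: "(real^'n \<Rightarrow> 'b::real_normed_vector) \<Rightarrow> real^'n \<Rightarrow> 'b" where
  "laplacian f x = (\<Sum>i\<in>UNIV. partial_deriv i (partial_deriv i f) x)"

definition positive_definite :: "real^'n^'n \<Rightarrow> bool" where
  "positive_definite A \<longleftrightarrow> transpose A = A \<and> (\<forall>v. v \<noteq> 0 \<longrightarrow> v \<bullet> (A *v v) > 0)"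

text \<open>Since \<open>Inf\<close> on the reals is unspecified for sets that are not bounded below, boundedness
  is part of the meaning of \<open>inf V = 0\<close>.\<close>

definition admissible_potential :: "(real^'k \<Rightarrow> real) \<Rightarrow> bool" where
  "admissible_potential V \<longleftrightarrow>
     smooth_on UNIV V \<and>
     bdd_below (range V) \<and> Inf (range V) = 0 \<and>
     finite {y. V y = 0} \<and> card {y. V y = 0} \<ge> 2 \<and>
     (\<forall>\<sigma>. V \<sigma> = 0 \<longrightarrow> positive_definite (hessian V \<sigma>)) \<and>
     (\<exists>\<alpha>>0. \<exists>R>0. \<forall>y. norm y > R \<longrightarrow> y \<bullet> gradient V y \<ge> \<alpha> * (norm y)\<^sup>2) \<and>
     filterlim V at_top at_infinity"

definition test_function_on :: "(real^'n) set \<Rightarrow> (real^'n \<Rightarrow> real) \<Rightarrow> bool" where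
  "test_function_on S \<phi> \<longleftrightarrow>
     smooth_on UNIV \<phi> \<and> compact (closure {x. \<phi> x \<noteq> 0}) \<and> closure {x. \<phi> x \<noteq> 0} \<subseteq> S"

definition L2_on :: "(real^'n) set \<Rightarrow> (real^'n \<Rightarrow> real^'k) \<Rightarrow> bool" where
  "L2_on S f \<longleftrightarrow>
     set_borel_measurable lebesgue S f \<and> set_integrable lebesgue S (\<lambda>x. (norm (f x))\<^sup>2)"

definition weak_partial_deriv_on ::
    "(real^'n) set \<Rightarrow> 'n \<Rightarrow> (real^'n \<Rightarrow> real^'k) \<Rightarrow> (real^'n \<Rightarrow> real^'k) \<Rightarrow> bool" where
  "weak_partial_deriv_on S i f g \<longleftrightarrow>
     (\<forall>\<phi>. test_function_on S \<phi> \<longrightarrow>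
        (LINT x:S|lebesgue. partial_deriv i \<phi> x *\<^sub>R f x) = - (LINT x:S|lebesgue. \<phi> x *\<^sub>R g x))"

definition H1_on :: "(real^'n) set \<Rightarrow> (real^'n \<Rightarrow> real^'k) \<Rightarrow> bool" where
  "H1_on S f \<longleftrightarrow> L2_on S f \<and> (\<forall>i. \<exists>g. L2_on S g \<and> weak_partial_deriv_on S i f g)"

definition energy_density ::
    "(real^'k \<Rightarrow> real) \<Rightarrow> real \<Rightarrow> (real^2 \<Rightarrow> real^'k) \<Rightarrow> real^2 \<Rightarrow> real" where
  "energy_density V \<epsilon> u x =
     \<epsilon> * ((\<Sum>i\<in>UNIV. (norm (partial_deriv i u x))\<^sup>2) / 2) + (1 / \<epsilon>) * V (u x)"

text \<open>Only the values of \<open>u\<close> on the open unit disk matter.\<close>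

definition solution :: "(real^'k \<Rightarrow> real) \<Rightarrow> real \<Rightarrow> (real^2 \<Rightarrow> real^'k) \<Rightarrow> bool" where
  "solution V \<epsilon> u \<longleftrightarrow>
     H1_on (ball 0 1) u \<and>
     set_integrable lebesgue (ball 0 1) (energy_density V \<epsilon> u) \<and>
     smooth_on (ball 0 1) u \<and>
     (\<forall>x\<in>ball 0 1. - laplacian u x = - ((1 / \<epsilon>\<^sup>2) *\<^sub>R gradient V (u x)))"

end

theory Submission
  imports Defs
begin

text \<open>
  For \<open>\<epsilon>\<close> bounded below, or energy bounded below, the estimate is trivial; otherwise more is true:
  the solution stays near a single zero \<open>\<sigma>\<close> of the potential, and testing the equation with
  \<open>u - \<sigma>\<close> (times a cutoff) bounds the inner energy by \<open>\<epsilon>\<close> times the total energy.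

  The closeness to \<open>\<sigma>\<close> follows from a decay of the scale-invariant energy \<open>E\<close>. On every coordinate line
  carrying energy less than a threshold \<open>\<eta>\<close>, the solution is near one zero, the same for all these lines
  as horizontal and vertical lines meet. The other lines are parametrised by sets of measure at
  most \<open>E / \<eta>\<close>, so varying the domain along \<open>(f x, g y)\<close>, where \<open>f'\<close> and \<open>g'\<close> are essentially the
  indicators of these sets and hence \<open>f\<close> and \<open>g\<close> are at most \<open>E / \<eta>\<close>, bounds the potential on the bad
  set by \<open>E\<^sup>2 / \<eta>\<close> plus the energy on the good set. The latter is small because truncations of
  \<open>u - \<sigma>\<close> are admissible test fields. Finally, the potential controls the gradient by a pointwise
  Bernstein bound. Iterating down to the scale \<open>\<epsilon>\<close> gives closeness at every interior point.
\<close>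

section \<open>Calculus on squares\<close>

text \<open>The decay factor 1/2 is dictated by scaling. Zooming into the half square doubles both
  \<epsilon> and the energy, so halving the energy is exactly what reproduces the smallness
  hypothesis at the next scale. The zoom stops once \<epsilon> is comparable to a fixed threshold:
  there a square of side comparable to \<epsilon> carries a definite amount of energy unless the
  value at its centre is near a zero.

  The obstacle in the decay step is that in two dimensions the energy controls the solution along
  lines and not at points, so nothing is known where both coordinate lines are bad. There the trace
  of the stress tensor is used: it equals 2 V(u) / \<epsilon>, without gradient, which is why the
  inner variation sees the potential alone and the gradient needs a separate argument. The test
  fields are truncated for the same reason: a field that is the gradient of a convex function
  contributes nothing negative on the bad set, and the final cutoff of the field costs an error
  proportional to the truncation height. Hence the order of choice: truncation height, threshold for
  the lines, then energy and \<epsilon>.\<close>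

abbreviation square :: "real \<Rightarrow> (real \<times> real) set" where
  "square r \<equiv> cbox (- r, - r) (r, r)"

text \<open>Derivatives are two-sided even at edge points of a closed square, so no one-sided
  derivative arises on the boundary. The gradient is given by explicit components so that the
  equation and the stress tensor can be written in partials.\<close>

definition has_partials ::
    "(real \<times> real \<Rightarrow> 'a::real_normed_vector) \<Rightarrow> (real \<times> real \<Rightarrow> 'a) \<Rightarrow> (real \<times> real \<Rightarrow> 'a) \<Rightarrow>
      (real \<times> real) set \<Rightarrow> bool" where
  "has_partials f fx fy S \<longleftrightarrow>
     (\<forall>p\<in>S. (f has_derivative (\<lambda>h. fst h *\<^sub>R fx p + snd h *\<^sub>R fy p)) (at p))"

lemma mem_square: "(x, y) \<in> square r \<longleftrightarrow> \<bar>x\<bar> \<le> r \<and> \<bar>y\<bar> \<le> r"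
  by (auto simp: cbox_Pair_eq)

lemma has_partials_x:
  assumes "has_partials f fx fy S" "(x, y) \<in> S"
  shows "((\<lambda>t. f (t, y)) has_vector_derivative fx (x, y)) (at x)"
proof -
  have "(f has_derivative (\<lambda>h. fst h *\<^sub>R fx (x, y) + snd h *\<^sub>R fy (x, y))) (at ((\<lambda>t. (t, y)) x))"
    using assms by (auto simp: has_partials_def)
  moreover have "((\<lambda>t. (t, y)) has_derivative (\<lambda>t. (t, 0))) (at x)"
    by (auto intro!: derivative_eq_intros)
  ultimately show ?thesis
    using diff_chain_at[of "\<lambda>t. (t, y)" "\<lambda>t. (t, 0)" x f] by (fastforce simp: o_def has_vector_derivative_def)
qed

lemma has_partials_y:
  assumes "has_partials f fx fy S" "(x, y) \<in> S"
  shows "((\<lambda>t. f (x, t)) has_vector_derivative fy (x, y)) (at y)"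
proof -
  have "(f has_derivative (\<lambda>h. fst h *\<^sub>R fx (x, y) + snd h *\<^sub>R fy (x, y))) (at ((\<lambda>t. (x, t)) y))"
    using assms by (auto simp: has_partials_def)
  moreover have "((\<lambda>t. (x, t)) has_derivative (\<lambda>t. (0, t))) (at y)"
    by (auto intro!: derivative_eq_intros)
  ultimately show ?thesis
    using diff_chain_at[of "\<lambda>t. (x, t)" "\<lambda>t. (0, t)" y f] by (fastforce simp: o_def has_vector_derivative_def)
qed

lemma has_partials_continuous:
  assumes "has_partials f fx fy S"
  shows "continuous_on S f"
  using assms unfolding has_partials_def
  by (meson continuous_at_imp_continuous_on has_derivative_continuous)

lemma has_partials_subset: "has_partials f fx fy S \<Longrightarrow> T \<subseteq> S \<Longrightarrow> has_partials f fx fy T"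
  by (auto simp: has_partials_def)

lemma has_real_derivative_inner:
  assumes "(f has_vector_derivative f') (at x within S)" "(g has_vector_derivative g') (at x within S)"
  shows "((\<lambda>t. f t \<bullet> g t) has_real_derivative (f x \<bullet> g' + f' \<bullet> g x)) (at x within S)"
  using has_derivative_inner[OF assms[unfolded has_vector_derivative_def]]
  unfolding has_field_derivative_def
  by (rule has_derivative_eq_rhs) (simp add: fun_eq_iff algebra_simps)

text \<open>Fubini, and the fundamental theorem of calculus on each line; only the derivative of
  each component in its own direction enters. The boundary values vanish in the applications because
  the fields carry a cutoff.\<close>

lemma divergence_square:
  fixes F G :: "real \<times> real \<Rightarrow> real"
  assumes r: "0 < r"
    and cont: "continuous_on (square r) Fx" "continuous_on (square r) Gy"
    and F: "\<And>x y. (x, y) \<in> square r \<Longrightarrow> ((\<lambda>t. F (t, y)) has_real_derivative Fx (x, y)) (at x)"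
    and G: "\<And>x y. (x, y) \<in> square r \<Longrightarrow> ((\<lambda>t. G (x, t)) has_real_derivative Gy (x, y)) (at y)"
    and bd: "\<And>y. F (r, y) = 0" "\<And>y. F (- r, y) = 0" "\<And>x. G (x, r) = 0" "\<And>x. G (x, - r) = 0"
  shows "integral (square r) (\<lambda>p. Fx p + Gy p) = 0"
proof -
  have Gy: "integral {- r..r} (\<lambda>y. Gy (x, y)) = 0" if "\<bar>x\<bar> \<le> r" for x
  proof -
    have "((\<lambda>y. Gy (x, y)) has_integral (G (x, r) - G (x, - r))) {- r..r}"
      using r that
      by (intro fundamental_theorem_of_calculus)
        (auto intro!: has_vector_derivative_at_within G[unfolded has_real_derivative_iff_has_vector_derivative] simp: mem_square)
    then show ?thesis using bd by (simp add: integral_unique)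
  qed
  have Fx: "integral {- r..r} (\<lambda>x. Fx (x, y)) = 0" if "\<bar>y\<bar> \<le> r" for y
  proof -
    have "((\<lambda>x. Fx (x, y)) has_integral (F (r, y) - F (- r, y))) {- r..r}"
      using r that
      by (intro fundamental_theorem_of_calculus)
        (auto intro!: has_vector_derivative_at_within F[unfolded has_real_derivative_iff_has_vector_derivative] simp: mem_square)
    then show ?thesis using bd by (simp add: integral_unique)
  qed
  have "integral (square r) Gy = integral (cbox (- r) r) (\<lambda>x. integral (cbox (- r) r) (\<lambda>y. Gy (x, y)))"
    by (rule integral_prod_continuous[OF cont(2)])
  also have "\<dots> = integral (cbox (- r) r) (\<lambda>x. 0)"
    by (rule integral_cong) (use Gy in auto)
  finally have 1: "integral (square r) Gy = 0" by simp
  have "integral (square r) Fx = integral (cbox (- r) r) (\<lambda>x. integral (cbox (- r) r) (\<lambda>y. Fx (x, y)))"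
    by (rule integral_prod_continuous[OF cont(1)])
  also have "\<dots> = integral (cbox (- r) r) (\<lambda>y. integral (cbox (- r) r) (\<lambda>x. Fx (x, y)))"
    by (rule integral_swap_continuous) (use cont(1) in simp)
  also have "\<dots> = integral (cbox (- r) r) (\<lambda>x. 0)"
    by (rule integral_cong) (use Fx in auto)
  finally have 2: "integral (square r) Fx = 0" by simp
  show ?thesis
    using 1 2 cont by (simp add: integral_add integrable_continuous)
qed

text \<open>Both mixed partials have the same integral over every small square with corner
  \<open>p\<close>, namely the second difference \<open>W\<close> of \<open>f\<close>. Their
  difference is continuous with mean zero on these squares, hence zero at \<open>p\<close>.\<close>

lemma mixed_partials_eq:
  fixes f :: "real \<times> real \<Rightarrow> 'a::euclidean_space"
  assumes S: "open S" and p: "p \<in> S"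
    and f: "has_partials f fx fy S" "has_partials fx fxx fxy S" "has_partials fy fyx fyy S"
    and cont: "continuous_on S fxy" "continuous_on S fyx"
  shows "fxy p = fyx p"
proof -
  obtain x0 y0 where p0: "p = (x0, y0)" by (cases p)
  define g where "g = (\<lambda>p. fxy p - fyx p)"
  have g: "continuous_on S g" unfolding g_def by (intro continuous_intros cont)
  have *: "norm (g p) \<le> e" if "e > 0" for e
  proof -
    have "\<exists>d>0. \<forall>q\<in>S. dist q p < d \<longrightarrow> dist (g q) (g p) < e"
      using g p \<open>e > 0\<close> unfolding continuous_on_iff by blast
    then obtain d1 where d1: "d1 > 0" "\<And>q. q \<in> S \<Longrightarrow> dist q p < d1 \<Longrightarrow> dist (g q) (g p) < e" by blast
    obtain d2 where d2: "d2 > 0" "ball p d2 \<subseteq> S" using S p open_contains_ball by blast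
    define s where "s = min d1 d2 / 4"
    have s: "s > 0" using d1 d2 by (simp add: s_def)
    define Q where "Q = cbox (x0, y0) (x0 + s, y0 + s)"
    have near: "dist q p < min d1 d2" if "q \<in> Q" for q
    proof -
      obtain x y where q: "q = (x, y)" by (cases q)
      have "dist q p \<le> \<bar>x - x0\<bar> + \<bar>y - y0\<bar>"
        unfolding q p0 dist_Pair_Pair dist_real_def by (intro real_le_lsqrt) (auto simp: power2_eq_square algebra_simps)
      also have "\<dots> \<le> 2 * s" using that by (auto simp: Q_def q cbox_Pair_eq)
      finally show ?thesis using s by (simp add: s_def)
    qed
    have QS: "Q \<subseteq> S" using near d2 by (force simp: dist_commute)
    have pQ: "p \<in> Q" using s by (auto simp: Q_def p0 cbox_Pair_eq)
    have cQ: "continuous_on Q fxy" "continuous_on Q fyx" using cont QS continuous_on_subset by blast+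
    have xy: "(x, y) \<in> S" if "x0 \<le> x" "x \<le> x0 + s" "y0 \<le> y" "y \<le> y0 + s" for x y
      using that QS by (auto simp: Q_def cbox_Pair_eq)
    have i1: "((\<lambda>y. fxy (x, y)) has_integral (fx (x, y0 + s) - fx (x, y0))) {y0..y0 + s}"
      if "x0 \<le> x" "x \<le> x0 + s" for x
      using s that by (intro fundamental_theorem_of_calculus)
        (auto intro!: has_vector_derivative_at_within has_partials_y[OF f(2)] xy)
    have i2: "((\<lambda>x. fx (x, y)) has_integral (f (x0 + s, y) - f (x0, y))) {x0..x0 + s}"
      if "y0 \<le> y" "y \<le> y0 + s" for y
      using s that by (intro fundamental_theorem_of_calculus)
        (auto intro!: has_vector_derivative_at_within has_partials_x[OF f(1)] xy)
    have i3: "((\<lambda>x. fyx (x, y)) has_integral (fy (x0 + s, y) - fy (x0, y))) {x0..x0 + s}"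
      if "y0 \<le> y" "y \<le> y0 + s" for y
      using s that by (intro fundamental_theorem_of_calculus)
        (auto intro!: has_vector_derivative_at_within has_partials_x[OF f(3)] xy)
    have i4: "((\<lambda>y. fy (x, y)) has_integral (f (x, y0 + s) - f (x, y0))) {y0..y0 + s}"
      if "x0 \<le> x" "x \<le> x0 + s" for x
      using s that by (intro fundamental_theorem_of_calculus)
        (auto intro!: has_vector_derivative_at_within has_partials_y[OF f(1)] xy)
    define W where "W = (f (x0 + s, y0 + s) - f (x0, y0 + s)) - (f (x0 + s, y0) - f (x0, y0))"
    have "integral Q fxy = integral (cbox x0 (x0+s)) (\<lambda>x. integral (cbox y0 (y0+s)) (\<lambda>y. fxy (x, y)))"
      unfolding Q_def by (rule integral_prod_continuous) (use cQ in \<open>simp add: Q_def\<close>)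
    also have "\<dots> = integral (cbox x0 (x0+s)) (\<lambda>x. fx (x, y0 + s) - fx (x, y0))"
      by (rule integral_cong) (use i1 in \<open>auto simp: integral_unique\<close>)
    also have "\<dots> = W"
      unfolding W_def by (rule integral_unique, simp, intro has_integral_diff i2) (use s in auto)
    finally have 1: "integral Q fxy = W" .
    have "integral Q fyx = integral (cbox x0 (x0+s)) (\<lambda>x. integral (cbox y0 (y0+s)) (\<lambda>y. fyx (x, y)))"
      unfolding Q_def by (rule integral_prod_continuous) (use cQ in \<open>simp add: Q_def\<close>)
    also have "\<dots> = integral (cbox y0 (y0+s)) (\<lambda>y. integral (cbox x0 (x0+s)) (\<lambda>x. fyx (x, y)))"
      by (rule integral_swap_continuous) (use cQ in \<open>simp add: Q_def\<close>)
    also have "\<dots> = integral (cbox y0 (y0+s)) (\<lambda>y. fy (x0 + s, y) - fy (x0, y))"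
      by (rule integral_cong) (use i3 in \<open>auto simp: integral_unique\<close>)
    also have "\<dots> = (f (x0 + s, y0 + s) - f (x0 + s, y0)) - (f (x0, y0 + s) - f (x0, y0))"
      by (rule integral_unique, simp, intro has_integral_diff i4) (use s in auto)
    finally have 2: "integral Q fyx = W" by (simp add: W_def)
    have i: "fxy integrable_on Q" "fyx integrable_on Q"
      using cQ by (auto simp: Q_def intro: integrable_continuous)
    have "integral Q g = 0" unfolding g_def using i 1 2 by (simp add: integral_diff)
    moreover have "g integrable_on Q" unfolding g_def using i by (rule integrable_diff)
    ultimately have g0: "(g has_integral 0) Q" by (simp add: has_integral_iff)
    have cont_eq: "measure lborel Q = s * s" unfolding Q_def using s by (simp add: content_Pair)
    have "((\<lambda>q. g q - g p) has_integral (0 - measure lborel Q *\<^sub>R g p)) Q"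
      using g0 has_integral_const[of "g p" "(x0, y0)" "(x0 + s, y0 + s)"]
      unfolding Q_def by (intro has_integral_diff)
    then have "norm (0 - measure lborel Q *\<^sub>R g p) \<le> e * measure lborel Q"
      unfolding Q_def
      by (rule has_integral_bound[rotated]) (use d1(2) near QS \<open>e > 0\<close> in \<open>auto simp: Q_def dist_norm intro!: less_imp_le\<close>)
    then show ?thesis using s by (simp add: cont_eq mult.commute)
  qed
  have "norm (g p) \<le> 0" by (rule field_le_epsilon) (unfold add_0, rule *)
  then show ?thesis unfolding g_def by simp
qed

section \<open>Truncations of class C1 and the product cutoff\<close>

lemma has_real_derivative_pos_square:
  "((\<lambda>s::real. (max 0 s)\<^sup>2) has_real_derivative 2 * max 0 x) (at x)"
proof -
  consider "x < 0" | "x = 0" | "x > 0" by linarith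
  then show ?thesis
  proof cases
    case 1
    have "((\<lambda>s::real. 0) has_real_derivative 2 * max 0 x) (at x)"
      using 1 by (auto intro!: derivative_eq_intros)
    moreover have "eventually (\<lambda>s. 0 = (max 0 s)\<^sup>2) (nhds x)"
      using eventually_nhds_in_open[of "{..<0}" x] 1 by (auto elim!: eventually_mono)
    ultimately show ?thesis by (rule DERIV_cong_ev[THEN iffD1, OF refl _ refl, rotated])
  next
    case 3
    have "((\<lambda>s::real. s\<^sup>2) has_real_derivative 2 * max 0 x) (at x)"
      using 3 by (auto intro!: derivative_eq_intros)
    moreover have "eventually (\<lambda>s. s\<^sup>2 = (max 0 s)\<^sup>2) (nhds x)"
      using eventually_nhds_in_open[of "{0<..}" x] 3 by (auto elim!: eventually_mono)
    ultimately show ?thesis by (rule DERIV_cong_ev[THEN iffD1, OF refl _ refl, rotated])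
  next
    case 2
    have "((\<lambda>h::real. (max 0 h)\<^sup>2 / h) \<longlongrightarrow> 0) (at 0)"
    proof (rule Lim_null_comparison)
      show "\<forall>\<^sub>F h::real in at 0. norm ((max 0 h)\<^sup>2 / h) \<le> \<bar>h\<bar>"
        by (intro always_eventually allI) (auto simp: max_def power2_eq_square)
      show "((\<lambda>h::real. \<bar>h\<bar>) \<longlongrightarrow> 0) (at 0)" by (auto intro!: tendsto_eq_intros)
    qed
    then show ?thesis using 2 by (simp add: DERIV_def)
  qed
qed

lemma has_real_derivative_pos_cube:
  "((\<lambda>s::real. (max 0 s)^3) has_real_derivative 3 * (max 0 x)\<^sup>2) (at x)"
proof -
  have "((\<lambda>s::real. s * (max 0 s)\<^sup>2) has_real_derivative (1 * (max 0 x)\<^sup>2 + 2 * max 0 x * x)) (at x)"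
    by (intro DERIV_mult DERIV_ident has_real_derivative_pos_square)
  moreover have "(\<lambda>s::real. s * (max 0 s)\<^sup>2) = (\<lambda>s. (max 0 s)^3)"
    by (auto simp: fun_eq_iff max_def power2_eq_square power3_eq_cube)
  moreover have "1 * (max 0 x)\<^sup>2 + 2 * max 0 x * x = 3 * (max 0 x)\<^sup>2"
    by (auto simp: max_def power2_eq_square)
  ultimately show ?thesis by (simp only:)
qed

text \<open>Squaring the positive part makes the profile C1 on the whole line, also where it reaches
  0 at \<open>r\<close> and \<open>- r\<close>. This is the regularity that one integration by parts
  asks for, and the bounds stay explicit.\<close>

definition bump :: "real \<Rightarrow> real \<Rightarrow> real" where
  "bump r x = (max 0 (1 - (x / r)\<^sup>2))\<^sup>2"

definition bump' :: "real \<Rightarrow> real \<Rightarrow> real" where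
  "bump' r x = - 4 * (x / r\<^sup>2) * max 0 (1 - (x / r)\<^sup>2)"

lemma bump_deriv: "(bump r has_real_derivative bump' r x) (at x)"
proof -
  have "((\<lambda>x. 1 - (x * inverse r)\<^sup>2) has_real_derivative - 2 * (x / r\<^sup>2)) (at x)"
    by (rule derivative_eq_intros refl)+ (simp add: power2_eq_square field_simps)
  then have "((\<lambda>x. 1 - (x / r)\<^sup>2) has_real_derivative - 2 * (x / r\<^sup>2)) (at x)"
    by (simp add: divide_inverse)
  from DERIV_chain2[OF has_real_derivative_pos_square this]
  show ?thesis unfolding bump_def bump'_def by (rule DERIV_cong) (simp add: field_simps)
qed

lemma bump_cont [continuous_intros]:
  "continuous_on S f \<Longrightarrow> continuous_on S (\<lambda>x. bump r (f x))"
  "continuous_on S f \<Longrightarrow> continuous_on S (\<lambda>x. bump' r (f x))"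
  unfolding bump_def bump'_def divide_inverse by (intro continuous_intros; assumption)+

lemma bump_bounds: "0 \<le> bump r x" "bump r x \<le> 1"
  unfolding bump_def by (auto simp: max_def power_le_one)

lemma bump_boundary [simp]: "0 < r \<Longrightarrow> bump r r = 0" "0 < r \<Longrightarrow> bump r (- r) = 0"
  by (auto simp: bump_def)

lemma bump'_bound:
  assumes "0 < r" shows "\<bar>bump' r x\<bar> \<le> 4 / r"
proof (cases "\<bar>x\<bar> \<le> r")
  case True
  have "\<bar>max 0 (1 - (x / r)\<^sup>2)\<bar> \<le> 1" by (auto simp: max_def)
  moreover have "\<bar>x / r\<^sup>2\<bar> \<le> 1 / r" using assms True by (simp add: power2_eq_square field_simps abs_mult)
  ultimately have "\<bar>x / r\<^sup>2\<bar> * \<bar>max 0 (1 - (x / r)\<^sup>2)\<bar> \<le> (1 / r) * 1"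
    using assms by (intro mult_mono) auto
  then show ?thesis by (simp add: bump'_def abs_mult)
next
  case False
  then have "1 \<le> \<bar>x / r\<bar>" using assms by simp
  then have "1 \<le> (x / r)\<^sup>2" by (metis one_le_power power2_abs)
  then show ?thesis using assms by (simp add: bump'_def)
qed

lemma bump_lower:
  assumes "0 < r" "\<bar>x\<bar> \<le> s" "s < r"
  shows "(1 - (s / r)\<^sup>2)\<^sup>2 \<le> bump r x"
proof -
  have "(x / r)\<^sup>2 \<le> (s / r)\<^sup>2" using assms by (auto simp: abs_le_square_iff[symmetric] divide_right_mono)
  moreover have "(s / r)\<^sup>2 \<le> 1" using assms by (auto simp: power_le_one_iff)
  ultimately show ?thesis unfolding bump_def by (intro power_mono) auto
qed

section \<open>The potential and the test field estimate\<close>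

definition cutoff :: "real \<Rightarrow> real \<times> real \<Rightarrow> real" where
  "cutoff r p = bump r (fst p) * bump r (snd p)"

lemma cutoff_bounds: "0 \<le> cutoff r p" "cutoff r p \<le> 1"
  unfolding cutoff_def using bump_bounds by (auto intro: mult_le_one)

lemma cutoff_cont: "continuous_on S (cutoff r)"
  unfolding cutoff_def by (intro continuous_intros)

lemma cutoff_lower:
  assumes "0 < s" "s < r" "p \<in> square s"
  shows "(1 - (s / r)\<^sup>2) ^ 4 \<le> cutoff r p"
proof -
  obtain x y where p: "p = (x, y)" by (cases p)
  have "\<bar>x\<bar> \<le> s" "\<bar>y\<bar> \<le> s" using assms(3) unfolding p mem_square by auto
  then have "(1 - (s / r)\<^sup>2)\<^sup>2 * (1 - (s / r)\<^sup>2)\<^sup>2 \<le> bump r x * bump r y"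
    using assms by (intro mult_mono bump_lower) (auto simp: bump_bounds)
  then show ?thesis by (simp add: cutoff_def p power4_eq_xxxx power2_eq_square mult.assoc)
qed

text \<open>All constants of the estimates are built from these numbers, which is how they depend on
  the potential alone. The radius \<mu> is common to all zeros. The regions overlap:
  \<open>far\<close> starts at \<open>\<mu> / 8\<close> while the quadratic bounds reach to \<mu>,
  which leaves room for the intermediate thresholds \<open>\<mu> / 4\<close> and
  \<open>\<mu> / 2\<close>.\<close>

locale potential =
  fixes V :: "'a::euclidean_space \<Rightarrow> real" and gV :: "'a \<Rightarrow> 'a" and HV :: "'a \<Rightarrow> 'a \<Rightarrow> 'a"
    and Z :: "'a set" and \<mu> a b v0 M L :: real
  assumes V_deriv: "(V has_derivative (\<lambda>h. gV y \<bullet> h)) (at y)"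
    and gV_deriv: "(gV has_derivative HV y) (at y)"
    and V_nonneg: "0 \<le> V y"
    and finite_Z: "finite Z"
    and pos: "0 < \<mu>" "0 < a" "0 < b" "0 < v0" "0 < M" "0 < L"
    and near_grad: "\<sigma> \<in> Z \<Longrightarrow> norm (y - \<sigma>) \<le> \<mu> \<Longrightarrow> a * (norm (y - \<sigma>))\<^sup>2 \<le> (y - \<sigma>) \<bullet> gV y"
    and near_lower: "\<sigma> \<in> Z \<Longrightarrow> norm (y - \<sigma>) \<le> \<mu> \<Longrightarrow> a * (norm (y - \<sigma>))\<^sup>2 \<le> V y"
    and near_upper: "\<sigma> \<in> Z \<Longrightarrow> norm (y - \<sigma>) \<le> \<mu> \<Longrightarrow> V y \<le> b * (norm (y - \<sigma>))\<^sup>2"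
    and far: "(\<And>\<sigma>. \<sigma> \<in> Z \<Longrightarrow> \<mu> / 8 \<le> norm (y - \<sigma>)) \<Longrightarrow> v0 \<le> V y"
    and separated: "\<sigma> \<in> Z \<Longrightarrow> \<sigma>' \<in> Z \<Longrightarrow> \<sigma> \<noteq> \<sigma>' \<Longrightarrow> 2 * \<mu> < norm (\<sigma> - \<sigma>')"
    and Z_bounded: "\<sigma> \<in> Z \<Longrightarrow> norm \<sigma> + \<mu> \<le> M"
    and radial: "M < norm y \<Longrightarrow> 0 < y \<bullet> gV y"
    and gV_bound: "norm y \<le> M \<Longrightarrow> norm (gV y) \<le> L"
    and HV_bound: "norm y \<le> M \<Longrightarrow> norm (HV y h) \<le> L * norm h"
begin

text \<open>Sharing \<open>uxy\<close>, \<open>uxxy\<close> and \<open>uxyy\<close> between the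
  clauses encodes the symmetry of mixed partials. The third derivatives make the second ones
  continuous and allow the equation to be differentiated once in
  \<open>bernstein_estimate\<close>.\<close>

definition solves ::
    "real \<Rightarrow> (real \<times> real) set \<Rightarrow> (real \<times> real \<Rightarrow> 'a) \<Rightarrow> (real \<times> real \<Rightarrow> 'a) \<Rightarrow>
      (real \<times> real \<Rightarrow> 'a) \<Rightarrow> bool" where
  "solves \<epsilon> S u ux uy \<longleftrightarrow> (\<exists>uxx uxy uyy uxxx uxxy uxyy uyyy.
     has_partials u ux uy S \<and> has_partials ux uxx uxy S \<and> has_partials uy uxy uyy S \<and>
     has_partials uxx uxxx uxxy S \<and> has_partials uxy uxxy uxyy S \<and> has_partials uyy uxyy uyyy S \<and>
     (\<forall>p\<in>S. uxx p + uyy p = (1 / \<epsilon>\<^sup>2) *\<^sub>R gV (u p)))"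

definition grad_sq :: "(real \<times> real \<Rightarrow> 'a) \<Rightarrow> (real \<times> real \<Rightarrow> 'a) \<Rightarrow> real \<times> real \<Rightarrow> real" where
  "grad_sq ux uy p = (norm (ux p))\<^sup>2 + (norm (uy p))\<^sup>2"

definition energy ::
    "real \<Rightarrow> (real \<times> real \<Rightarrow> 'a) \<Rightarrow> (real \<times> real \<Rightarrow> 'a) \<Rightarrow> (real \<times> real \<Rightarrow> 'a) \<Rightarrow> real \<times> real \<Rightarrow> real" where
  "energy \<epsilon> u ux uy p = \<epsilon> * (grad_sq ux uy p / 2) + V (u p) / \<epsilon>"

lemma solves_subset: "solves \<epsilon> S u ux uy \<Longrightarrow> T \<subseteq> S \<Longrightarrow> solves \<epsilon> T u ux uy"
  unfolding solves_def by (meson has_partials_subset subsetD)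

lemma continuous_V: "continuous_on S V"
  using V_deriv by (meson continuous_at_imp_continuous_on has_derivative_continuous)

lemma continuous_gV: "continuous_on S gV"
  using gV_deriv by (meson continuous_at_imp_continuous_on has_derivative_continuous)

lemma solves_continuous:
  assumes "solves \<epsilon> S u ux uy"
  shows "continuous_on S u" "continuous_on S ux" "continuous_on S uy"
    "continuous_on S (grad_sq ux uy)" "continuous_on S (\<lambda>p. V (u p))"
    "continuous_on S (energy \<epsilon> u ux uy)"
proof -
  show c: "continuous_on S u" "continuous_on S ux" "continuous_on S uy"
    using assms has_partials_continuous unfolding solves_def by blast+
  show "continuous_on S (grad_sq ux uy)" unfolding grad_sq_def by (intro continuous_intros c)
  then have g: "continuous_on S (grad_sq ux uy)" .
  show v: "continuous_on S (\<lambda>p. V (u p))"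
    using continuous_on_compose2[OF continuous_V c(1)] by blast
  show "continuous_on S (energy \<epsilon> u ux uy)"
    unfolding energy_def divide_inverse by (intro continuous_intros g v)
qed

lemma grad_sq_nonneg: "0 \<le> grad_sq ux uy p"
  by (simp add: grad_sq_def)

lemma energy_nonneg: "0 < \<epsilon> \<Longrightarrow> 0 \<le> energy \<epsilon> u ux uy p"
  by (simp add: energy_def V_nonneg grad_sq_nonneg)

text \<open>The arithmetic-geometric mean inequality, applied once to each partial with half of
  \<open>V (u p) / \<epsilon>\<close>. The powers of \<epsilon> cancel, so the left side, which
  governs the variation of the squared distance to a zero, is bounded uniformly in
  \<epsilon>.\<close>

lemma sqrt_V_gradient_le_energy:
  assumes "0 < \<epsilon>"
  shows "sqrt (V (u p)) * (norm (ux p) + norm (uy p)) \<le> energy \<epsilon> u ux uy p"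
proof -
  have *: "sqrt v * n \<le> (\<epsilon> * n\<^sup>2 + v / \<epsilon>) / 2" if "0 \<le> v" for n v :: real
  proof -
    have "0 \<le> (sqrt \<epsilon> * n - sqrt v / sqrt \<epsilon>)\<^sup>2" by simp
    also have "\<dots> = \<epsilon> * n\<^sup>2 + v / \<epsilon> - 2 * (sqrt v * n)"
      using assms that by (simp add: power2_diff power_mult_distrib power_divide)
    finally show ?thesis by simp
  qed
  from *[OF V_nonneg, of "u p" "norm (ux p)"] *[OF V_nonneg, of "u p" "norm (uy p)"]
  show ?thesis by (simp add: energy_def grad_sq_def algebra_simps add_divide_distrib)
qed

text \<open>The equation is tested with the vector field \<open>\<tau>(|u - \<sigma>|\<^sup>2) (u - \<sigma>)\<close>
  times the cutoff.\<close>

lemma weighted_energy_estimate: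
  fixes u ux uy :: "real \<times> real \<Rightarrow> 'a"
  assumes r: "0 < r" and \<epsilon>: "0 < \<epsilon>" and sol: "solves \<epsilon> (square r) u ux uy" and \<sigma>: "\<sigma> \<in> Z"
    and \<tau>: "\<And>t. 0 \<le> t \<Longrightarrow> (\<tau> has_real_derivative \<tau>' t) (at t)" "continuous_on {0..} \<tau>'"
      "\<And>t. 0 \<le> t \<Longrightarrow> 0 \<le> \<tau> t" "\<And>t. 0 \<le> t \<Longrightarrow> \<tau> t \<le> 1"
      "\<And>t. 0 \<le> t \<Longrightarrow> \<tau>' t \<le> 0" "\<And>t. \<mu>\<^sup>2 \<le> t \<Longrightarrow> \<tau> t = 0"
  defines "q \<equiv> \<lambda>p. (norm (u p - \<sigma>))\<^sup>2"
  shows "integral (square r) (\<lambda>p. cutoff r p * ((\<tau> (q p) + 2 * q p * \<tau>' (q p)) * (\<epsilon> * grad_sq ux uy p)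
            + a / b * (\<tau> (q p) * V (u p) / \<epsilon>)))
      \<le> 4 / (r * sqrt a) * \<epsilon> * integral (square r) (energy \<epsilon> u ux uy)"
proof -
  obtain uxx uxy uyy where sol': "has_partials u ux uy (square r)" "has_partials ux uxx uxy (square r)"
      "has_partials uy uxy uyy (square r)" "continuous_on (square r) uxx" "continuous_on (square r) uyy"
      and pde: "\<And>p. p \<in> square r \<Longrightarrow> uxx p + uyy p = (1 / \<epsilon>\<^sup>2) *\<^sub>R gV (u p)"
    using sol has_partials_continuous unfolding solves_def by metis
  note cont = solves_continuous[OF sol]
  define w where "w = (\<lambda>p. u p - \<sigma>)"
  have q: "q = (\<lambda>p. w p \<bullet> w p)" by (simp add: q_def w_def power2_norm_eq_inner)
  have q0: "0 \<le> q p" for p by (simp add: q_def)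
  define F where "F = (\<lambda>p. bump r (fst p) * bump r (snd p) * (\<tau> (q p) * (w p \<bullet> ux p)))"
  define G where "G = (\<lambda>p. bump r (fst p) * bump r (snd p) * (\<tau> (q p) * (w p \<bullet> uy p)))"
  define Fx where "Fx = (\<lambda>p. bump' r (fst p) * bump r (snd p) * (\<tau> (q p) * (w p \<bullet> ux p))
     + cutoff r p * (\<tau>' (q p) * (2 * (w p \<bullet> ux p)) * (w p \<bullet> ux p) + \<tau> (q p) * (w p \<bullet> uxx p + ux p \<bullet> ux p)))"
  define Gy where "Gy = (\<lambda>p. bump r (fst p) * bump' r (snd p) * (\<tau> (q p) * (w p \<bullet> uy p))
     + cutoff r p * (\<tau>' (q p) * (2 * (w p \<bullet> uy p)) * (w p \<bullet> uy p) + \<tau> (q p) * (w p \<bullet> uyy p + uy p \<bullet> uy p)))"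
  have cw: "continuous_on (square r) w" unfolding w_def by (intro continuous_intros cont)
  have cq: "continuous_on (square r) q" unfolding q by (intro continuous_intros cw)
  have "continuous_on {0..} \<tau>" using \<tau>(1) by (meson DERIV_continuous atLeast_iff continuous_at_imp_continuous_on)
  then have c\<tau>: "continuous_on (square r) (\<lambda>p. \<tau> (q p))"
    by (rule continuous_on_compose2[OF _ cq]) (auto simp: q0)
  have c\<tau>': "continuous_on (square r) (\<lambda>p. \<tau>' (q p))"
    by (rule continuous_on_compose2[OF \<tau>(2) cq]) (auto simp: q0)
  have cF: "continuous_on (square r) Fx" "continuous_on (square r) Gy"
    unfolding Fx_def Gy_def
    by (intro continuous_intros cw c\<tau> c\<tau>' cutoff_cont sol' cont)+
  have div: "integral (square r) (\<lambda>p. Fx p + Gy p) = 0"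
  proof (rule divergence_square[OF r cF])
    fix x y assume xy: "(x, y) \<in> square r"
    have dw: "((\<lambda>t. w (t, y)) has_vector_derivative ux (x, y)) (at x)"
      unfolding w_def using has_partials_x[OF sol'(1) xy] by (auto intro!: derivative_eq_intros)
    have "((\<lambda>t. q (t, y)) has_real_derivative 2 * (w (x, y) \<bullet> ux (x, y))) (at x)"
      unfolding q using has_real_derivative_inner[OF dw dw] by (simp add: inner_commute)
    from DERIV_chain2[OF \<tau>(1)[OF q0] this]
    have d\<tau>: "((\<lambda>t. \<tau> (q (t, y))) has_real_derivative \<tau>' (q (x, y)) * (2 * (w (x, y) \<bullet> ux (x, y)))) (at x)" .
    show "((\<lambda>t. F (t, y)) has_real_derivative Fx (x, y)) (at x)"
      unfolding F_def Fx_def cutoff_def fst_conv snd_conv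
      by (rule DERIV_cong, rule DERIV_mult[OF DERIV_mult[OF bump_deriv DERIV_const] DERIV_mult[OF d\<tau> has_real_derivative_inner[OF dw has_partials_x[OF sol'(2) xy]]]])
        (simp add: algebra_simps)
    have dw: "((\<lambda>t. w (x, t)) has_vector_derivative uy (x, y)) (at y)"
      unfolding w_def using has_partials_y[OF sol'(1) xy] by (auto intro!: derivative_eq_intros)
    have "((\<lambda>t. q (x, t)) has_real_derivative 2 * (w (x, y) \<bullet> uy (x, y))) (at y)"
      unfolding q using has_real_derivative_inner[OF dw dw] by (simp add: inner_commute)
    from DERIV_chain2[OF \<tau>(1)[OF q0] this]
    have d\<tau>: "((\<lambda>t. \<tau> (q (x, t))) has_real_derivative \<tau>' (q (x, y)) * (2 * (w (x, y) \<bullet> uy (x, y)))) (at y)" .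
    show "((\<lambda>t. G (x, t)) has_real_derivative Gy (x, y)) (at y)"
      unfolding G_def Gy_def cutoff_def fst_conv snd_conv
      by (rule DERIV_cong, rule DERIV_mult[OF DERIV_mult[OF DERIV_const bump_deriv] DERIV_mult[OF d\<tau> has_real_derivative_inner[OF dw has_partials_y[OF sol'(3) xy]]]])
        (simp add: algebra_simps)
  qed (use r in \<open>auto simp: F_def G_def\<close>)
  define J where "J = (\<lambda>p. cutoff r p * ((\<tau> (q p) + 2 * q p * \<tau>' (q p)) * (\<epsilon> * grad_sq ux uy p)
            + a / b * (\<tau> (q p) * V (u p) / \<epsilon>)))"
  have pw: "J p \<le> \<epsilon> * (Fx p + Gy p) + 4 / (r * sqrt a) * \<epsilon> * energy \<epsilon> u ux uy p" if p: "p \<in> square r" for p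
  proof -
    let ?t = "\<tau> (q p)" and ?t' = "\<tau>' (q p)" and ?c = "cutoff r p"
    have t: "0 \<le> ?t" "?t' \<le> 0" using \<tau>(3,5) q0 by auto
    have c: "0 \<le> ?c" by (rule cutoff_bounds)
    have CS: "(w p \<bullet> ux p)\<^sup>2 + (w p \<bullet> uy p)\<^sup>2 \<le> q p * grad_sq ux uy p"
      using Cauchy_Schwarz_ineq[of "w p" "ux p"] Cauchy_Schwarz_ineq[of "w p" "uy p"]
      by (simp add: q grad_sq_def power2_norm_eq_inner distrib_left)
    \<comment> \<open>As \<open>\<tau>'\<close> is nonpositive, the Cauchy-Schwarz bound turns into
      a lower bound for the term in which the weight is differentiated.\<close>
    have A: "2 * q p * ?t' * grad_sq ux uy p \<le> 2 * ?t' * ((w p \<bullet> ux p)\<^sup>2 + (w p \<bullet> uy p)\<^sup>2)"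
      using mult_left_mono_neg[OF CS, of "2 * ?t'"] t by (simp add: algebra_simps)
    \<comment> \<open>Where the weight is nonzero, \<open>q p\<close> is below
      \<open>\<mu>\<^sup>2\<close> and both sides compare with \<open>a * q p\<close>. This is where
      the ratio \<open>a / b\<close> comes from.\<close>
    have B: "a / b * (?t * V (u p)) \<le> ?t * (w p \<bullet> gV (u p))"
    proof (cases "q p < \<mu>\<^sup>2")
      case True
      then have n: "norm (u p - \<sigma>) \<le> \<mu>" using pos(1) unfolding q_def
        by (meson abs_le_square_iff abs_of_pos abs_norm_cancel less_imp_le power_less_imp_less_base pos(1))
      have "a / b * V (u p) \<le> a / b * (b * q p)"
        using near_upper[OF \<sigma> n] pos by (intro mult_left_mono) (auto simp: q_def)
      also have "\<dots> = a * q p" using pos by simp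
      also have "\<dots> \<le> w p \<bullet> gV (u p)" using near_grad[OF \<sigma> n] by (simp add: q_def w_def)
      finally have "?t * (a / b * V (u p)) \<le> ?t * (w p \<bullet> gV (u p))" by (rule mult_left_mono) (rule t)
      then show ?thesis by (simp add: mult.commute mult.left_commute)
    next
      case False then show ?thesis using \<tau>(6) by simp
    qed
    \<comment> \<open>This makes the cutoff error as good as it is: the length of the field is
      absorbed into the square root of the potential, the error becomes a multiple of the energy
      density, and multiplying by \<epsilon> gives the gain of one power of \<epsilon>.\<close>
    have Q: "?t * norm (w p) \<le> sqrt (V (u p)) / sqrt a"
    proof (cases "q p < \<mu>\<^sup>2")
      case True
      then have n: "norm (u p - \<sigma>) \<le> \<mu>" using pos(1) unfolding q_def
        by (meson abs_le_square_iff abs_of_pos abs_norm_cancel less_imp_le power_less_imp_less_base pos(1))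
      have "(sqrt a * norm (w p))\<^sup>2 \<le> V (u p)"
        using near_lower[OF \<sigma> n] pos by (simp add: power_mult_distrib w_def)
      then have "sqrt a * norm (w p) \<le> sqrt (V (u p))" by (rule real_le_rsqrt)
      then have 1: "norm (w p) \<le> sqrt (V (u p)) / sqrt a" using pos by (simp add: field_simps)
      have "?t * norm (w p) \<le> 1 * norm (w p)" using \<tau>(4) q0 by (intro mult_right_mono) auto
      with 1 show ?thesis by simp
    next
      case False then show ?thesis using \<tau>(6) pos V_nonneg by simp
    qed
    have Err: "\<bar>e1 * e2 * (?t * (w p \<bullet> h))\<bar> \<le> 4 / (r * sqrt a) * (sqrt (V (u p)) * norm h)"
      if "\<bar>e1\<bar> * \<bar>e2\<bar> \<le> 4 / r" for e1 e2 h
    proof -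
      have "\<bar>e1 * e2 * (?t * (w p \<bullet> h))\<bar> = (\<bar>e1\<bar> * \<bar>e2\<bar>) * (?t * \<bar>w p \<bullet> h\<bar>)"
        using t by (simp add: abs_mult)
      also have "\<dots> \<le> 4 / r * (?t * (norm (w p) * norm h))"
        using that t r by (intro mult_mono mult_left_mono Cauchy_Schwarz_ineq2) auto
      also have "\<dots> = 4 / r * ((?t * norm (w p)) * norm h)" by simp
      also have "\<dots> \<le> 4 / r * ((sqrt (V (u p)) / sqrt a) * norm h)"
        using r by (intro mult_left_mono mult_right_mono Q) auto
      finally show ?thesis by (simp add: field_simps)
    qed
    have b1: "\<bar>bump' r (fst p)\<bar> * \<bar>bump r (snd p)\<bar> \<le> 4 / r" "\<bar>bump r (fst p)\<bar> * \<bar>bump' r (snd p)\<bar> \<le> 4 / r"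
      using mult_mono[OF bump'_bound[OF r, of "fst p"] bump_bounds(2)[of r "snd p"]]
        mult_mono[OF bump_bounds(2)[of r "fst p"] bump'_bound[OF r, of "snd p"]] bump_bounds(1) r by auto
    define E1 where "E1 = bump' r (fst p) * bump r (snd p) * (?t * (w p \<bullet> ux p)) + bump r (fst p) * bump' r (snd p) * (?t * (w p \<bullet> uy p))"
    have "\<bar>E1\<bar> \<le> 4 / (r * sqrt a) * (sqrt (V (u p)) * norm (ux p)) + 4 / (r * sqrt a) * (sqrt (V (u p)) * norm (uy p))"
      unfolding E1_def using Err[OF b1(1), of "ux p"] Err[OF b1(2), of "uy p"] by linarith
    also have "\<dots> = 4 / (r * sqrt a) * (sqrt (V (u p)) * (norm (ux p) + norm (uy p)))" by (simp add: distrib_left)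
    also have "\<dots> \<le> 4 / (r * sqrt a) * energy \<epsilon> u ux uy p"
      using r pos by (intro mult_left_mono sqrt_V_gradient_le_energy \<epsilon>) auto
    finally have E1: "- E1 \<le> 4 / (r * sqrt a) * energy \<epsilon> u ux uy p" by linarith
    have lap: "w p \<bullet> uxx p + w p \<bullet> uyy p = (w p \<bullet> gV (u p)) / \<epsilon>\<^sup>2"
      using pde[OF p] by (metis inner_add_right inner_scaleR_right mult.commute times_divide_eq_right mult_1_right)
    have FG: "Fx p + Gy p = E1 + ?c * (2 * ?t' * ((w p \<bullet> ux p)\<^sup>2 + (w p \<bullet> uy p)\<^sup>2) + ?t * grad_sq ux uy p
         + ?t * (w p \<bullet> uxx p + w p \<bullet> uyy p))"
      unfolding Fx_def Gy_def E1_def grad_sq_def power2_norm_eq_inner by (simp add: algebra_simps power2_eq_square)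
    have "J p = ?c * (\<epsilon> * (?t * grad_sq ux uy p) + \<epsilon> * (2 * q p * ?t' * grad_sq ux uy p) + (a / b * (?t * V (u p))) / \<epsilon>)"
      unfolding J_def by (simp add: algebra_simps)
    also have "\<dots> \<le> ?c * (\<epsilon> * (?t * grad_sq ux uy p) + \<epsilon> * (2 * ?t' * ((w p \<bullet> ux p)\<^sup>2 + (w p \<bullet> uy p)\<^sup>2)) + (?t * (w p \<bullet> gV (u p))) / \<epsilon>)"
      using A B \<epsilon> c t by (intro mult_left_mono add_mono divide_right_mono) auto
    also have "(?t * (w p \<bullet> gV (u p))) / \<epsilon> = \<epsilon> * (?t * (w p \<bullet> uxx p + w p \<bullet> uyy p))"
      unfolding lap using \<epsilon> by (simp add: power2_eq_square)
    also have "?c * (\<epsilon> * (?t * grad_sq ux uy p) + \<epsilon> * (2 * ?t' * ((w p \<bullet> ux p)\<^sup>2 + (w p \<bullet> uy p)\<^sup>2)) + \<epsilon> * (?t * (w p \<bullet> uxx p + w p \<bullet> uyy p)))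
       = \<epsilon> * (Fx p + Gy p) + \<epsilon> * (- E1)"
      unfolding FG by (simp add: algebra_simps)
    also have "\<dots> \<le> \<epsilon> * (Fx p + Gy p) + \<epsilon> * (4 / (r * sqrt a) * energy \<epsilon> u ux uy p)"
      using E1 \<epsilon> by (intro add_left_mono mult_left_mono) auto
    finally show ?thesis by (simp add: mult.left_commute mult.assoc)
  qed
  have cJ: "continuous_on (square r) J" unfolding J_def divide_inverse
    by (intro continuous_intros cutoff_cont c\<tau> c\<tau>' cq cont)
  have "integral (square r) J \<le> integral (square r) (\<lambda>p. \<epsilon> * (Fx p + Gy p) + 4 / (r * sqrt a) * \<epsilon> * energy \<epsilon> u ux uy p)"
    using pw by (intro integral_le integrable_continuous continuous_intros cJ cF cont) auto
  also have "\<dots> = \<epsilon> * integral (square r) (\<lambda>p. Fx p + Gy p) + 4 / (r * sqrt a) * \<epsilon> * integral (square r) (energy \<epsilon> u ux uy)"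
    using cF cont(6) r pos by (subst integral_add) (auto intro!: integrable_continuous continuous_intros)
  finally show ?thesis using div by (simp add: J_def)
qed

end

section \<open>Lines of small energy and the maximum principle\<close>

lemma has_partials_affine:
  assumes f: "has_partials f fx fy S" and sub: "\<And>p. p \<in> T \<Longrightarrow> c + R *\<^sub>R p \<in> S"
  shows "has_partials (\<lambda>p. k *\<^sub>R f (c + R *\<^sub>R p)) (\<lambda>p. (k * R) *\<^sub>R fx (c + R *\<^sub>R p))
    (\<lambda>p. (k * R) *\<^sub>R fy (c + R *\<^sub>R p)) T"
  unfolding has_partials_def
proof
  fix p assume "p \<in> T"
  then have "(f has_derivative (\<lambda>h. fst h *\<^sub>R fx (c + R *\<^sub>R p) + snd h *\<^sub>R fy (c + R *\<^sub>R p))) (at (c + R *\<^sub>R p))"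
    using f sub by (auto simp: has_partials_def)
  moreover have "((\<lambda>p. c + R *\<^sub>R p) has_derivative (\<lambda>h. R *\<^sub>R h)) (at p)"
    by (auto intro!: derivative_eq_intros)
  ultimately have "((\<lambda>p. f (c + R *\<^sub>R p)) has_derivative
      (\<lambda>h. fst (R *\<^sub>R h) *\<^sub>R fx (c + R *\<^sub>R p) + snd (R *\<^sub>R h) *\<^sub>R fy (c + R *\<^sub>R p))) (at p)"
    using diff_chain_at[of "\<lambda>p. c + R *\<^sub>R p" "\<lambda>h. R *\<^sub>R h" p f] by (fastforce simp: o_def)
  then have "((\<lambda>p. k *\<^sub>R f (c + R *\<^sub>R p)) has_derivative
      (\<lambda>h. k *\<^sub>R (fst (R *\<^sub>R h) *\<^sub>R fx (c + R *\<^sub>R p) + snd (R *\<^sub>R h) *\<^sub>R fy (c + R *\<^sub>R p)))) (at p)"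
    by (rule has_derivative_scaleR_right)
  then show "((\<lambda>p. k *\<^sub>R f (c + R *\<^sub>R p)) has_derivative
      (\<lambda>h. fst h *\<^sub>R (k * R) *\<^sub>R fx (c + R *\<^sub>R p) + snd h *\<^sub>R (k * R) *\<^sub>R fy (c + R *\<^sub>R p))) (at p)"
    by (rule has_derivative_eq_rhs) (auto simp: fun_eq_iff scaleR_add_right mult_ac)
qed

text \<open>A second derivative is assumed at \<open>x\<close> only. If it were positive,
  \<open>g'\<close> would be positive just to the right of its zero \<open>x\<close>, and the mean
  value theorem would give a larger value of \<open>g\<close>.\<close>

lemma second_derivative_nonpos_at_max:
  fixes g :: "real \<Rightarrow> real"
  assumes d: "0 < d" and max: "\<And>t. \<bar>t - x\<bar> < d \<Longrightarrow> g t \<le> g x"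
    and g: "\<And>t. \<bar>t - x\<bar> < d \<Longrightarrow> (g has_real_derivative g' t) (at t)"
    and g': "(g' has_real_derivative g'') (at x)"
  shows "g'' \<le> 0"
proof (rule ccontr)
  assume "\<not> g'' \<le> 0"
  then obtain \<delta> where \<delta>: "0 < \<delta>" "\<And>h. 0 < h \<Longrightarrow> h < \<delta> \<Longrightarrow> g' x < g' (x + h)"
    using DERIV_pos_inc_right[OF g'] by (auto simp: not_le)
  have "g' x = 0"
    using DERIV_local_max[OF g[of x] d] max d by (auto simp: abs_minus_commute)
  define h where "h = min d \<delta> / 2"
  have h: "0 < h" "h < d" "h < \<delta>" using d \<delta> by (auto simp: h_def)
  have "\<exists>z>x. z < x + h \<and> g (x + h) - g x = (x + h - x) * g' z"
    using h by (intro MVT2 g) auto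
  then obtain z where z: "x < z" "z < x + h" "g (x + h) - g x = h * g' z" by auto
  then have "0 < g' z" using \<delta>(2)[of "z - x"] h \<open>g' x = 0\<close> by auto
  then have "g x < g (x + h)" using z h by (metis diff_gt_0_iff_gt mult_pos_pos)
  then show False using max[of "x + h"] h by auto
qed

context potential
begin

text \<open>The Laplacian gains \<open>R * R\<close>, so magnifying a small square enlarges the
  parameter: \<open>\<epsilon>\<close> becomes \<open>\<epsilon> / R\<close>. Every change of scale
  below rests on this.\<close>

lemma solves_affine:
  assumes sol: "solves \<epsilon> S u ux uy" and R: "0 < R" and sub: "\<And>p. p \<in> T \<Longrightarrow> c + R *\<^sub>R p \<in> S"
  shows "solves (\<epsilon> / R) T (\<lambda>p. u (c + R *\<^sub>R p)) (\<lambda>p. R *\<^sub>R ux (c + R *\<^sub>R p)) (\<lambda>p. R *\<^sub>R uy (c + R *\<^sub>R p))"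
proof -
  obtain uxx uxy uyy uxxx uxxy uxyy uyyy where s: "has_partials u ux uy S" "has_partials ux uxx uxy S"
      "has_partials uy uxy uyy S" "has_partials uxx uxxx uxxy S" "has_partials uxy uxxy uxyy S"
      "has_partials uyy uxyy uyyy S" and pde: "\<forall>p\<in>S. uxx p + uyy p = (1 / \<epsilon>\<^sup>2) *\<^sub>R gV (u p)"
    using sol unfolding solves_def by auto
  let ?s = "\<lambda>k (f :: real \<times> real \<Rightarrow> 'a) p. k *\<^sub>R f (c + R *\<^sub>R p)"
  have "has_partials (?s 1 u) (?s R ux) (?s R uy) T"
    "has_partials (?s R ux) (?s (R * R) uxx) (?s (R * R) uxy) T"
    "has_partials (?s R uy) (?s (R * R) uxy) (?s (R * R) uyy) T"
    "has_partials (?s (R * R) uxx) (?s (R * R * R) uxxx) (?s (R * R * R) uxxy) T"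
    "has_partials (?s (R * R) uxy) (?s (R * R * R) uxxy) (?s (R * R * R) uxyy) T"
    "has_partials (?s (R * R) uyy) (?s (R * R * R) uxyy) (?s (R * R * R) uyyy) T"
    using has_partials_affine[OF s(1) sub, where k = 1]
      has_partials_affine[OF s(2) sub, where k = R] has_partials_affine[OF s(3) sub, where k = R]
      has_partials_affine[OF s(4) sub, where k = "R * R"] has_partials_affine[OF s(5) sub, where k = "R * R"]
      has_partials_affine[OF s(6) sub, where k = "R * R"]
    by simp_all
  moreover have "\<forall>p\<in>T. ?s (R * R) uxx p + ?s (R * R) uyy p = (1 / (\<epsilon> / R)\<^sup>2) *\<^sub>R gV (u (c + R *\<^sub>R p))"
    using pde sub R by (simp add: scaleR_add_right[symmetric] power2_eq_square)
  ultimately show ?thesis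
    unfolding solves_def
    by (rule_tac x = "?s (R * R) uxx" in exI, rule_tac x = "?s (R * R) uxy" in exI,
        rule_tac x = "?s (R * R) uyy" in exI, rule_tac x = "?s (R * R * R) uxxx" in exI,
        rule_tac x = "?s (R * R * R) uxxy" in exI, rule_tac x = "?s (R * R * R) uxyy" in exI,
        rule_tac x = "?s (R * R * R) uyyy" in exI) simp
qed

text \<open>The squared distance to the zero is at most \<open>\<eta> / (2 * a)\<close> at the best
  point of the line and, after truncation, varies by at most \<open>2 / sqrt a * \<eta>\<close>. The
  factor 3 undoes the truncation, which keeps at least a third of its argument below
  \<open>\<mu>\<^sup>2\<close>.\<close>

definition line_const :: real where
  "line_const = 3 * (1 / (2 * a) + 2 / sqrt a)"

lemma line_const_pos: "0 < line_const"
  using pos unfolding line_const_def by (intro mult_pos_pos add_pos_pos) auto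

lemma near_some_zero:
  assumes "V y < v0" obtains \<sigma> where "\<sigma> \<in> Z" "norm (y - \<sigma>) < \<mu> / 8"
  using far[of y] assms by (meson not_le)

text \<open>The truncation \<open>\<omega>\<close> of \<open>t \<mapsto> t\<close> at height \<open>\<mu>\<^sup>2 / 3\<close> makes \<open>|(\<omega> |f - \<sigma>|\<^sup>2)'|\<close> at most a
  multiple of \<open>sqrt (V f) * |f'|\<close> everywhere, so that no continuity argument is needed.\<close>

lemma line_near_zero:
  fixes f :: "real \<Rightarrow> 'a"
  assumes f: "\<And>t. \<bar>t\<bar> \<le> 1 \<Longrightarrow> (f has_vector_derivative f' t) (at t)"
    and e: "continuous_on {-1..1} e" "\<And>t. \<bar>t\<bar> \<le> 1 \<Longrightarrow> V (f t) \<le> e t"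
      "\<And>t. \<bar>t\<bar> \<le> 1 \<Longrightarrow> sqrt (V (f t)) * norm (f' t) \<le> e t"
    and \<eta>: "integral {-1..1} e \<le> \<eta>" "\<eta> \<le> v0" "line_const * \<eta> < \<mu>\<^sup>2"
  shows "\<exists>\<sigma>\<in>Z. \<forall>t. \<bar>t\<bar> \<le> 1 \<longrightarrow> (norm (f t - \<sigma>))\<^sup>2 \<le> line_const * \<eta>"
proof -
  have ei: "e integrable_on {-1..1}" using e(1) by (rule integrable_continuous_real)
  have "{-1..1::real} \<noteq> {}" by simp
  from continuous_attains_inf[OF compact_Icc this e(1)]
  obtain t0 where "t0 \<in> {-1..1}" "\<forall>t\<in>{-1..1}. e t0 \<le> e t" by blast
  then have t0: "\<bar>t0\<bar> \<le> 1" "\<And>t. \<bar>t\<bar> \<le> 1 \<Longrightarrow> e t0 \<le> e t"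
    by (simp_all add: abs_le_iff)
  \<comment> \<open>The interval has length 2, so the minimum of \<open>e\<close> is at most
    \<open>\<eta> / 2\<close>. The zero \<sigma> is the one found at the minimum point.\<close>
  have "integral {-1..1} (\<lambda>t::real. e t0) \<le> integral {-1..1} e"
    using ei t0 by (intro integral_le) auto
  then have et0: "e t0 \<le> \<eta> / 2" using \<eta> by simp
  have ge0: "0 \<le> e t" if "\<bar>t\<bar> \<le> 1" for t using e(2)[OF that] V_nonneg[of "f t"] by linarith
  have \<eta>0: "0 \<le> \<eta>" using ge0[OF t0(1)] et0 by linarith
  have Vt0: "V (f t0) \<le> \<eta> / 2" using e(2)[OF t0(1)] et0 by linarith
  then have "V (f t0) < v0" using \<eta> pos by linarith
  then obtain \<sigma> where \<sigma>: "\<sigma> \<in> Z" "norm (f t0 - \<sigma>) < \<mu> / 8" by (rule near_some_zero)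
  define q where "q = (\<lambda>t. (f t - \<sigma>) \<bullet> (f t - \<sigma>))"
  have q: "q t = (norm (f t - \<sigma>))\<^sup>2" for t by (simp add: q_def power2_norm_eq_inner)
  define \<omega> where "\<omega> = (\<lambda>t. \<mu>\<^sup>2 / 3 * (1 - (max 0 (1 - t * inverse (\<mu>\<^sup>2)))^3))"
  define \<omega>' where "\<omega>' = (\<lambda>t. (max 0 (1 - t * inverse (\<mu>\<^sup>2)))\<^sup>2)"
  have \<omega>: "(\<omega> has_real_derivative \<omega>' t) (at t)" for t
  proof -
    have "((\<lambda>t. 1 - t * inverse (\<mu>\<^sup>2)) has_real_derivative - inverse (\<mu>\<^sup>2)) (at t)"
      by (rule derivative_eq_intros refl)+ simp
    from DERIV_chain2[OF has_real_derivative_pos_cube this]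
    have d: "((\<lambda>t. (max 0 (1 - t * inverse (\<mu>\<^sup>2)))^3) has_real_derivative
        3 * \<omega>' t * - inverse (\<mu>\<^sup>2)) (at t)" by (simp add: \<omega>'_def)
    show ?thesis unfolding \<omega>_def
      by (rule DERIV_cong, rule DERIV_cmult[OF DERIV_diff[OF DERIV_const d]]) (use pos in simp)
  qed
  have q0: "q t0 \<le> (\<eta> / 2) / a"
  proof -
    have "a * q t0 \<le> V (f t0)" using near_lower[OF \<sigma>(1), of "f t0"] \<sigma>(2) pos by (simp add: q)
    then have "q t0 * a \<le> \<eta> / 2" using Vt0 by (simp only: mult.commute)
    then show ?thesis by (simp only: pos_le_divide_eq[OF pos(2)])
  qed
  have W: "\<bar>\<omega> (q t) - \<omega> (q s)\<bar> \<le> 2 / sqrt a * \<eta>" if st: "-1 \<le> s" "s \<le> t" "t \<le> 1" for s t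
  proof -
    define W' where "W' = (\<lambda>t. \<omega>' (q t) * (2 * ((f t - \<sigma>) \<bullet> f' t)))"
    have dW: "((\<lambda>t. \<omega> (q t)) has_real_derivative W' t) (at t)" if "\<bar>t\<bar> \<le> 1" for t
    proof -
      have dw: "((\<lambda>t. f t - \<sigma>) has_vector_derivative f' t) (at t)"
        using f[OF that] by (auto intro!: derivative_eq_intros)
      have "(q has_real_derivative 2 * ((f t - \<sigma>) \<bullet> f' t)) (at t)"
        unfolding q_def using has_real_derivative_inner[OF dw dw] by (simp add: inner_commute)
      from DERIV_chain2[OF \<omega> this] show ?thesis by (simp add: W'_def)
    qed
    have bound: "\<bar>W' t\<bar> \<le> 2 / sqrt a * e t" if "\<bar>t\<bar> \<le> 1" for t
    proof -
      have b1: "\<omega>' (q t) * norm (f t - \<sigma>) \<le> sqrt (V (f t)) / sqrt a"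
      proof (cases "norm (f t - \<sigma>) \<le> \<mu>")
        case True
        have "(sqrt a * norm (f t - \<sigma>))\<^sup>2 \<le> V (f t)"
          using near_lower[OF \<sigma>(1) True] pos by (simp add: power_mult_distrib)
        then have "sqrt a * norm (f t - \<sigma>) \<le> sqrt (V (f t))" by (rule real_le_rsqrt)
        then have 1: "norm (f t - \<sigma>) \<le> sqrt (V (f t)) / sqrt a" using pos by (simp add: field_simps)
        have "\<omega>' (q t) \<le> 1" unfolding \<omega>'_def using pos by (intro power_le_one) (auto simp: q)
        then have "\<omega>' (q t) * norm (f t - \<sigma>) \<le> 1 * norm (f t - \<sigma>)" by (intro mult_right_mono) auto
        with 1 show ?thesis by simp
      next
        case False
        then have "\<mu>\<^sup>2 \<le> q t" using pos unfolding q by (intro power_mono) auto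
        then have "\<omega>' (q t) = 0" using pos by (simp add: \<omega>'_def field_simps)
        then show ?thesis using pos V_nonneg by simp
      qed
      have "\<bar>W' t\<bar> = \<omega>' (q t) * (2 * \<bar>(f t - \<sigma>) \<bullet> f' t\<bar>)"
        by (simp add: W'_def abs_mult \<omega>'_def)
      also have "\<dots> \<le> \<omega>' (q t) * (2 * (norm (f t - \<sigma>) * norm (f' t)))"
        by (intro mult_left_mono Cauchy_Schwarz_ineq2) (auto simp: \<omega>'_def)
      also have "\<dots> = 2 * ((\<omega>' (q t) * norm (f t - \<sigma>)) * norm (f' t))" by simp
      also have "\<dots> \<le> 2 * ((sqrt (V (f t)) / sqrt a) * norm (f' t))"
        by (intro mult_left_mono mult_right_mono b1) auto
      also have "\<dots> = 2 / sqrt a * (sqrt (V (f t)) * norm (f' t))" by simp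
      also have "\<dots> \<le> 2 / sqrt a * e t" using pos by (intro mult_left_mono e(3) that) auto
      finally show ?thesis .
    qed
    have est: "e integrable_on {s..t}"
      using e(1) st by (intro integrable_continuous_real) (auto elim!: continuous_on_subset)
    have hi: "(W' has_integral (\<omega> (q t) - \<omega> (q s))) {s..t}"
      using st by (intro fundamental_theorem_of_calculus)
        (auto intro!: has_vector_derivative_at_within dW[unfolded has_real_derivative_iff_has_vector_derivative] simp: abs_le_iff)
    have "norm (integral {s..t} W') \<le> integral {s..t} (\<lambda>t. 2 / sqrt a * e t)"
    proof (rule integral_norm_bound_integral)
      show "W' integrable_on {s..t}" using hi by blast
      show "(\<lambda>t. 2 / sqrt a * e t) integrable_on {s..t}" using est by (rule integrable_on_mult_right)
      show "norm (W' x) \<le> 2 / sqrt a * e x" if "x \<in> {s..t}" for x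
        unfolding real_norm_def by (rule bound) (use that st in auto)
    qed
    also have "\<dots> = 2 / sqrt a * integral {s..t} e" by simp
    also have "\<dots> \<le> 2 / sqrt a * integral {-1..1} e"
      using st ei est ge0 pos by (intro mult_left_mono integral_subset_le) (auto simp: abs_le_iff)
    also have "\<dots> \<le> 2 / sqrt a * \<eta>" using \<eta> pos by (intro mult_left_mono) auto
    finally show ?thesis using hi by (simp add: integral_unique)
  qed
  have W0: "\<omega> (q t) - \<omega> (q t0) \<le> 2 / sqrt a * \<eta>" if "\<bar>t\<bar> \<le> 1" for t
    using W[of t t0] W[of t0 t] that t0(1) by (cases "t \<le> t0") (auto simp: abs_le_iff)
  have \<omega>le: "\<omega> s \<le> s" if "0 \<le> s" "s \<le> \<mu>\<^sup>2" for s
  proof -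
    define x where "x = s * inverse (\<mu>\<^sup>2)"
    have x: "0 \<le> x" "x \<le> 1" "s = \<mu>\<^sup>2 * x" using that pos by (auto simp: x_def field_simps)
    have "0 \<le> x * x * (3 - x)" using x by (intro mult_nonneg_nonneg) auto
    then have "1 - (max 0 (1 - x))^3 \<le> 3 * x" using x by (simp add: power3_eq_cube max_def algebra_simps)
    then have "\<mu>\<^sup>2 / 3 * (1 - (max 0 (1 - x))^3) \<le> \<mu>\<^sup>2 / 3 * (3 * x)" by (intro mult_left_mono) auto
    then have "\<omega> s \<le> \<mu>\<^sup>2 * x" unfolding \<omega>_def x_def[symmetric] by simp
    then show ?thesis using x(3) by simp
  qed
  have qt0: "q t0 \<le> \<mu>\<^sup>2" unfolding q using \<sigma>(2) pos by (intro power_mono) auto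
  have main: "q t \<le> line_const * \<eta>" if t: "\<bar>t\<bar> \<le> 1" for t
  proof -
    define m where "m = max 0 (1 - q t * inverse (\<mu>\<^sup>2))"
    have m: "0 \<le> m" "m \<le> 1" using pos by (auto simp: m_def q)
    have "\<omega> (q t) \<le> (\<eta> / 2) / a + 2 / sqrt a * \<eta>"
      using W0[OF t] q0 \<omega>le[of "q t0"] qt0 by (auto simp: q)
    also have "\<dots> = line_const * \<eta> / 3" by (simp add: line_const_def algebra_simps)
    finally have "\<mu>\<^sup>2 * (1 - m^3) \<le> line_const * \<eta>" unfolding \<omega>_def m_def[symmetric] by simp
    moreover have "m^3 \<le> m" using m power_decreasing[of 1 3 m] by simp
    then have "\<mu>\<^sup>2 * (1 - m) \<le> \<mu>\<^sup>2 * (1 - m^3)" by (intro mult_left_mono) auto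
    ultimately have le: "\<mu>\<^sup>2 * (1 - m) \<le> line_const * \<eta>" by linarith
    \<comment> \<open>At \<open>m = 0\<close> the truncation is saturated and the inequality would
      read \<open>\<mu>\<^sup>2 \<le> line_const * \<eta>\<close>, against the choice of
      \<eta>.\<close>
    have "m \<noteq> 0" using le \<eta>(3) by auto
    then have "m = 1 - q t * inverse (\<mu>\<^sup>2)" by (auto simp: m_def max_def split: if_splits)
    then have "\<mu>\<^sup>2 * (1 - m) = q t" using pos by simp
    with le show ?thesis by simp
  qed
  show ?thesis using \<sigma>(1) main by (auto simp: q)
qed

lemma zero_unique:
  assumes "\<sigma> \<in> Z" "\<sigma>' \<in> Z" "norm (y - \<sigma>) \<le> \<mu>" "norm (y - \<sigma>') \<le> \<mu>"
  shows "\<sigma> = \<sigma>'"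
proof (rule ccontr)
  assume "\<sigma> \<noteq> \<sigma>'"
  then have "2 * \<mu> < norm (\<sigma> - \<sigma>')" using assms by (intro separated)
  also have "\<dots> \<le> norm (y - \<sigma>) + norm (y - \<sigma>')"
    using norm_triangle_ineq4[of "y - \<sigma>'" "y - \<sigma>"] by simp
  finally show False using assms by simp
qed

text \<open>At an interior maximum of \<open>|u|\<^sup>2\<close> both second derivatives are
  nonpositive, yet their sum is twice \<open>|ux|\<^sup>2 + |uy|\<^sup>2 + (u \<bullet> gV u) /
  \<epsilon>\<^sup>2\<close>, which \<open>radial\<close> makes positive as soon as the norm exceeds
  \<open>M\<close>.\<close>

lemma box_maximum_principle:
  assumes \<epsilon>: "0 < \<epsilon>" and sol: "solves \<epsilon> (cbox (x0, y0) (x1, y1)) u ux uy"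
    and bd: "\<And>x y. x0 \<le> x \<Longrightarrow> x \<le> x1 \<Longrightarrow> y0 \<le> y \<Longrightarrow> y \<le> y1 \<Longrightarrow>
       x = x0 \<or> x = x1 \<or> y = y0 \<or> y = y1 \<Longrightarrow> norm (u (x, y)) \<le> M"
    and p: "p \<in> cbox (x0, y0) (x1, y1)"
  shows "norm (u p) \<le> M"
proof (rule ccontr)
  assume *: "\<not> norm (u p) \<le> M"
  let ?B = "cbox (x0, y0) (x1, y1)"
  obtain uxx uxy uyy where s: "has_partials u ux uy ?B" "has_partials ux uxx uxy ?B"
      "has_partials uy uxy uyy ?B" and pde: "\<And>p. p \<in> ?B \<Longrightarrow> uxx p + uyy p = (1 / \<epsilon>\<^sup>2) *\<^sub>R gV (u p)"
    using sol unfolding solves_def by metis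
  have "continuous_on ?B (\<lambda>p. norm (u p))" using solves_continuous[OF sol] by (intro continuous_intros)
  from continuous_attains_sup[OF compact_cbox _ this] p obtain z where
    z: "z \<in> ?B" "\<And>p. p \<in> ?B \<Longrightarrow> norm (u p) \<le> norm (u z)" by blast
  obtain x y where zxy: "z = (x, y)" by (cases z)
  have big: "M < norm (u z)" using * z(2)[OF p] by linarith
  then have int: "x0 < x" "x < x1" "y0 < y" "y < y1"
    using bd[of x y] z(1) by (auto simp: zxy cbox_Pair_eq order_less_le)
  define d where "d = min (min (x - x0) (x1 - x)) (min (y - y0) (y1 - y))"
  have d: "0 < d" using int by (simp add: d_def)
  have inB: "(t, y) \<in> ?B" if "\<bar>t - x\<bar> < d" for t using that int by (auto simp: d_def cbox_Pair_eq)
  have inB': "(x, t) \<in> ?B" if "\<bar>t - y\<bar> < d" for t using that int by (auto simp: d_def cbox_Pair_eq)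
  have n: "u p \<bullet> u p \<le> u z \<bullet> u z" if "p \<in> ?B" for p
    using z(2)[OF that] by (simp add: norm_eq_sqrt_inner)
  have "u z \<bullet> uxx z + ux z \<bullet> ux z + (ux z \<bullet> ux z + uxx z \<bullet> u z) \<le> 0"
    unfolding zxy
  proof (rule second_derivative_nonpos_at_max[OF d, of x "\<lambda>t. u (t, y) \<bullet> u (t, y)"])
    show "((\<lambda>t. u (t, y) \<bullet> u (t, y)) has_real_derivative (u (t, y) \<bullet> ux (t, y) + ux (t, y) \<bullet> u (t, y))) (at t)"
      if "\<bar>t - x\<bar> < d" for t
      by (intro has_real_derivative_inner has_partials_x[OF s(1)] inB that)
    show "((\<lambda>t. u (t, y) \<bullet> ux (t, y) + ux (t, y) \<bullet> u (t, y)) has_real_derivative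
       u (x, y) \<bullet> uxx (x, y) + ux (x, y) \<bullet> ux (x, y) + (ux (x, y) \<bullet> ux (x, y) + uxx (x, y) \<bullet> u (x, y))) (at x)"
      using d by (intro DERIV_add has_real_derivative_inner has_partials_x[OF s(1)] has_partials_x[OF s(2)] inB) auto
  qed (use n inB zxy in auto)
  moreover have "u z \<bullet> uyy z + uy z \<bullet> uy z + (uy z \<bullet> uy z + uyy z \<bullet> u z) \<le> 0"
    unfolding zxy
  proof (rule second_derivative_nonpos_at_max[OF d, of y "\<lambda>t. u (x, t) \<bullet> u (x, t)"])
    show "((\<lambda>t. u (x, t) \<bullet> u (x, t)) has_real_derivative (u (x, t) \<bullet> uy (x, t) + uy (x, t) \<bullet> u (x, t))) (at t)"
      if "\<bar>t - y\<bar> < d" for t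
      by (intro has_real_derivative_inner has_partials_y[OF s(1)] inB' that)
    show "((\<lambda>t. u (x, t) \<bullet> uy (x, t) + uy (x, t) \<bullet> u (x, t)) has_real_derivative
       u (x, y) \<bullet> uyy (x, y) + uy (x, y) \<bullet> uy (x, y) + (uy (x, y) \<bullet> uy (x, y) + uyy (x, y) \<bullet> u (x, y))) (at y)"
      using d by (intro DERIV_add has_real_derivative_inner has_partials_y[OF s(1)] has_partials_y[OF s(3)] inB') auto
  qed (use n inB' zxy in auto)
  moreover have "u z \<bullet> uxx z + u z \<bullet> uyy z = (u z \<bullet> gV (u z)) / \<epsilon>\<^sup>2"
    using pde[OF z(1)] by (metis inner_add_right inner_scaleR_right mult.commute times_divide_eq_right mult_1_right)
  moreover have "0 < (u z \<bullet> gV (u z)) / \<epsilon>\<^sup>2" using radial[OF big] \<epsilon> by simp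
  moreover have "0 \<le> ux z \<bullet> ux z" "0 \<le> uy z \<bullet> uy z" by auto
  ultimately show False by (simp add: inner_commute)
qed

end

section \<open>Selection of lines by their energy\<close>

lemma continuous_on_line_integrals:
  fixes e :: "real \<times> real \<Rightarrow> real"
  assumes "continuous_on (square 1) e"
  shows "continuous_on {-1..1} (\<lambda>x. integral {-1..1} (\<lambda>y. e (x, y)))"
    "continuous_on {-1..1} (\<lambda>y. integral {-1..1} (\<lambda>x. e (x, y)))"
    "integral (square 1) e = integral {-1..1} (\<lambda>x. integral {-1..1} (\<lambda>y. e (x, y)))"
    "integral (square 1) e = integral {-1..1} (\<lambda>y. integral {-1..1} (\<lambda>x. e (x, y)))"
proof -
  have sq: "square 1 = {-1..1} \<times> cbox (-1) 1" by (simp add: cbox_Pair_eq)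
  have "continuous_on ({-1..1} \<times> cbox (-1) 1) (\<lambda>(x, y). e (x, y))" using assms by (simp add: sq)
  from integral_continuous_on_param[OF this]
  show "continuous_on {-1..1} (\<lambda>x. integral {-1..1} (\<lambda>y. e (x, y)))" by simp
  have "continuous_on ({-1..1} \<times> cbox (-1) 1) (\<lambda>(y, x). e (x, y))"
    unfolding case_prod_beta
    by (rule continuous_on_compose2[OF assms]) (auto intro!: continuous_intros simp: mem_square)
  from integral_continuous_on_param[OF this]
  show "continuous_on {-1..1} (\<lambda>y. integral {-1..1} (\<lambda>x. e (x, y)))" by simp
  show 1: "integral (square 1) e = integral {-1..1} (\<lambda>x. integral {-1..1} (\<lambda>y. e (x, y)))"
    using integral_prod_continuous[OF assms] by simp
  show "integral (square 1) e = integral {-1..1} (\<lambda>y. integral {-1..1} (\<lambda>x. e (x, y)))"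
    unfolding 1 using integral_swap_continuous[of "-1" "-1" "1::real" "1::real" "\<lambda>x y. e (x, y)"] assms by simp
qed

lemma integral_nonneg_real:
  fixes f :: "'a::euclidean_space \<Rightarrow> real"
  assumes "\<And>x. 0 \<le> f x" shows "0 \<le> integral S f"
  using assms by (cases "f integrable_on S") (auto intro: integral_nonneg simp: not_integrable_integral)

lemma exists_small_value:
  fixes A :: "real \<Rightarrow> real"
  assumes A: "continuous_on {-1..1} A" "\<And>x. \<bar>x\<bar> \<le> 1 \<Longrightarrow> 0 \<le> A x"
    and cd: "-1 \<le> c" "c < d" "d \<le> 1" and E: "integral {-1..1} A < (d - c) * \<eta>"
  shows "\<exists>x. c \<le> x \<and> x \<le> d \<and> A x < \<eta>"
proof (rule ccontr)
  assume "\<not> ?thesis"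
  then have ge: "\<eta> \<le> A x" if "x \<in> {c..d}" for x using that by (auto simp: not_less)
  have i: "A integrable_on {c..d}"
    by (rule integrable_continuous_real, rule continuous_on_subset[OF A(1)]) (use cd in auto)
  have "(d - c) * \<eta> = integral {c..d} (\<lambda>x. \<eta>)" using cd by simp
  also have "\<dots> \<le> integral {c..d} A" by (rule integral_le) (use i ge in auto)
  also have "\<dots> \<le> integral {-1..1} A"
    by (rule integral_subset_le) (use cd i A in \<open>auto intro!: integrable_continuous_real\<close>)
  finally show False using E by simp
qed

text \<open>The cross term of Bernstein's argument: for \<open>m = 1 - s\<^sup>2\<close> the factor
  \<open>16 * s * m\<close> is, up to sign, four times the derivative of the weight
  \<open>m\<^sup>2\<close>. Expanding \<open>2 * (m * |B| - 4 * |A|)\<^sup>2\<close> leaves a share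
  of \<open>|B|\<^sup>2\<close> that the second derivatives can absorb.\<close>

lemma weighted_inner_bound:
  fixes A B :: "'a::real_inner"
  assumes "\<bar>s\<bar> \<le> 1"
  shows "- (2 * m\<^sup>2 * (B \<bullet> B) + 32 * (A \<bullet> A)) \<le> 16 * s * m * (A \<bullet> B)"
proof -
  have "\<bar>16 * s * m * (A \<bullet> B)\<bar> = 16 * (\<bar>s\<bar> * (\<bar>m\<bar> * \<bar>A \<bullet> B\<bar>))" by (simp add: abs_mult)
  also have "\<dots> \<le> 16 * (1 * (\<bar>m\<bar> * (norm A * norm B)))"
    using assms by (intro mult_left_mono mult_mono Cauchy_Schwarz_ineq2) auto
  also have "\<dots> = 16 * (\<bar>m\<bar> * norm A * norm B)" by simp
  also have "\<dots> \<le> 2 * m\<^sup>2 * (norm B)\<^sup>2 + 32 * (norm A)\<^sup>2"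
    using zero_le_power2[of "\<bar>m\<bar> * norm B - 4 * norm A"]
    by (simp add: power2_diff power_mult_distrib algebra_simps)
  finally show ?thesis by (simp add: power2_norm_eq_inner abs_le_iff)
qed

context potential
begin

lemma good_lines:
  fixes u ux uy :: "real \<times> real \<Rightarrow> 'a"
  assumes \<epsilon>: "0 < \<epsilon>" "\<epsilon> \<le> 1" and sol: "solves \<epsilon> (square 1) u ux uy"
    and \<eta>: "\<eta> \<le> v0" "line_const * \<eta> < \<mu>\<^sup>2" "integral (square 1) (energy \<epsilon> u ux uy) < 2 * \<eta>"
  shows "\<exists>\<sigma>\<in>Z. \<forall>x y. (x, y) \<in> square 1 \<longrightarrow>
     integral {-1..1} (\<lambda>y. energy \<epsilon> u ux uy (x, y)) < \<eta> \<or>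
     integral {-1..1} (\<lambda>x. energy \<epsilon> u ux uy (x, y)) < \<eta> \<longrightarrow>
     (norm (u (x, y) - \<sigma>))\<^sup>2 \<le> line_const * \<eta>"
proof -
  define e where "e = energy \<epsilon> u ux uy"
  define A where "A x = integral {-1..1} (\<lambda>y. e (x, y))" for x
  define B where "B y = integral {-1..1} (\<lambda>x. e (x, y))" for y
  obtain uxx uxy uyy where s: "has_partials u ux uy (square 1)"
    using sol unfolding solves_def by metis
  have ce: "continuous_on (square 1) e" unfolding e_def by (rule solves_continuous[OF sol])
  have e0: "0 \<le> e p" for p unfolding e_def by (rule energy_nonneg[OF \<epsilon>(1)])
  have Ve: "V (u p) \<le> e p" for p
  proof -
    \<comment> \<open>As \<open>\<epsilon> \<le> 1\<close>, the energy on a line bounds the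
      potential itself, so that one threshold \<eta> serves all \<epsilon>.\<close>
    have "V (u p) \<le> V (u p) / \<epsilon>" using \<epsilon> V_nonneg[of "u p"] by (simp add: le_divide_eq mult_left_le)
    also have "\<dots> \<le> e p" using \<epsilon> grad_sq_nonneg by (simp add: e_def energy_def)
    finally show ?thesis .
  qed
  have Ge: "sqrt (V (u p)) * norm (ux p) \<le> e p" "sqrt (V (u p)) * norm (uy p) \<le> e p" for p
    using sqrt_V_gradient_le_energy[OF \<epsilon>(1), where u = u and ux = ux and uy = uy and p = p] V_nonneg[of "u p"]
      mult_left_mono[of "norm (ux p)" "norm (ux p) + norm (uy p)" "sqrt (V (u p))"]
      mult_left_mono[of "norm (uy p)" "norm (ux p) + norm (uy p)" "sqrt (V (u p))"]
    unfolding e_def by fastforce+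
  have LA: "\<exists>\<sigma>\<in>Z. \<forall>y. \<bar>y\<bar> \<le> 1 \<longrightarrow> (norm (u (x, y) - \<sigma>))\<^sup>2 \<le> line_const * \<eta>"
    if x: "\<bar>x\<bar> \<le> 1" "A x < \<eta>" for x
  proof (rule line_near_zero[where e = "\<lambda>y. e (x, y)" and f' = "\<lambda>y. uy (x, y)"])
    show "((\<lambda>y. u (x, y)) has_vector_derivative uy (x, t)) (at t)" if "\<bar>t\<bar> \<le> 1" for t
      by (rule has_partials_y[OF s]) (use that x in \<open>auto simp: mem_square\<close>)
    show "continuous_on {-1..1} (\<lambda>y. e (x, y))"
      by (rule continuous_on_compose2[OF ce]) (use x in \<open>auto intro!: continuous_intros simp: mem_square\<close>)
  qed (use Ve Ge x \<eta> in \<open>auto simp: A_def\<close>)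
  have LB: "\<exists>\<sigma>\<in>Z. \<forall>x. \<bar>x\<bar> \<le> 1 \<longrightarrow> (norm (u (x, y) - \<sigma>))\<^sup>2 \<le> line_const * \<eta>"
    if y: "\<bar>y\<bar> \<le> 1" "B y < \<eta>" for y
  proof (rule line_near_zero[where e = "\<lambda>x. e (x, y)" and f' = "\<lambda>x. ux (x, y)"])
    show "((\<lambda>x. u (x, y)) has_vector_derivative ux (t, y)) (at t)" if "\<bar>t\<bar> \<le> 1" for t
      by (rule has_partials_x[OF s]) (use that y in \<open>auto simp: mem_square\<close>)
    show "continuous_on {-1..1} (\<lambda>x. e (x, y))"
      by (rule continuous_on_compose2[OF ce]) (use y in \<open>auto intro!: continuous_intros simp: mem_square\<close>)
  qed (use Ve Ge y \<eta> in \<open>auto simp: B_def\<close>)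
  have le\<mu>: "norm z \<le> \<mu>" if "(norm z)\<^sup>2 \<le> line_const * \<eta>" for z :: 'a
    using that \<eta>(2) pos(1) by (meson less_imp_le order.strict_trans1 power2_less_imp_less)
  note LI = continuous_on_line_integrals[OF ce, folded A_def B_def]
  have A0: "0 \<le> A x" "0 \<le> B x" for x
    unfolding A_def B_def by (intro integral_nonneg_real e0)+
  \<comment> \<open>The means of \<open>A\<close> and \<open>B\<close> over an interval of length 2
    are below \<eta>, so at least one good line exists in each direction.\<close>
  have E: "integral {-1..1} A < (1 - (-1)) * \<eta>" "integral {-1..1} B < (1 - (-1)) * \<eta>"
    using LI(3,4) \<eta>(3) by (simp_all add: e_def)
  obtain xg where "-1 \<le> xg" "xg \<le> 1" and xg2: "A xg < \<eta>"
    using exists_small_value[OF LI(1) A0(1) _ _ _ E(1)] by auto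
  then have xg: "\<bar>xg\<bar> \<le> 1" "A xg < \<eta>" by auto
  obtain yg where "-1 \<le> yg" "yg \<le> 1" and yg2: "B yg < \<eta>"
    using exists_small_value[OF LI(2) A0(2) _ _ _ E(2)] by auto
  then have yg: "\<bar>yg\<bar> \<le> 1" "B yg < \<eta>" by auto
  obtain \<sigma> where \<sigma>: "\<sigma> \<in> Z" "\<And>y. \<bar>y\<bar> \<le> 1 \<Longrightarrow> (norm (u (xg, y) - \<sigma>))\<^sup>2 \<le> line_const * \<eta>"
    using LA[OF xg] by blast
  \<comment> \<open>Parallel good lines do not meet; they are compared through the transversal
    reference lines \<open>xg\<close> and \<open>yg\<close>.\<close>
  have B: "(norm (u (x, y) - \<sigma>))\<^sup>2 \<le> line_const * \<eta>" if xy: "\<bar>x\<bar> \<le> 1" "\<bar>y\<bar> \<le> 1" "B y < \<eta>" for x y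
  proof -
    obtain \<sigma>' where \<sigma>': "\<sigma>' \<in> Z" "\<And>x. \<bar>x\<bar> \<le> 1 \<Longrightarrow> (norm (u (x, y) - \<sigma>'))\<^sup>2 \<le> line_const * \<eta>"
      using LB[OF xy(2,3)] by blast
    have "\<sigma>' = \<sigma>" using \<sigma>'(1) \<sigma>(1) le\<mu>[OF \<sigma>'(2)[OF xg(1)]] le\<mu>[OF \<sigma>(2)[OF xy(2)]] by (rule zero_unique)
    then show ?thesis using \<sigma>' xy by blast
  qed
  have A: "(norm (u (x, y) - \<sigma>))\<^sup>2 \<le> line_const * \<eta>" if xy: "\<bar>x\<bar> \<le> 1" "\<bar>y\<bar> \<le> 1" "A x < \<eta>" for x y
  proof -
    obtain \<sigma>' where \<sigma>': "\<sigma>' \<in> Z" "\<And>y. \<bar>y\<bar> \<le> 1 \<Longrightarrow> (norm (u (x, y) - \<sigma>'))\<^sup>2 \<le> line_const * \<eta>"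
      using LA[OF xy(1,3)] by blast
    have "\<sigma>' = \<sigma>" using \<sigma>'(1) \<sigma>(1) le\<mu>[OF \<sigma>'(2)[OF yg(1)]] le\<mu>[OF B[OF xy(1) yg]] by (rule zero_unique)
    then show ?thesis using \<sigma>' xy by blast
  qed
  show ?thesis
    using \<sigma>(1) A B unfolding A_def B_def e_def by (intro bexI[of _ \<sigma>]) (auto simp: mem_square)
qed

text \<open>Each of the four strips of width 1/4 along the sides contains a good line, because the
  energy is below \<open>\<eta> / 4\<close>. These lines bound a box around the inner square, the
  solution is near a zero on its boundary, and the maximum principle fills the interior.\<close>

lemma solution_bounded:
  fixes u ux uy :: "real \<times> real \<Rightarrow> 'a"
  assumes \<epsilon>: "0 < \<epsilon>" "\<epsilon> \<le> 1" and sol: "solves \<epsilon> (square 1) u ux uy"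
    and \<eta>: "\<eta> \<le> v0" "line_const * \<eta> < \<mu>\<^sup>2" "integral (square 1) (energy \<epsilon> u ux uy) < \<eta> / 4"
    and p: "p \<in> square (3/4)"
  shows "norm (u p) \<le> M"
proof -
  define e where "e = energy \<epsilon> u ux uy"
  define A where "A x = integral {-1..1} (\<lambda>y. e (x, y))" for x
  define B where "B y = integral {-1..1} (\<lambda>x. e (x, y))" for y
  have ce: "continuous_on (square 1) e" unfolding e_def by (rule solves_continuous[OF sol])
  have e0: "0 \<le> e p" for p unfolding e_def by (rule energy_nonneg[OF \<epsilon>(1)])
  have E0: "0 \<le> integral (square 1) e" using ce e0 by (intro integral_nonneg integrable_continuous) auto
  note LI = continuous_on_line_integrals[OF ce, folded A_def B_def]
  have A0: "0 \<le> A x" "0 \<le> B x" for x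
    unfolding A_def B_def by (intro integral_nonneg_real e0)+
  have "\<eta> > 0" using E0 \<eta>(3) unfolding e_def by linarith
  then have "integral (square 1) (energy \<epsilon> u ux uy) < 2 * \<eta>" using \<eta>(3) by linarith
  from good_lines[OF \<epsilon> sol \<eta>(1,2) this] obtain \<sigma> where \<sigma>: "\<sigma> \<in> Z"
    "\<And>x y. (x, y) \<in> square 1 \<Longrightarrow> A x < \<eta> \<or> B y < \<eta> \<Longrightarrow> (norm (u (x, y) - \<sigma>))\<^sup>2 \<le> line_const * \<eta>"
    unfolding A_def B_def e_def by blast
  have E: "integral {-1..1} A < (d - c) * \<eta>" "integral {-1..1} B < (d - c) * \<eta>" if "d - c = 1/4" for c d :: real
    unfolding that using LI(3,4) \<eta>(3) by (simp_all add: e_def)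
  obtain xl where xl: "-1 \<le> xl" "xl \<le> -3/4" "A xl < \<eta>"
    using exists_small_value[OF LI(1) A0(1) _ _ _ E(1), of "-1" "-3/4"] by auto
  obtain xr where xr: "3/4 \<le> xr" "xr \<le> 1" "A xr < \<eta>"
    using exists_small_value[OF LI(1) A0(1) _ _ _ E(1), of "3/4" 1] by auto
  obtain yl where yl: "-1 \<le> yl" "yl \<le> -3/4" "B yl < \<eta>"
    using exists_small_value[OF LI(2) A0(2) _ _ _ E(2), of "-1" "-3/4"] by auto
  obtain yr where yr: "3/4 \<le> yr" "yr \<le> 1" "B yr < \<eta>"
    using exists_small_value[OF LI(2) A0(2) _ _ _ E(2), of "3/4" 1] by auto
  have good: "norm (u (x, y)) \<le> M" if "(x, y) \<in> square 1" "A x < \<eta> \<or> B y < \<eta>" for x y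
  proof -
    have "(norm (u (x, y) - \<sigma>))\<^sup>2 < \<mu>\<^sup>2" using \<sigma>(2)[OF that] \<eta>(2) by linarith
    then have "norm (u (x, y) - \<sigma>) < \<mu>" using pos(1) by (meson less_imp_le power2_less_imp_less)
    then show ?thesis using Z_bounded[OF \<sigma>(1)] norm_triangle_sub[of "u (x, y)" \<sigma>] by linarith
  qed
  have sub: "cbox (xl, yl) (xr, yr) \<subseteq> square 1"
    using xl xr yl yr by (auto simp: cbox_Pair_eq)
  show ?thesis
  proof (rule box_maximum_principle[OF \<epsilon>(1) solves_subset[OF sol sub]])
    show "p \<in> cbox (xl, yl) (xr, yr)" using p xl xr yl yr by (cases p) (auto simp: cbox_Pair_eq)
    fix x y assume xy: "xl \<le> x" "x \<le> xr" "yl \<le> y" "y \<le> yr" "x = xl \<or> x = xr \<or> y = yl \<or> y = yr"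
    show "norm (u (x, y)) \<le> M"
      by (rule good) (use xy xl xr yl yr in \<open>auto simp: mem_square\<close>)
  qed
qed

text \<open>This is \<open>K * M * L + K * M * M\<close> with \<open>K = L + 37\<close>, the bound
  for the maximum of the auxiliary function: the first part bounds the gradient at the maximum
  point, the second the term \<open>K * |v|\<^sup>2\<close>.\<close>

definition bernstein_const :: real where
  "bernstein_const = (L + 37) * M * (L + M)"

lemma bernstein_const_pos: "0 < bernstein_const"
  using pos by (simp add: bernstein_const_def)

text \<open>Bernstein's method: a maximum principle for
  \<open>\<Phi> x * \<Phi> y * |\<nabla>v|\<^sup>2 + K * |v|\<^sup>2\<close>.\<close>

lemma bernstein_estimate:
  assumes sol: "solves 1 (square 1) v vx vy" and bd: "\<And>p. p \<in> square 1 \<Longrightarrow> norm (v p) \<le> M"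
  shows "grad_sq vx vy (0, 0) \<le> bernstein_const"
proof -
  obtain vxx vxy vyy vxxx vxxy vxyy vyyy where s: "has_partials v vx vy (square 1)" "has_partials vx vxx vxy (square 1)"
      "has_partials vy vxy vyy (square 1)" "has_partials vxx vxxx vxxy (square 1)" "has_partials vxy vxxy vxyy (square 1)"
      "has_partials vyy vxyy vyyy (square 1)" and pde: "\<And>p. p \<in> square 1 \<Longrightarrow> vxx p + vyy p = gV (v p)"
    using sol unfolding solves_def by auto
  \<comment> \<open>The zero at the ends of the interval makes boundary maxima harmless. As it is a
    double zero, the square of \<open>\<Phi>'\<close> is at most 16 times \<open>\<Phi>\<close> on
    the interval, which lets the cross terms be absorbed.\<close>
  define \<Phi> where "\<Phi> t = (1 - t\<^sup>2)\<^sup>2" for t :: real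
  define \<Phi>' where "\<Phi>' t = - 4 * t * (1 - t\<^sup>2)" for t :: real
  define \<Phi>'' where "\<Phi>'' t = 12 * t\<^sup>2 - 4" for t :: real
  have d\<Phi>: "(\<Phi> has_real_derivative \<Phi>' t) (at t)" for t
    unfolding \<Phi>_def \<Phi>'_def by (rule derivative_eq_intros refl)+ (simp add: algebra_simps power2_eq_square)
  have d\<Phi>': "(\<Phi>' has_real_derivative \<Phi>'' t) (at t)" for t
    unfolding \<Phi>'_def \<Phi>''_def by (rule derivative_eq_intros refl)+ (simp add: algebra_simps power2_eq_square)
  \<comment> \<open>At the maximum point the coefficient of \<open>w\<close> becomes
    \<open>2 * K - 72 - 2 * L\<close>, where 8 of the 72 come from \<open>\<Phi>''\<close> and 64
    from the cross terms. With this \<open>K\<close> it equals 2.\<close>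
  define K where "K = L + 37"
  define w where "w p = vx p \<bullet> vx p + vy p \<bullet> vy p" for p
  define wx where "wx p = 2 * (vx p \<bullet> vxx p + vy p \<bullet> vxy p)" for p
  define wy where "wy p = 2 * (vx p \<bullet> vxy p + vy p \<bullet> vyy p)" for p
  define wxx where "wxx p = 2 * (vxx p \<bullet> vxx p + vx p \<bullet> vxxx p + (vxy p \<bullet> vxy p + vy p \<bullet> vxxy p))" for p
  define wyy where "wyy p = 2 * (vxy p \<bullet> vxy p + vx p \<bullet> vxyy p + (vyy p \<bullet> vyy p + vy p \<bullet> vyyy p))" for p
  define P where "P p = \<Phi> (fst p) * \<Phi> (snd p) * w p + K * (v p \<bullet> v p)" for p
  have cont: "continuous_on (square 1) P"
    unfolding P_def \<Phi>_def w_def by (intro continuous_intros solves_continuous[OF sol])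
  have ne: "square 1 \<noteq> {}" by (auto simp: cbox_Pair_eq)
  from continuous_attains_sup[OF compact_cbox ne cont] obtain z where
    z: "z \<in> square 1" "\<And>p. p \<in> square 1 \<Longrightarrow> P p \<le> P z" by blast
  obtain x y where zxy: "z = (x, y)" by (cases z)
  have xy: "\<bar>x\<bar> \<le> 1" "\<bar>y\<bar> \<le> 1" using z(1) by (auto simp: zxy mem_square)
  have K: "0 < K" using pos by (simp add: K_def)
  have w0: "0 \<le> w p" for p by (simp add: w_def)
  have \<Phi>1: "0 \<le> \<Phi> t" "\<Phi> t \<le> 1" if "\<bar>t\<bar> \<le> 1" for t
    using that unfolding \<Phi>_def by (auto intro!: power_le_one simp: abs_square_le_1)
  have vM: "v z \<bullet> v z \<le> M * M"
    using mult_mono[OF bd[OF z(1)] bd[OF z(1)]] pos by (simp add: power2_norm_eq_inner[symmetric] power2_eq_square)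
  have "P z \<le> K * M * L + K * (M * M)"
  proof (cases "\<bar>x\<bar> < 1 \<and> \<bar>y\<bar> < 1")
    case False
    then have "\<Phi> x = 0 \<or> \<Phi> y = 0" using xy by (auto simp: \<Phi>_def abs_if power2_eq_1_iff split: if_splits)
    then have "P z = K * (v z \<bullet> v z)" by (auto simp: P_def zxy)
    also have "\<dots> \<le> K * (M * M)" using K vM by (intro mult_left_mono) auto
    finally show ?thesis using K pos by (meson add_increasing less_imp_le mult_nonneg_nonneg)
  next
    case True
    define d where "d = min (1 - \<bar>x\<bar>) (1 - \<bar>y\<bar>)"
    have d: "0 < d" using True by (simp add: d_def)
    have in1: "(t, y) \<in> square 1" if "\<bar>t - x\<bar> < d" for t using that by (auto simp: d_def mem_square)
    have in2: "(x, t) \<in> square 1" if "\<bar>t - y\<bar> < d" for t using that by (auto simp: d_def mem_square)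
    have gx: "((\<lambda>t. gV (v (t, y))) has_vector_derivative HV (v z) (vx z)) (at x)"
      using diff_chain_at[OF has_partials_x[OF s(1) in1[of x], unfolded has_vector_derivative_def] gV_deriv] d
        has_derivative_linear[OF gV_deriv[of "v z"]]
      by (simp add: o_def has_vector_derivative_def zxy linear_cmul)
    have gy: "((\<lambda>t. gV (v (x, t))) has_vector_derivative HV (v z) (vy z)) (at y)"
      using diff_chain_at[OF has_partials_y[OF s(1) in2[of y], unfolded has_vector_derivative_def] gV_deriv] d
        has_derivative_linear[OF gV_deriv[of "v z"]]
      by (simp add: o_def has_vector_derivative_def zxy linear_cmul)
    \<comment> \<open>The equation holds on a whole segment through the point, so its two sides have
      the same derivative there. This expresses the Laplacian of \<open>vx\<close> by the derivative
      of \<open>gV\<close>.\<close>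
    have "((\<lambda>t. vxx (t, y) + vyy (t, y)) has_vector_derivative (vxxx (x, y) + vxyy (x, y))) (at x)"
      using d by (intro has_vector_derivative_add has_partials_x[OF s(4)] has_partials_x[OF s(6)] in1) auto
    then have "((\<lambda>t. gV (v (t, y))) has_vector_derivative (vxxx (x, y) + vxyy (x, y))) (at x)"
    proof (rule has_vector_derivative_transform_within_open[where S = "ball x d"])
      show "vxx (t, y) + vyy (t, y) = gV (v (t, y))" if "t \<in> ball x d" for t
        by (rule pde[OF in1]) (use that in \<open>simp add: dist_real_def abs_minus_commute\<close>)
    qed (use d in auto)
    then have lx: "vxxx z + vxyy z = HV (v z) (vx z)"
      using vector_derivative_unique_at gx zxy by blast
    have "((\<lambda>t. vxx (x, t) + vyy (x, t)) has_vector_derivative (vxxy (x, y) + vyyy (x, y))) (at y)"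
      using d by (intro has_vector_derivative_add has_partials_y[OF s(4)] has_partials_y[OF s(6)] in2) auto
    then have "((\<lambda>t. gV (v (x, t))) has_vector_derivative (vxxy (x, y) + vyyy (x, y))) (at y)"
    proof (rule has_vector_derivative_transform_within_open[where S = "ball y d"])
      show "vxx (x, t) + vyy (x, t) = gV (v (x, t))" if "t \<in> ball y d" for t
        by (rule pde[OF in2]) (use that in \<open>simp add: dist_real_def abs_minus_commute\<close>)
    qed (use d in auto)
    then have ly: "vxxy z + vyyy z = HV (v z) (vy z)"
      using vector_derivative_unique_at gy zxy by blast
    have dwx: "((\<lambda>t. w (t, y)) has_real_derivative wx (t, y)) (at t)" if "\<bar>t - x\<bar> < d" for t
      unfolding w_def
      by (rule DERIV_cong, rule DERIV_add[OF has_real_derivative_inner[OF has_partials_x[OF s(2)] has_partials_x[OF s(2)]]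
            has_real_derivative_inner[OF has_partials_x[OF s(3)] has_partials_x[OF s(3)]]])
        (use in1[OF that] in \<open>auto simp: wx_def inner_commute\<close>)
    have dwxx: "((\<lambda>t. wx (t, y)) has_real_derivative wxx z) (at x)"
      unfolding wx_def
      by (rule DERIV_cong, rule DERIV_cmult[OF DERIV_add[OF has_real_derivative_inner[OF has_partials_x[OF s(2)] has_partials_x[OF s(4)]]
            has_real_derivative_inner[OF has_partials_x[OF s(3)] has_partials_x[OF s(5)]]]])
        (use in1[of x] d in \<open>auto simp: wxx_def zxy\<close>)
    have dwy: "((\<lambda>t. w (x, t)) has_real_derivative wy (x, t)) (at t)" if "\<bar>t - y\<bar> < d" for t
      unfolding w_def
      by (rule DERIV_cong, rule DERIV_add[OF has_real_derivative_inner[OF has_partials_y[OF s(2)] has_partials_y[OF s(2)]]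
            has_real_derivative_inner[OF has_partials_y[OF s(3)] has_partials_y[OF s(3)]]])
        (use in2[OF that] in \<open>auto simp: wy_def inner_commute\<close>)
    have dwyy: "((\<lambda>t. wy (x, t)) has_real_derivative wyy z) (at y)"
      unfolding wy_def
      by (rule DERIV_cong, rule DERIV_cmult[OF DERIV_add[OF has_real_derivative_inner[OF has_partials_y[OF s(2)] has_partials_y[OF s(5)]]
            has_real_derivative_inner[OF has_partials_y[OF s(3)] has_partials_y[OF s(6)]]]])
        (use in2[of y] d in \<open>auto simp: wyy_def zxy\<close>)
    define Pxx where "Pxx = \<Phi>'' x * \<Phi> y * w z + 2 * (\<Phi>' x * \<Phi> y * wx z) + \<Phi> x * \<Phi> y * wxx z + 2 * K * (vx z \<bullet> vx z + v z \<bullet> vxx z)"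
    define Pyy where "Pyy = \<Phi> x * \<Phi>'' y * w z + 2 * (\<Phi> x * \<Phi>' y * wy z) + \<Phi> x * \<Phi> y * wyy z + 2 * K * (vy z \<bullet> vy z + v z \<bullet> vyy z)"
    have "Pxx \<le> 0"
    proof (rule second_derivative_nonpos_at_max[OF d, of x "\<lambda>t. P (t, y)"
          "\<lambda>t. \<Phi>' t * \<Phi> y * w (t, y) + \<Phi> t * \<Phi> y * wx (t, y) + 2 * K * (v (t, y) \<bullet> vx (t, y))"])
      show "P (t, y) \<le> P (x, y)" if "\<bar>t - x\<bar> < d" for t using z(2)[OF in1[OF that]] zxy by simp
      show "((\<lambda>t. P (t, y)) has_real_derivative \<Phi>' t * \<Phi> y * w (t, y) + \<Phi> t * \<Phi> y * wx (t, y) + 2 * K * (v (t, y) \<bullet> vx (t, y))) (at t)"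
        if "\<bar>t - x\<bar> < d" for t
        unfolding P_def fst_conv snd_conv
        by (rule DERIV_cong, rule DERIV_add[OF DERIV_mult[OF DERIV_mult[OF d\<Phi> DERIV_const] dwx[OF that]]
              DERIV_cmult[OF has_real_derivative_inner[OF has_partials_x[OF s(1) in1[OF that]] has_partials_x[OF s(1) in1[OF that]]]]])
          (simp add: inner_commute algebra_simps)
      show "((\<lambda>t. \<Phi>' t * \<Phi> y * w (t, y) + \<Phi> t * \<Phi> y * wx (t, y) + 2 * K * (v (t, y) \<bullet> vx (t, y))) has_real_derivative Pxx) (at x)"
        using d by (intro DERIV_cong[OF DERIV_add[OF DERIV_add[OF DERIV_mult[OF DERIV_mult[OF d\<Phi>' DERIV_const] dwx]
              DERIV_mult[OF DERIV_mult[OF d\<Phi> DERIV_const] dwxx]]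
              DERIV_cmult[OF has_real_derivative_inner[OF has_partials_x[OF s(1) in1] has_partials_x[OF s(2) in1]]]]])
          (auto simp: inner_commute algebra_simps Pxx_def zxy)
    qed
    moreover have "Pyy \<le> 0"
    proof (rule second_derivative_nonpos_at_max[OF d, of y "\<lambda>t. P (x, t)"
          "\<lambda>t. \<Phi> x * \<Phi>' t * w (x, t) + \<Phi> x * \<Phi> t * wy (x, t) + 2 * K * (v (x, t) \<bullet> vy (x, t))"])
      show "P (x, t) \<le> P (x, y)" if "\<bar>t - y\<bar> < d" for t using z(2)[OF in2[OF that]] zxy by simp
      show "((\<lambda>t. P (x, t)) has_real_derivative \<Phi> x * \<Phi>' t * w (x, t) + \<Phi> x * \<Phi> t * wy (x, t) + 2 * K * (v (x, t) \<bullet> vy (x, t))) (at t)"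
        if "\<bar>t - y\<bar> < d" for t
        unfolding P_def fst_conv snd_conv
        by (rule DERIV_cong, rule DERIV_add[OF DERIV_mult[OF DERIV_mult[OF DERIV_const d\<Phi>] dwy[OF that]]
              DERIV_cmult[OF has_real_derivative_inner[OF has_partials_y[OF s(1) in2[OF that]] has_partials_y[OF s(1) in2[OF that]]]]])
          (simp add: inner_commute algebra_simps)
      show "((\<lambda>t. \<Phi> x * \<Phi>' t * w (x, t) + \<Phi> x * \<Phi> t * wy (x, t) + 2 * K * (v (x, t) \<bullet> vy (x, t))) has_real_derivative Pyy) (at y)"
        using d by (intro DERIV_cong[OF DERIV_add[OF DERIV_add[OF DERIV_mult[OF DERIV_mult[OF DERIV_const d\<Phi>'] dwy]
              DERIV_mult[OF DERIV_mult[OF DERIV_const d\<Phi>] dwyy]]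
              DERIV_cmult[OF has_real_derivative_inner[OF has_partials_y[OF s(1) in2] has_partials_y[OF s(3) in2]]]]])
          (auto simp: inner_commute algebra_simps Pyy_def zxy)
    qed
    ultimately have le0: "Pxx + Pyy \<le> 0" by linarith
    define N where "N = vxx z \<bullet> vxx z + 2 * (vxy z \<bullet> vxy z) + vyy z \<bullet> vyy z"
    note \<Phi>x = \<Phi>1[OF xy(1)] and \<Phi>y = \<Phi>1[OF xy(2)]
    define H where "H = vx z \<bullet> HV (v z) (vx z) + vy z \<bullet> HV (v z) (vy z)"
    have wsum: "wxx z + wyy z = 2 * N + 2 * H"
      unfolding wxx_def wyy_def N_def H_def lx[symmetric] ly[symmetric] by (simp add: inner_add_right algebra_simps)
    have Hin: "\<bar>h \<bullet> HV (v z) h\<bar> \<le> L * (h \<bullet> h)" for h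
    proof -
      have "\<bar>h \<bullet> HV (v z) h\<bar> \<le> norm h * norm (HV (v z) h)" by (rule Cauchy_Schwarz_ineq2)
      also have "\<dots> \<le> norm h * (L * norm h)" by (intro mult_left_mono HV_bound bd z) auto
      finally show ?thesis by (simp add: power2_norm_eq_inner[symmetric] power2_eq_square mult_ac)
    qed
    have H: "- (L * w z) \<le> H" using Hin[of "vx z"] Hin[of "vy z"] by (simp add: H_def w_def distrib_left)
    have Pq: "0 \<le> \<Phi> x * \<Phi> y" "\<Phi> x * \<Phi> y \<le> 1" using \<Phi>x \<Phi>y by (auto intro: mult_le_one)
    have t3: "2 * (\<Phi> x * \<Phi> y * N) - 2 * (L * w z) \<le> \<Phi> x * \<Phi> y * (wxx z + wyy z)"
    proof -
      have "- (L * w z) \<le> \<Phi> x * \<Phi> y * (- (L * w z))"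
        using mult_right_mono[OF Pq(2), of "L * w z"] w0[of z] pos by simp
      also have "\<dots> \<le> \<Phi> x * \<Phi> y * H" using H Pq by (intro mult_left_mono) auto
      finally show ?thesis unfolding wsum by (simp add: algebra_simps)
    qed
    have t1: "- (8 * w z) \<le> \<Phi>'' x * \<Phi> y * w z + \<Phi> x * \<Phi>'' y * w z"
    proof -
      have "- 4 \<le> \<Phi>'' x * \<Phi> y"
        using mult_right_mono[of "-4" "\<Phi>'' x" "\<Phi> y"] \<Phi>y by (simp add: \<Phi>''_def)
      moreover have "- 4 \<le> \<Phi> x * \<Phi>'' y"
        using mult_left_mono[of "-4" "\<Phi>'' y" "\<Phi> x"] \<Phi>x by (simp add: \<Phi>''_def)
      ultimately have "(-8) * w z \<le> (\<Phi>'' x * \<Phi> y + \<Phi> x * \<Phi>'' y) * w z" using w0 by (intro mult_right_mono) auto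
      then show ?thesis by (simp add: distrib_right)
    qed
    have cross: "- (2 * (\<Phi> s * (B1 \<bullet> B1 + B2 \<bullet> B2)) + 32 * w z) \<le> 4 * \<Phi>' s * (vx z \<bullet> B1 + vy z \<bullet> B2)"
      if "\<bar>s\<bar> \<le> 1" for s B1 B2
      using weighted_inner_bound[of "- s" "1 - s\<^sup>2" B1 "vx z"] weighted_inner_bound[of "- s" "1 - s\<^sup>2" B2 "vy z"] that
      unfolding \<Phi>_def \<Phi>'_def w_def by (simp add: distrib_left)
    have t2: "- (2 * (\<Phi> x * \<Phi> y * (vxx z \<bullet> vxx z + vxy z \<bullet> vxy z)) + 32 * w z) \<le> 2 * (\<Phi>' x * \<Phi> y * wx z)"
    proof -
      have "- (32 * w z) \<le> \<Phi> y * - (32 * w z)" using mult_right_mono[OF \<Phi>y(2), of "32 * w z"] w0[of z] by simp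
      moreover have "\<Phi> y * - (2 * (\<Phi> x * (vxx z \<bullet> vxx z + vxy z \<bullet> vxy z)) + 32 * w z) \<le> \<Phi> y * (4 * \<Phi>' x * (vx z \<bullet> vxx z + vy z \<bullet> vxy z))"
        by (intro mult_left_mono cross xy \<Phi>y)
      ultimately show ?thesis unfolding wx_def by (simp add: algebra_simps)
    qed
    have t2': "- (2 * (\<Phi> x * \<Phi> y * (vxy z \<bullet> vxy z + vyy z \<bullet> vyy z)) + 32 * w z) \<le> 2 * (\<Phi> x * \<Phi>' y * wy z)"
    proof -
      have "- (32 * w z) \<le> \<Phi> x * - (32 * w z)" using mult_right_mono[OF \<Phi>x(2), of "32 * w z"] w0[of z] by simp
      moreover have "\<Phi> x * - (2 * (\<Phi> y * (vxy z \<bullet> vxy z + vyy z \<bullet> vyy z)) + 32 * w z) \<le> \<Phi> x * (4 * \<Phi>' y * (vx z \<bullet> vxy z + vy z \<bullet> vyy z))"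
        by (intro mult_left_mono cross xy \<Phi>x)
      ultimately show ?thesis unfolding wy_def by (simp add: algebra_simps)
    qed
    have t2s: "- (2 * (\<Phi> x * \<Phi> y * N) + 64 * w z) \<le> 2 * (\<Phi>' x * \<Phi> y * wx z) + 2 * (\<Phi> x * \<Phi>' y * wy z)"
      using add_mono[OF t2 t2'] unfolding N_def by (simp add: algebra_simps)
    have vg: "- (M * L) \<le> v z \<bullet> vxx z + v z \<bullet> vyy z"
    proof -
      have "\<bar>v z \<bullet> gV (v z)\<bar> \<le> norm (v z) * norm (gV (v z))" by (rule Cauchy_Schwarz_ineq2)
      also have "\<dots> \<le> M * L" using pos by (intro mult_mono gV_bound bd z) auto
      finally show ?thesis using pde[OF z(1)] by (simp add: inner_add_right[symmetric])
    qed
    have t4: "2 * K * w z - 2 * (K * (M * L)) \<le> 2 * K * (vx z \<bullet> vx z + v z \<bullet> vxx z) + 2 * K * (vy z \<bullet> vy z + v z \<bullet> vyy z)"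
      using mult_left_mono[OF vg, of "2 * K"] K by (simp add: w_def algebra_simps)
    \<comment> \<open>The second-derivative terms \<open>2 * (\<Phi> x * \<Phi> y * N)\<close> of
      \<open>t2s\<close> and \<open>t3\<close> cancel exactly.\<close>
    have "2 * (K * w z) - 2 * (K * (M * L)) - 72 * w z - 2 * (L * w z) \<le> Pxx + Pyy"
      using t1 t2s t3 t4 unfolding Pxx_def Pyy_def by (simp add: distrib_left)
    then have "w z \<le> K * (M * L)" using le0 unfolding K_def by (simp add: algebra_simps)
    moreover have "P z \<le> w z + K * (v z \<bullet> v z)"
      using mult_right_mono[OF Pq(2), of "w z"] w0 by (simp add: P_def zxy)
    moreover have "K * (v z \<bullet> v z) \<le> K * (M * M)" using K vM by (intro mult_left_mono) auto
    ultimately show ?thesis by (simp add: mult.assoc)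
  qed
  moreover have "w (0, 0) \<le> P (0, 0)" using K by (simp add: P_def \<Phi>_def)
  moreover have "P (0, 0) \<le> P z" by (rule z) (simp add: mem_square)
  ultimately show ?thesis
    by (simp add: w_def grad_sq_def power2_norm_eq_inner bernstein_const_def K_def algebra_simps)
qed

text \<open>Magnifying by \<open>1 / \<epsilon>\<close> around \<open>p\<close> turns the parameter
  into 1. The magnified unit square stays in \<open>square (3/4)\<close> because 5/8 + 1/8 =
  3/4.\<close>

lemma gradient_bound:
  assumes \<epsilon>: "0 < \<epsilon>" "\<epsilon> \<le> 1/8" and sol: "solves \<epsilon> (square (3/4)) u ux uy"
    and bd: "\<And>p. p \<in> square (3/4) \<Longrightarrow> norm (u p) \<le> M" and p: "p \<in> square (5/8)"
  shows "\<epsilon>\<^sup>2 * grad_sq ux uy p \<le> bernstein_const"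
proof -
  have sub: "p + \<epsilon> *\<^sub>R q \<in> square (3/4)" if "q \<in> square 1" for q
  proof -
    obtain x y s t where [simp]: "p = (x, y)" "q = (s, t)" by (metis surj_pair)
    have st: "\<bar>s\<bar> \<le> 1" "\<bar>t\<bar> \<le> 1" using that unfolding \<open>q = (s, t)\<close> mem_square by auto
    have "\<epsilon> * \<bar>s\<bar> \<le> 1/8 * 1" "\<epsilon> * \<bar>t\<bar> \<le> 1/8 * 1" using st \<epsilon> by (intro mult_mono; simp)+
    then have "\<bar>\<epsilon> * s\<bar> \<le> 1/8" "\<bar>\<epsilon> * t\<bar> \<le> 1/8" using \<epsilon> by (simp_all add: abs_mult)
    moreover have "\<bar>x\<bar> \<le> 5/8" "\<bar>y\<bar> \<le> 5/8" using p unfolding \<open>p = (x, y)\<close> mem_square by auto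
    ultimately have "\<bar>x + \<epsilon> * s\<bar> \<le> 3/4" "\<bar>y + \<epsilon> * t\<bar> \<le> 3/4" by linarith+
    then show ?thesis
      by (simp only: \<open>p = (x, y)\<close> \<open>q = (s, t)\<close> scaleR_Pair add_Pair real_scaleR_def mem_square)
  qed
  have "solves 1 (square 1) (\<lambda>q. u (p + \<epsilon> *\<^sub>R q)) (\<lambda>q. \<epsilon> *\<^sub>R ux (p + \<epsilon> *\<^sub>R q)) (\<lambda>q. \<epsilon> *\<^sub>R uy (p + \<epsilon> *\<^sub>R q))"
    using solves_affine[OF sol \<epsilon>(1) sub] \<epsilon> by simp
  from bernstein_estimate[OF this] have "grad_sq (\<lambda>q. \<epsilon> *\<^sub>R ux (p + \<epsilon> *\<^sub>R q)) (\<lambda>q. \<epsilon> *\<^sub>R uy (p + \<epsilon> *\<^sub>R q)) (0, 0) \<le> bernstein_const"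
    using bd sub by blast
  then show ?thesis by (simp add: grad_sq_def power_mult_distrib distrib_left zero_prod_def[symmetric])
qed

end

section \<open>Inner variations\<close>

context potential
begin

lemma V_comp_deriv_x:
  assumes "has_partials u ux uy S" "(x, y) \<in> S"
  shows "((\<lambda>t. V (u (t, y))) has_real_derivative gV (u (x, y)) \<bullet> ux (x, y)) (at x)"
  using diff_chain_at[OF has_partials_x[OF assms, unfolded has_vector_derivative_def] V_deriv]
  by (simp add: o_def has_field_derivative_def mult_commute_abs)

lemma V_comp_deriv_y:
  assumes "has_partials u ux uy S" "(x, y) \<in> S"
  shows "((\<lambda>t. V (u (x, t))) has_real_derivative gV (u (x, y)) \<bullet> uy (x, y)) (at y)"
  using diff_chain_at[OF has_partials_y[OF assms, unfolded has_vector_derivative_def] V_deriv]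
  by (simp add: o_def has_field_derivative_def mult_commute_abs)

lemma antiderivative_facts:
  fixes p :: "real \<Rightarrow> real"
  assumes p: "continuous_on {-1..1} p" "\<And>x. 0 \<le> p x" and d: "integral {-1..1} p \<le> \<delta>" and x: "\<bar>x\<bar> < 1"
  shows "((\<lambda>x. integral {-1..x} p) has_real_derivative p x) (at x)"
    "\<bar>integral {-1..x} p\<bar> \<le> \<delta>"
proof -
  have "((\<lambda>x. integral {-1..x} p) has_real_derivative p x) (at x within {-1..1})"
    by (rule integral_has_real_derivative[OF p(1)]) (use x in auto)
  then show "((\<lambda>x. integral {-1..x} p) has_real_derivative p x) (at x)"
    using x by (simp add: at_within_Icc_at abs_less_iff)
  have "p integrable_on {-1..1}" "p integrable_on {-1..x}"
    using p(1) x by (auto intro!: integrable_continuous_real elim!: continuous_on_subset)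
  then have "integral {-1..x} p \<le> integral {-1..1} p"
    using p(2) x by (intro integral_subset_le) auto
  moreover have "0 \<le> integral {-1..x} p" by (rule integral_nonneg_real[OF p(2)])
  ultimately show "\<bar>integral {-1..x} p\<bar> \<le> \<delta>" using d by linarith
qed

text \<open>The stress-energy tensor, in the frame of the coordinate axes, is divergence free.\<close>

definition T11 where
  "T11 \<epsilon> u ux uy p = \<epsilon> / 2 * ((norm (uy p))\<^sup>2 - (norm (ux p))\<^sup>2) + V (u p) / \<epsilon>"

definition T22 where
  "T22 \<epsilon> u ux uy p = \<epsilon> / 2 * ((norm (ux p))\<^sup>2 - (norm (uy p))\<^sup>2) + V (u p) / \<epsilon>"

definition T12 :: "real \<Rightarrow> (real \<times> real \<Rightarrow> 'a) \<Rightarrow> (real \<times> real \<Rightarrow> 'a) \<Rightarrow> real \<times> real \<Rightarrow> real" where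
  "T12 \<epsilon> ux uy p = - \<epsilon> * (ux p \<bullet> uy p)"

lemma stress_bounds:
  assumes "0 < \<epsilon>"
  shows "\<bar>T11 \<epsilon> u ux uy p\<bar> \<le> energy \<epsilon> u ux uy p" "\<bar>T22 \<epsilon> u ux uy p\<bar> \<le> energy \<epsilon> u ux uy p"
    "\<bar>T12 \<epsilon> ux uy p\<bar> \<le> energy \<epsilon> u ux uy p"
proof -
  have v: "0 \<le> V (u p) / \<epsilon>" "0 \<le> \<epsilon> * (norm (ux p))\<^sup>2" "0 \<le> \<epsilon> * (norm (uy p))\<^sup>2"
    using assms V_nonneg by auto
  have T: "T11 \<epsilon> u ux uy p = (\<epsilon> * (norm (uy p))\<^sup>2 - \<epsilon> * (norm (ux p))\<^sup>2) / 2 + V (u p) / \<epsilon>"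
    "T22 \<epsilon> u ux uy p = (\<epsilon> * (norm (ux p))\<^sup>2 - \<epsilon> * (norm (uy p))\<^sup>2) / 2 + V (u p) / \<epsilon>"
    "energy \<epsilon> u ux uy p = (\<epsilon> * (norm (ux p))\<^sup>2 + \<epsilon> * (norm (uy p))\<^sup>2) / 2 + V (u p) / \<epsilon>"
    by (simp_all add: T11_def T22_def energy_def grad_sq_def right_diff_distrib distrib_left)
  have "\<bar>(B - A) / 2 + W\<bar> \<le> (A + B) / 2 + W" "\<bar>(A - B) / 2 + W\<bar> \<le> (A + B) / 2 + W"
    if "0 \<le> W" "0 \<le> A" "0 \<le> B" for A B W :: real using that by (auto simp: abs_le_iff field_simps)
  from this[OF v] show "\<bar>T11 \<epsilon> u ux uy p\<bar> \<le> energy \<epsilon> u ux uy p" "\<bar>T22 \<epsilon> u ux uy p\<bar> \<le> energy \<epsilon> u ux uy p"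
    unfolding T by auto
  have "\<bar>ux p \<bullet> uy p\<bar> \<le> norm (ux p) * norm (uy p)" by (rule Cauchy_Schwarz_ineq2)
  also have "\<dots> \<le> ((norm (ux p))\<^sup>2 + (norm (uy p))\<^sup>2) / 2"
    using zero_le_power2[of "norm (ux p) - norm (uy p)"] by (simp add: power2_diff)
  finally have "\<epsilon> * \<bar>ux p \<bullet> uy p\<bar> \<le> \<epsilon> * (((norm (ux p))\<^sup>2 + (norm (uy p))\<^sup>2) / 2)"
    using assms by (intro mult_left_mono) auto
  also have "\<dots> \<le> energy \<epsilon> u ux uy p" unfolding energy_def grad_sq_def using v by linarith
  finally show "\<bar>T12 \<epsilon> ux uy p\<bar> \<le> energy \<epsilon> u ux uy p"
    using assms by (simp add: T12_def abs_mult)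
qed

text \<open>Domain variation along \<open>cutoff * (f x, g y)\<close> with \<open>f' = p1\<close> and \<open>g' = p2\<close>,
  where \<open>f\<close> and \<open>g\<close> are bounded by \<open>\<delta>\<close>.\<close>

lemma stress_estimate:
  fixes u ux uy :: "real \<times> real \<Rightarrow> 'a"
  assumes \<epsilon>: "0 < \<epsilon>" and r: "0 < r" "r < 1" and sol: "solves \<epsilon> (square r) u ux uy"
    and p1: "continuous_on {-1..1} p1" "\<And>x. 0 \<le> p1 x" "integral {-1..1} p1 \<le> \<delta>"
    and p2: "continuous_on {-1..1} p2" "\<And>x. 0 \<le> p2 x" "integral {-1..1} p2 \<le> \<delta>"
  shows "integral (square r) (\<lambda>p. cutoff r p * (p1 (fst p) * T11 \<epsilon> u ux uy p + p2 (snd p) * T22 \<epsilon> u ux uy p))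
     \<le> 16 / r * \<delta> * integral (square r) (energy \<epsilon> u ux uy)"
proof -
  obtain uxx uxy uyy where s: "has_partials u ux uy (square r)" "has_partials ux uxx uxy (square r)"
      "has_partials uy uxy uyy (square r)" and c2: "continuous_on (square r) uxx" "continuous_on (square r) uxy"
      "continuous_on (square r) uyy"
      and pde: "\<And>p. p \<in> square r \<Longrightarrow> uxx p + uyy p = (1 / \<epsilon>\<^sup>2) *\<^sub>R gV (u p)"
    using sol has_partials_continuous unfolding solves_def by metis
  note cont = solves_continuous[OF sol]
  define f where "f x = integral {-1..x} p1" for x
  define g where "g x = integral {-1..x} p2" for x
  note f = antiderivative_facts[OF p1, folded f_def] and g = antiderivative_facts[OF p2, folded g_def]
  let ?T11 = "T11 \<epsilon> u ux uy" and ?T22 = "T22 \<epsilon> u ux uy" and ?T12 = "T12 \<epsilon> ux uy"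
  define T11x where "T11x p = \<epsilon> * (uy p \<bullet> uxy p - ux p \<bullet> uxx p) + (gV (u p) \<bullet> ux p) / \<epsilon>" for p
  define T22y where "T22y p = \<epsilon> * (ux p \<bullet> uxy p - uy p \<bullet> uyy p) + (gV (u p) \<bullet> uy p) / \<epsilon>" for p
  define T12x where "T12x p = - \<epsilon> * (ux p \<bullet> uxy p + uxx p \<bullet> uy p)" for p
  define T12y where "T12y p = - \<epsilon> * (ux p \<bullet> uyy p + uxy p \<bullet> uy p)" for p
  have xin: "\<bar>x\<bar> < 1" "\<bar>y\<bar> < 1" if "(x, y) \<in> square r" for x y
    using that r unfolding mem_square by linarith+
  have d11: "((\<lambda>t. ?T11 (t, y)) has_real_derivative T11x (x, y)) (at x)" if "(x, y) \<in> square r" for x y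
    unfolding T11_def power2_norm_eq_inner
    by (rule DERIV_cong, rule DERIV_add[OF DERIV_cmult[OF DERIV_diff[OF
          has_real_derivative_inner[OF has_partials_x[OF s(3) that] has_partials_x[OF s(3) that]]
          has_real_derivative_inner[OF has_partials_x[OF s(2) that] has_partials_x[OF s(2) that]]]]
          DERIV_cdivide[OF V_comp_deriv_x[OF s(1) that]]])
      (simp add: T11x_def inner_commute algebra_simps)
  have d22: "((\<lambda>t. ?T22 (x, t)) has_real_derivative T22y (x, y)) (at y)" if "(x, y) \<in> square r" for x y
    unfolding T22_def power2_norm_eq_inner
    by (rule DERIV_cong, rule DERIV_add[OF DERIV_cmult[OF DERIV_diff[OF
          has_real_derivative_inner[OF has_partials_y[OF s(2) that] has_partials_y[OF s(2) that]]
          has_real_derivative_inner[OF has_partials_y[OF s(3) that] has_partials_y[OF s(3) that]]]]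
          DERIV_cdivide[OF V_comp_deriv_y[OF s(1) that]]])
      (simp add: T22y_def inner_commute algebra_simps)
  have d12x: "((\<lambda>t. ?T12 (t, y)) has_real_derivative T12x (x, y)) (at x)" if "(x, y) \<in> square r" for x y
    unfolding T12_def T12x_def
    by (intro DERIV_cmult has_real_derivative_inner has_partials_x[OF s(2) that] has_partials_x[OF s(3) that])
  have d12y: "((\<lambda>t. ?T12 (x, t)) has_real_derivative T12y (x, y)) (at y)" if "(x, y) \<in> square r" for x y
    unfolding T12_def T12y_def
    by (intro DERIV_cmult has_real_derivative_inner has_partials_y[OF s(2) that] has_partials_y[OF s(3) that])
  define F where "F p = bump r (fst p) * bump r (snd p) * (f (fst p) * ?T11 p + g (snd p) * ?T12 p)" for p
  define G where "G p = bump r (fst p) * bump r (snd p) * (f (fst p) * ?T12 p + g (snd p) * ?T22 p)" for p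
  define Fx where "Fx p = bump' r (fst p) * bump r (snd p) * (f (fst p) * ?T11 p + g (snd p) * ?T12 p)
     + cutoff r p * (p1 (fst p) * ?T11 p + f (fst p) * T11x p + g (snd p) * T12x p)" for p
  define Gy where "Gy p = bump r (fst p) * bump' r (snd p) * (f (fst p) * ?T12 p + g (snd p) * ?T22 p)
     + cutoff r p * (f (fst p) * T12y p + p2 (snd p) * ?T22 p + g (snd p) * T22y p)" for p
  have cf: "continuous_on (square r) (\<lambda>p. f (fst p))" "continuous_on (square r) (\<lambda>p. p1 (fst p))"
  proof -
    have "continuous_on {- r..r} f"
      by (intro continuous_at_imp_continuous_on ballI DERIV_isCont[OF f(1)]) (use r in auto)
    then show "continuous_on (square r) (\<lambda>p. f (fst p))"
      by (rule continuous_on_compose2) (auto intro!: continuous_intros simp: cbox_Pair_eq)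
    show "continuous_on (square r) (\<lambda>p. p1 (fst p))"
      by (rule continuous_on_compose2[OF p1(1)]) (use r in \<open>auto intro!: continuous_intros simp: cbox_Pair_eq\<close>)
  qed
  have cg: "continuous_on (square r) (\<lambda>p. g (snd p))" "continuous_on (square r) (\<lambda>p. p2 (snd p))"
  proof -
    have "continuous_on {- r..r} g"
      by (intro continuous_at_imp_continuous_on ballI DERIV_isCont[OF g(1)]) (use r in auto)
    then show "continuous_on (square r) (\<lambda>p. g (snd p))"
      by (rule continuous_on_compose2) (auto intro!: continuous_intros simp: cbox_Pair_eq)
    show "continuous_on (square r) (\<lambda>p. p2 (snd p))"
      by (rule continuous_on_compose2[OF p2(1)]) (use r in \<open>auto intro!: continuous_intros simp: cbox_Pair_eq\<close>)
  qed
  have cV: "continuous_on (square r) (\<lambda>p. gV (u p))"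
    using continuous_on_compose2[OF continuous_gV cont(1)] by blast
  have cT: "continuous_on (square r) ?T11" "continuous_on (square r) ?T22" "continuous_on (square r) ?T12"
    unfolding T11_def T22_def T12_def divide_inverse by (intro continuous_intros cont)+
  have cTd: "continuous_on (square r) T11x" "continuous_on (square r) T22y"
    "continuous_on (square r) T12x" "continuous_on (square r) T12y"
    unfolding T11x_def T22y_def T12x_def T12y_def divide_inverse by (intro continuous_intros cont c2 cV)+
  have cFG: "continuous_on (square r) Fx" "continuous_on (square r) Gy"
    unfolding Fx_def Gy_def by (intro continuous_intros cf cg cT cTd cutoff_cont)+
  have div: "integral (square r) (\<lambda>p. Fx p + Gy p) = 0"
  proof (rule divergence_square[OF r(1) cFG])
    fix x y assume xy: "(x, y) \<in> square r"
    show "((\<lambda>t. F (t, y)) has_real_derivative Fx (x, y)) (at x)"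
      unfolding F_def Fx_def cutoff_def fst_conv snd_conv
      by (rule DERIV_cong, rule DERIV_mult[OF DERIV_mult[OF bump_deriv DERIV_const]
            DERIV_add[OF DERIV_mult[OF f(1)[OF xin(1)[OF xy]] d11[OF xy]] DERIV_mult[OF DERIV_const d12x[OF xy]]]])
        (simp add: algebra_simps)
    show "((\<lambda>t. G (x, t)) has_real_derivative Gy (x, y)) (at y)"
      unfolding G_def Gy_def cutoff_def fst_conv snd_conv
      by (rule DERIV_cong, rule DERIV_mult[OF DERIV_mult[OF DERIV_const bump_deriv]
            DERIV_add[OF DERIV_mult[OF DERIV_const d12y[OF xy]] DERIV_mult[OF g(1)[OF xin(2)[OF xy]] d22[OF xy]]]])
        (simp add: algebra_simps)
  qed (use r in \<open>auto simp: F_def G_def\<close>)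
  have \<delta>: "0 \<le> \<delta>" using f(2)[of 0] by linarith
  define J where "J p = cutoff r p * (p1 (fst p) * ?T11 p + p2 (snd p) * ?T22 p)" for p
  have pw: "J p \<le> (Fx p + Gy p) + 16 / r * \<delta> * energy \<epsilon> u ux uy p" if p: "p \<in> square r" for p
  proof -
    let ?e = "energy \<epsilon> u ux uy p"
    have lap: "ux p \<bullet> uxx p + ux p \<bullet> uyy p = (gV (u p) \<bullet> ux p) / \<epsilon>\<^sup>2"
      "uy p \<bullet> uxx p + uy p \<bullet> uyy p = (gV (u p) \<bullet> uy p) / \<epsilon>\<^sup>2"
      by (simp_all only: inner_add_right[symmetric] pde[OF p]) (simp_all add: inner_commute)
    \<comment> \<open>The equation paired with \<open>ux\<close>, and in \<open>z2\<close> with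
      \<open>uy\<close>. This removes the terms in which \<open>f\<close> and \<open>g\<close> stand
      undifferentiated next to derivatives of the tensor.\<close>
    have z1: "T11x p + T12y p = 0"
    proof -
      have "T11x p + T12y p = - \<epsilon> * (ux p \<bullet> uxx p + ux p \<bullet> uyy p) + (gV (u p) \<bullet> ux p) / \<epsilon>"
        by (simp add: T11x_def T12y_def inner_commute algebra_simps)
      then show ?thesis unfolding lap using \<epsilon> by (simp add: power2_eq_square)
    qed
    have z2: "T12x p + T22y p = 0"
    proof -
      have "T12x p + T22y p = - \<epsilon> * (uy p \<bullet> uxx p + uy p \<bullet> uyy p) + (gV (u p) \<bullet> uy p) / \<epsilon>"
        by (simp add: T12x_def T22y_def inner_commute algebra_simps)
      then show ?thesis unfolding lap using \<epsilon> by (simp add: power2_eq_square)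
    qed
    obtain x y where pxy: "p = (x, y)" by (cases p)
    have fb: "\<bar>f (fst p)\<bar> \<le> \<delta>" "\<bar>g (snd p)\<bar> \<le> \<delta>"
      using f(2)[OF xin(1)] g(2)[OF xin(2)] p pxy by auto
    have e0: "0 \<le> ?e" by (rule energy_nonneg[OF \<epsilon>])
    \<comment> \<open>Only the derivatives of the cutoff are left as errors. Each of the two error
      terms has a factor \<open>4 / r\<close> and two tensor entries of size at most \<delta> times
      the energy, which gives \<open>16 / r\<close> in total.\<close>
    have Err: "\<bar>c * (f (fst p) * A + g (snd p) * B)\<bar> \<le> 8 / r * \<delta> * ?e"
      if "\<bar>c\<bar> \<le> 4 / r" "\<bar>A\<bar> \<le> ?e" "\<bar>B\<bar> \<le> ?e" for c A B
    proof -
      have "\<bar>f (fst p) * A\<bar> \<le> \<delta> * ?e" "\<bar>g (snd p) * B\<bar> \<le> \<delta> * ?e"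
        unfolding abs_mult using fb that \<delta> by (auto intro!: mult_mono)
      then have "\<bar>f (fst p) * A + g (snd p) * B\<bar> \<le> 2 * (\<delta> * ?e)" by linarith
      then have "\<bar>c\<bar> * \<bar>f (fst p) * A + g (snd p) * B\<bar> \<le> 4 / r * (2 * (\<delta> * ?e))"
        using that r by (intro mult_mono) auto
      then show ?thesis by (simp add: abs_mult)
    qed
    have b1: "\<bar>bump' r (fst p) * bump r (snd p)\<bar> \<le> 4 / r" "\<bar>bump r (fst p) * bump' r (snd p)\<bar> \<le> 4 / r"
      using mult_mono[OF bump'_bound[OF r(1), of "fst p"] bump_bounds(2)[of r "snd p"]]
        mult_mono[OF bump_bounds(2)[of r "fst p"] bump'_bound[OF r(1), of "snd p"]] bump_bounds(1) r
      by (auto simp: abs_mult)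
    note sb = stress_bounds[OF \<epsilon>, where u = u and ux = ux and uy = uy and p = p]
    have "Fx p + Gy p = J p + bump' r (fst p) * bump r (snd p) * (f (fst p) * ?T11 p + g (snd p) * ?T12 p)
       + bump r (fst p) * bump' r (snd p) * (f (fst p) * ?T12 p + g (snd p) * ?T22 p)
       + cutoff r p * (f (fst p) * (T11x p + T12y p) + g (snd p) * (T12x p + T22y p))"
      unfolding Fx_def Gy_def J_def by (simp add: algebra_simps)
    also have "\<dots> = J p + bump' r (fst p) * bump r (snd p) * (f (fst p) * ?T11 p + g (snd p) * ?T12 p)
       + bump r (fst p) * bump' r (snd p) * (f (fst p) * ?T12 p + g (snd p) * ?T22 p)" unfolding z1 z2 by simp
    finally show ?thesis
      using Err[OF b1(1) sb(1) sb(3)] Err[OF b1(2) sb(3) sb(2)] by (simp add: abs_le_iff)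
  qed
  have cJ: "continuous_on (square r) J" unfolding J_def by (intro continuous_intros cutoff_cont cf cg cT)
  have "integral (square r) J \<le> integral (square r) (\<lambda>p. (Fx p + Gy p) + 16 / r * \<delta> * energy \<epsilon> u ux uy p)"
    using pw r by (intro integral_le integrable_continuous continuous_intros cJ cFG cont) auto
  also have "\<dots> = integral (square r) (\<lambda>p. Fx p + Gy p) + 16 / r * \<delta> * integral (square r) (energy \<epsilon> u ux uy)"
    using cFG cont(6) r by (subst integral_add) (auto intro!: integrable_continuous continuous_intros)
  finally show ?thesis using div by (simp add: J_def[abs_def])
qed

text \<open>The argument of a weight is a squared distance to a zero, hence only
  \<open>t \<ge> 0\<close> matters. The weight vanishes from \<open>\<mu>\<^sup>2\<close> on because
  the quadratic bounds for the potential hold up to distance \<mu>; the sign of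
  \<open>\<tau>'\<close> is the one that Cauchy-Schwarz needs.\<close>

definition admissible_weight :: "(real \<Rightarrow> real) \<Rightarrow> (real \<Rightarrow> real) \<Rightarrow> bool" where
  "admissible_weight \<tau> \<tau>' \<longleftrightarrow>
     (\<forall>t\<ge>0. (\<tau> has_real_derivative \<tau>' t) (at t)) \<and> continuous_on {0..} \<tau>' \<and>
     (\<forall>t\<ge>0. 0 \<le> \<tau> t \<and> \<tau> t \<le> 1 \<and> \<tau>' t \<le> 0) \<and> (\<forall>t\<ge>\<mu>\<^sup>2. \<tau> t = 0 \<and> \<tau>' t = 0)"

text \<open>The plain choice, the squared positive part of \<open>1 - t / \<mu>\<^sup>2\<close>. Its
  coefficient \<open>\<tau> t + 2 * t * \<tau>' t\<close> may be as bad as a negative constant, so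
  it serves where the solution is within \<open>\<mu> / 4\<close> of the zero or where the gradient
  is bounded by other means.\<close>

lemma quadratic_weight:
  obtains \<tau> \<tau>' where "admissible_weight \<tau> \<tau>'" "\<And>t. 0 \<le> t \<Longrightarrow> -1 \<le> \<tau> t + 2 * t * \<tau>' t"
    "\<And>t. 0 \<le> t \<Longrightarrow> t \<le> \<mu>\<^sup>2 / 16 \<Longrightarrow> 1/4 \<le> \<tau> t + 2 * t * \<tau>' t"
    "\<And>t. 0 \<le> t \<Longrightarrow> t \<le> \<mu>\<^sup>2 / 16 \<Longrightarrow> 1/4 \<le> \<tau> t"
proof -
  define m where "m t = max 0 (1 - t * inverse (\<mu>\<^sup>2))" for t
  define \<tau> where "\<tau> t = (m t)\<^sup>2" for t
  define \<tau>' where "\<tau>' t = - 2 * m t * inverse (\<mu>\<^sup>2)" for t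
  have im: "0 < inverse (\<mu>\<^sup>2)" using pos by simp
  have d: "(\<tau> has_real_derivative \<tau>' t) (at t)" for t
  proof -
    have "((\<lambda>t. 1 - t * inverse (\<mu>\<^sup>2)) has_real_derivative - inverse (\<mu>\<^sup>2)) (at t)"
      by (rule derivative_eq_intros refl)+ simp
    from DERIV_chain2[OF has_real_derivative_pos_square this]
    show ?thesis by (simp add: \<tau>_def[abs_def] \<tau>'_def m_def)
  qed
  have m: "0 \<le> m t" "m t \<le> 1" if "0 \<le> t" for t using that im by (auto simp: m_def)
  have big: "m t = 0" if "\<mu>\<^sup>2 \<le> t" for t using that pos by (simp add: m_def field_simps)
  have c: "continuous_on {0..} \<tau>'" unfolding \<tau>'_def m_def by (intro continuous_intros)
  have 1: "admissible_weight \<tau> \<tau>'"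
    using d c m big im unfolding admissible_weight_def by (auto simp: \<tau>_def \<tau>'_def power_le_one)
  have e: "\<tau> t + 2 * t * \<tau>' t = m t * (m t - 4 * (t * inverse (\<mu>\<^sup>2)))" for t
    by (simp add: \<tau>_def \<tau>'_def power2_eq_square algebra_simps)
  have 2: "-1 \<le> \<tau> t + 2 * t * \<tau>' t" if "0 \<le> t" for t
  proof (cases "t * inverse (\<mu>\<^sup>2) \<le> 1")
    case True
    define s where "s = t * inverse (\<mu>\<^sup>2)"
    have s: "m t = 1 - s" "s \<le> 1" "0 \<le> s" using True that im by (auto simp: m_def s_def)
    \<comment> \<open>For \<open>s = t / \<mu>\<^sup>2\<close> the coefficient is
      \<open>(1 - s) * (1 - 5 * s)\<close>, with minimum -4/5 at \<open>s = 3/5\<close>.\<close>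
    have "0 \<le> 5 * (s - 3/5)\<^sup>2" by simp
    then have "-1 \<le> (1 - s) * (1 - s - 4 * s)" by (simp add: power2_eq_square algebra_simps)
    then show ?thesis unfolding e s_def[symmetric] s(1) .
  next
    case False then show ?thesis unfolding e by (simp add: m_def)
  qed
  have s16: "t * inverse (\<mu>\<^sup>2) \<le> 1/16" if "t \<le> \<mu>\<^sup>2 / 16" for t
    using that pos by (simp add: field_simps)
  have 3: "1/4 \<le> \<tau> t + 2 * t * \<tau>' t" if "0 \<le> t" "t \<le> \<mu>\<^sup>2 / 16" for t
  proof -
    define s where "s = t * inverse (\<mu>\<^sup>2)"
    have s: "m t = 1 - s" "s \<le> 1/16" using s16[OF that(2)] by (auto simp: m_def s_def)
    have "(15/16) * (11/16) \<le> (1 - s) * (1 - s - 4 * s)" using s by (intro mult_mono) auto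
    then show ?thesis unfolding e s_def[symmetric] s(1) by simp
  qed
  have 4: "1/4 \<le> \<tau> t" if "0 \<le> t" "t \<le> \<mu>\<^sup>2 / 16" for t
  proof -
    have "15/16 \<le> m t" using s16[OF that(2)] by (auto simp: m_def)
    then have "(15/16)\<^sup>2 \<le> (m t)\<^sup>2" by (intro power_mono) auto
    then show ?thesis by (simp add: \<tau>_def power2_eq_square)
  qed
  show thesis using that 1 2 3 4 by blast
qed

text \<open>The weight is \<open>(1 + t / \<kappa>\<^sup>2) powr (-1/2)\<close> times a cutoff: the field \<open>p \<mapsto> \<tau> (|p|\<^sup>2) p\<close> has length
  at most \<open>\<kappa>\<close> and, apart from the cutoff, is the gradient of the convex function
  \<open>\<kappa> * sqrt (\<kappa>\<^sup>2 + |p|\<^sup>2)\<close>.\<close>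

lemma truncated_weight:
  assumes \<kappa>: "0 < \<kappa>" "\<kappa> \<le> \<mu> / 4"
  obtains \<tau> \<tau>' where "admissible_weight \<tau> \<tau>'" "\<And>t. 0 \<le> t \<Longrightarrow> - (4 * \<kappa> / \<mu>) \<le> \<tau> t + 2 * t * \<tau>' t"
    "\<And>t. 0 \<le> t \<Longrightarrow> t \<le> \<kappa>\<^sup>2 \<Longrightarrow> 1/4 - 4 * \<kappa> / \<mu> \<le> \<tau> t + 2 * t * \<tau>' t"
    "\<And>t. 0 \<le> t \<Longrightarrow> t \<le> \<kappa>\<^sup>2 \<Longrightarrow> 1/4 \<le> \<tau> t"
proof -
  define m where "m t = max 0 (1 - t * inverse (\<mu>\<^sup>2))" for t
  define S where "S t = sqrt (1 + t * inverse (\<kappa>\<^sup>2))" for t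
  define \<tau> where "\<tau> t = inverse (S t) * (m t)\<^sup>2" for t
  define \<tau>' where "\<tau>' t = - (inverse (\<kappa>\<^sup>2) / 2 * inverse (S t) ^ 3) * (m t)\<^sup>2 - inverse (S t) * (2 * m t * inverse (\<mu>\<^sup>2))" for t
  have im: "0 < inverse (\<mu>\<^sup>2)" "0 < inverse (\<kappa>\<^sup>2)" using pos \<kappa> by auto
  have S2: "(S t)\<^sup>2 = 1 + t * inverse (\<kappa>\<^sup>2)" if "0 \<le> t" for t using that im by (simp add: S_def)
  have S1: "1 \<le> S t" if "0 \<le> t" for t using that im by (simp add: S_def)
  have d: "(\<tau> has_real_derivative \<tau>' t) (at t)" if t: "0 \<le> t" for t
  proof -
    have p: "0 < 1 + t * inverse (\<kappa>\<^sup>2)" using t im by (simp add: add_pos_nonneg)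
    have "((\<lambda>t. 1 - t * inverse (\<mu>\<^sup>2)) has_real_derivative - inverse (\<mu>\<^sup>2)) (at t)"
      by (rule derivative_eq_intros refl)+ simp
    from DERIV_chain2[OF has_real_derivative_pos_square this]
    have dm: "((\<lambda>t. (m t)\<^sup>2) has_real_derivative - (2 * m t * inverse (\<mu>\<^sup>2))) (at t)"
      by (simp add: m_def)
    have "((\<lambda>t. 1 + t * inverse (\<kappa>\<^sup>2)) has_real_derivative inverse (\<kappa>\<^sup>2)) (at t)"
      by (rule derivative_eq_intros refl)+ simp
    from DERIV_chain2[OF DERIV_real_sqrt[OF p] this]
    have dS: "(S has_real_derivative inverse (S t) / 2 * inverse (\<kappa>\<^sup>2)) (at t)"
      by (simp add: S_def[abs_def])
    have "S t \<noteq> 0" using S1[OF t] by auto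
    from DERIV_inverse_fun[OF dS this]
    have dI: "((\<lambda>t. inverse (S t)) has_real_derivative - (inverse (\<kappa>\<^sup>2) / 2 * inverse (S t) ^ 3)) (at t)"
      by (rule DERIV_cong) (simp add: power3_eq_cube)
    show ?thesis unfolding \<tau>_def \<tau>'_def
      by (rule DERIV_cong, rule DERIV_mult[OF dI dm]) (simp add: algebra_simps)
  qed
  have m: "0 \<le> m t" "m t \<le> 1" if "0 \<le> t" for t using that im by (auto simp: m_def)
  have big: "m t = 0" if "\<mu>\<^sup>2 \<le> t" for t using that pos by (simp add: m_def field_simps)
  have iS: "0 < inverse (S t)" "inverse (S t) \<le> 1" if "0 \<le> t" for t
    using S1[OF that] by (auto simp: inverse_le_1_iff)
  have c: "continuous_on {0..} \<tau>'"
  proof -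
    have cS: "continuous_on {0..} S" unfolding S_def by (intro continuous_intros)
    have "\<forall>t\<in>{0..}. S t \<noteq> 0" using S1 by force
    then show ?thesis unfolding \<tau>'_def m_def divide_inverse by (intro continuous_intros cS)
  qed
  have nn: "0 \<le> \<tau> t" "\<tau> t \<le> 1" "\<tau>' t \<le> 0" if t: "0 \<le> t" for t
  proof -
    show "0 \<le> \<tau> t" unfolding \<tau>_def using iS[OF t] by simp
    have "inverse (S t) * (m t)\<^sup>2 \<le> 1 * 1" using iS[OF t] m[OF t] by (intro mult_mono) (auto simp: power_le_one)
    then show "\<tau> t \<le> 1" by (simp add: \<tau>_def)
    have "0 \<le> (inverse (\<kappa>\<^sup>2) / 2 * inverse (S t) ^ 3) * (m t)\<^sup>2" using iS[OF t] im by simp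
    moreover have "0 \<le> inverse (S t) * (2 * m t * inverse (\<mu>\<^sup>2))" using iS[OF t] im m[OF t] by simp
    ultimately show "\<tau>' t \<le> 0" unfolding \<tau>'_def mult_minus_left by linarith
  qed
  have 1: "admissible_weight \<tau> \<tau>'"
    using d c nn big unfolding admissible_weight_def by (auto simp: \<tau>_def \<tau>'_def)
  \<comment> \<open>The first summand is the contribution of the convex function:
    \<open>(S t)\<^sup>2 - t / \<kappa>\<^sup>2 = 1\<close> leaves the positive cube of
    \<open>inverse (S t)\<close>. Only the second one, from the cutoff \<open>m\<close>, can be
    negative.\<close>
  have e: "\<tau> t + 2 * t * \<tau>' t = inverse (S t) ^ 3 * (m t)\<^sup>2 - 4 * (t * inverse (S t)) * m t * inverse (\<mu>\<^sup>2)" if t: "0 \<le> t" for t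
  proof -
    have "\<tau> t + 2 * t * \<tau>' t = inverse (S t) ^ 3 * (m t)\<^sup>2 * ((S t)\<^sup>2 - t * inverse (\<kappa>\<^sup>2)) - 4 * (t * inverse (S t)) * m t * inverse (\<mu>\<^sup>2)"
      unfolding \<tau>_def \<tau>'_def using S1[OF t] by (simp add: power2_eq_square power3_eq_cube field_simps)
    then show ?thesis unfolding S2[OF t] by simp
  qed
  \<comment> \<open>\<open>sqrt t\<close> is at most \<open>\<kappa> * S t\<close> by definition of
    \<open>S\<close> and at most \<mu> on the support of \<open>m\<close>. Multiplying the two
    bounds shows that the cutoff costs only a multiple of \<open>\<kappa> / \<mu>\<close>, so a
    small \<kappa> makes it negligible.\<close>
  have err: "4 * (t * inverse (S t)) * m t * inverse (\<mu>\<^sup>2) \<le> 4 * \<kappa> / \<mu>" if t: "0 \<le> t" for t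
  proof (cases "t < \<mu>\<^sup>2")
    case True
    have "(sqrt t / \<kappa>)\<^sup>2 \<le> (S t)\<^sup>2" unfolding S2[OF t] using t by (simp add: divide_inverse power_mult_distrib power_inverse)
    then have "sqrt t / \<kappa> \<le> S t" by (rule power2_le_imp_le) (use S1[OF t] in linarith)
    then have st: "sqrt t \<le> \<kappa> * S t" using \<kappa> by (simp add: divide_le_eq mult.commute)
    have sm: "sqrt t \<le> \<mu>" using True pos by (intro real_le_lsqrt) auto
    have "t = sqrt t * sqrt t" using t by simp
    also have "\<dots> \<le> \<mu> * (\<kappa> * S t)" using st sm t pos by (intro mult_mono) auto
    finally have tS: "t * inverse (S t) \<le> \<mu> * \<kappa>" using S1[OF t] by (simp add: field_simps)
    have "(t * inverse (S t)) * m t \<le> (\<mu> * \<kappa>) * 1"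
      by (rule mult_mono[OF tS m(2)[OF t]]) (use m[OF t] pos \<kappa> in auto)
    then have "4 * ((t * inverse (S t)) * m t) * inverse (\<mu>\<^sup>2) \<le> 4 * (\<mu> * \<kappa>) * inverse (\<mu>\<^sup>2)" using im
      by (intro mult_right_mono mult_left_mono) auto
    also have "\<dots> = 4 * \<kappa> / \<mu>" using pos by (simp add: power2_eq_square field_simps)
    finally show ?thesis by (simp add: mult.assoc)
  next
    case False then show ?thesis using big[of t] \<kappa> pos by simp
  qed
  have 2: "- (4 * \<kappa> / \<mu>) \<le> \<tau> t + 2 * t * \<tau>' t" if t: "0 \<le> t" for t
  proof -
    have "0 \<le> inverse (S t) ^ 3 * (m t)\<^sup>2" using iS[OF t] by simp
    then show ?thesis unfolding e[OF t] using err[OF t] by linarith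
  qed
  have small: "15/16 \<le> m t" "2/3 \<le> inverse (S t)" if t: "0 \<le> t" "t \<le> \<kappa>\<^sup>2" for t
  proof -
    have "t \<le> (\<mu> / 4)\<^sup>2" using t power_mono[OF \<kappa>(2), of 2] \<kappa> by linarith
    then have "t * inverse (\<mu>\<^sup>2) \<le> 1/16" using pos by (simp add: field_simps)
    then show "15/16 \<le> m t" by (auto simp: m_def)
    have "(S t)\<^sup>2 \<le> 2" unfolding S2[OF t(1)] using t \<kappa> by (simp add: field_simps)
    then have "(S t)\<^sup>2 \<le> (3/2)\<^sup>2" by (simp add: power2_eq_square)
    then have "S t \<le> 3/2" by (rule power2_le_imp_le) simp
    then have "inverse (3/2) \<le> inverse (S t)" using S1[OF t(1)] by (intro le_imp_inverse_le) auto
    then show "2/3 \<le> inverse (S t)" by simp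
  qed
  have m2: "(15/16)\<^sup>2 \<le> (m t)\<^sup>2" if "0 \<le> t" "t \<le> \<kappa>\<^sup>2" for t using small(1)[OF that] by (intro power_mono) auto
  have 3: "1/4 - 4 * \<kappa> / \<mu> \<le> \<tau> t + 2 * t * \<tau>' t" if t: "0 \<le> t" "t \<le> \<kappa>\<^sup>2" for t
  proof -
    have "(2/3)^3 * (15/16)\<^sup>2 \<le> inverse (S t) ^ 3 * (m t)\<^sup>2"
      by (rule mult_mono[OF power_mono[OF small(2)[OF t]] m2[OF t]]) (use iS[OF t(1)] in auto)
    then have "1/4 \<le> inverse (S t) ^ 3 * (m t)\<^sup>2" by (simp add: power2_eq_square power3_eq_cube)
    then show ?thesis unfolding e[OF t(1)] using err[OF t(1)] by linarith
  qed
  have 4: "1/4 \<le> \<tau> t" if t: "0 \<le> t" "t \<le> \<kappa>\<^sup>2" for t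
  proof -
    have "(2/3) * (15/16)\<^sup>2 \<le> inverse (S t) * (m t)\<^sup>2"
      by (rule mult_mono[OF small(2)[OF t] m2[OF t]]) (use iS[OF t(1)] in auto)
    then show ?thesis by (simp add: \<tau>_def power2_eq_square)
  qed
  show thesis using that 1 2 3 4 by blast
qed

end

section \<open>Energy decay and clearing out\<close>

context potential
begin

text \<open>The integrand of \<open>weighted_energy_estimate\<close> without the cutoff. With
  \<open>q = |u - \<sigma>|\<^sup>2\<close>, the coefficient
  \<open>\<tau> q + 2 * q * \<tau>' q\<close> is the derivative of the field
  \<open>p \<mapsto> \<tau> (|p|\<^sup>2) p\<close> in the radial direction, the smallest one since
  \<open>\<tau>'\<close> is nonpositive; in the other directions it is
  \<open>\<tau> q\<close>.\<close>

definition weighted_density ::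
    "(real \<Rightarrow> real) \<Rightarrow> (real \<Rightarrow> real) \<Rightarrow> 'a \<Rightarrow> real \<Rightarrow> (real \<times> real \<Rightarrow> 'a) \<Rightarrow> (real \<times> real \<Rightarrow> 'a) \<Rightarrow>
      (real \<times> real \<Rightarrow> 'a) \<Rightarrow> real \<times> real \<Rightarrow> real" where
  "weighted_density \<tau> \<tau>' \<sigma> \<epsilon> u ux uy p =
     (\<tau> ((norm (u p - \<sigma>))\<^sup>2) + 2 * (norm (u p - \<sigma>))\<^sup>2 * \<tau>' ((norm (u p - \<sigma>))\<^sup>2)) * (\<epsilon> * grad_sq ux uy p)
      + a / b * (\<tau> ((norm (u p - \<sigma>))\<^sup>2) * V (u p) / \<epsilon>)"

lemma weighted_density_cont:
  assumes sol: "solves \<epsilon> S u ux uy" and \<tau>: "admissible_weight \<tau> \<tau>'"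
  shows "continuous_on S (weighted_density \<tau> \<tau>' \<sigma> \<epsilon> u ux uy)"
proof -
  note cont = solves_continuous[OF sol]
  have cq: "continuous_on S (\<lambda>p. (norm (u p - \<sigma>))\<^sup>2)" by (intro continuous_intros cont)
  have "continuous_on {0..} \<tau>"
    using \<tau> unfolding admissible_weight_def by (meson DERIV_continuous atLeast_iff continuous_at_imp_continuous_on)
  then have 1: "continuous_on S (\<lambda>p. \<tau> ((norm (u p - \<sigma>))\<^sup>2))"
    by (rule continuous_on_compose2[OF _ cq]) auto
  have "continuous_on {0..} \<tau>'" using \<tau> by (simp add: admissible_weight_def)
  then have 2: "continuous_on S (\<lambda>p. \<tau>' ((norm (u p - \<sigma>))\<^sup>2))"
    by (rule continuous_on_compose2[OF _ cq]) auto
  show ?thesis unfolding weighted_density_def divide_inverse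
    by (intro continuous_intros cont 1 2)
qed

lemma weighted_density_estimate:
  assumes "0 < r" "0 < \<epsilon>" "solves \<epsilon> (square r) u ux uy" "\<sigma> \<in> Z" "admissible_weight \<tau> \<tau>'"
  shows "integral (square r) (\<lambda>p. cutoff r p * weighted_density \<tau> \<tau>' \<sigma> \<epsilon> u ux uy p)
      \<le> 4 / (r * sqrt a) * \<epsilon> * integral (square r) (energy \<epsilon> u ux uy)"
  unfolding weighted_density_def
  by (rule weighted_energy_estimate) (use assms in \<open>auto simp: admissible_weight_def\<close>)

lemma weighted_density_lower:
  assumes \<epsilon>: "0 < \<epsilon>" and \<tau>: "admissible_weight \<tau> \<tau>'"
    and c: "c1 \<le> \<tau> ((norm (u p - \<sigma>))\<^sup>2) + 2 * (norm (u p - \<sigma>))\<^sup>2 * \<tau>' ((norm (u p - \<sigma>))\<^sup>2)"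
      "c2 \<le> \<tau> ((norm (u p - \<sigma>))\<^sup>2)"
  shows "c1 * (\<epsilon> * grad_sq ux uy p) + a / b * (c2 * (V (u p) / \<epsilon>)) \<le> weighted_density \<tau> \<tau>' \<sigma> \<epsilon> u ux uy p"
proof -
  have "c1 * (\<epsilon> * grad_sq ux uy p) \<le> (\<tau> ((norm (u p - \<sigma>))\<^sup>2) + 2 * (norm (u p - \<sigma>))\<^sup>2 * \<tau>' ((norm (u p - \<sigma>))\<^sup>2)) * (\<epsilon> * grad_sq ux uy p)"
    using c(1) \<epsilon> grad_sq_nonneg by (intro mult_right_mono) auto
  moreover have "a / b * (c2 * (V (u p) / \<epsilon>)) \<le> a / b * (\<tau> ((norm (u p - \<sigma>))\<^sup>2) * (V (u p) / \<epsilon>))"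
    using c(2) \<epsilon> V_nonneg pos by (intro mult_left_mono mult_right_mono) auto
  ultimately show ?thesis by (simp add: weighted_density_def)
qed

lemma energy_integral_mono:
  assumes "0 < \<epsilon>" "solves \<epsilon> (square R) u ux uy" "r \<le> R"
  shows "integral (square r) (energy \<epsilon> u ux uy) \<le> integral (square R) (energy \<epsilon> u ux uy)"
proof (rule integral_subset_le)
  show sub: "square r \<subseteq> square R" using assms by (auto simp: cbox_Pair_eq)
  have "continuous_on (square R) (energy \<epsilon> u ux uy)" by (rule solves_continuous[OF assms(2)])
  then show "energy \<epsilon> u ux uy integrable_on square r" "energy \<epsilon> u ux uy integrable_on square R"
    using continuous_on_subset[OF _ sub] by (auto intro: integrable_continuous)
qed (use energy_nonneg assms in auto)

text \<open>Away from \<open>Z\<close> the gradient is controlled by the potential through the pointwise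
  gradient bound, and near \<open>Z\<close> by testing the equation.\<close>

lemma gradient_by_potential:
  fixes u ux uy :: "real \<times> real \<Rightarrow> 'a"
  assumes r: "0 < r" and \<epsilon>: "0 < \<epsilon>" and sol: "solves \<epsilon> (square r) u ux uy"
    and bd: "\<And>p. p \<in> square r \<Longrightarrow> \<epsilon>\<^sup>2 * grad_sq ux uy p \<le> bernstein_const"
  shows "integral (square r) (\<lambda>p. cutoff r p * (\<epsilon> * grad_sq ux uy p))
    \<le> 4 * (card Z * (4 / (r * sqrt a) * \<epsilon> * integral (square r) (energy \<epsilon> u ux uy))
       + (card Z + 1) * (bernstein_const / v0) * integral (square r) (\<lambda>p. cutoff r p * (V (u p) / \<epsilon>)))"
proof -
  obtain \<tau> \<tau>' where \<tau>: "admissible_weight \<tau> \<tau>'" "\<And>t. 0 \<le> t \<Longrightarrow> -1 \<le> \<tau> t + 2 * t * \<tau>' t"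
    "\<And>t. 0 \<le> t \<Longrightarrow> t \<le> \<mu>\<^sup>2 / 16 \<Longrightarrow> 1/4 \<le> \<tau> t + 2 * t * \<tau>' t"
    "\<And>t. 0 \<le> t \<Longrightarrow> t \<le> \<mu>\<^sup>2 / 16 \<Longrightarrow> 1/4 \<le> \<tau> t"
    by (rule quadratic_weight) blast
  let ?w = "\<lambda>\<sigma>. weighted_density \<tau> \<tau>' \<sigma> \<epsilon> u ux uy"
  let ?C = "(card Z + 1) * (bernstein_const / v0)"
  note cont = solves_continuous[OF sol]
  have \<tau>0: "0 \<le> \<tau> t" if "0 \<le> t" for t using \<tau>(1) that by (auto simp: admissible_weight_def)
  have pw: "\<epsilon> * grad_sq ux uy p / 4 \<le> (\<Sum>\<sigma>\<in>Z. ?w \<sigma> p) + ?C * (V (u p) / \<epsilon>)" if p: "p \<in> square r" for p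
  proof (cases "\<exists>\<sigma>\<in>Z. norm (u p - \<sigma>) < \<mu> / 4")
    case True
    then obtain \<sigma>0 where \<sigma>0: "\<sigma>0 \<in> Z" "norm (u p - \<sigma>0) < \<mu> / 4" by blast
    \<comment> \<open>Balls of radius \<mu> about different zeros are disjoint, so the densities of
      all other zeros vanish together with \<open>\<tau>\<close> and \<open>\<tau>'\<close>.\<close>
    have "?w \<sigma> p = 0" if "\<sigma> \<in> Z - {\<sigma>0}" for \<sigma>
    proof -
      have "\<not> norm (u p - \<sigma>) \<le> \<mu>"
        using zero_unique[OF \<sigma>0(1), of \<sigma> "u p"] \<sigma>0(2) that pos by auto
      then have "\<mu>\<^sup>2 \<le> (norm (u p - \<sigma>))\<^sup>2" using pos by (intro power_mono) auto
      then show ?thesis using \<tau>(1) by (simp add: weighted_density_def admissible_weight_def)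
    qed
    then have sum: "(\<Sum>\<sigma>\<in>Z. ?w \<sigma> p) = ?w \<sigma>0 p"
      using sum.remove[OF finite_Z \<sigma>0(1), of "\<lambda>\<sigma>. ?w \<sigma> p"] by simp
    have "(norm (u p - \<sigma>0))\<^sup>2 \<le> (\<mu> / 4)\<^sup>2" using \<sigma>0(2) by (intro power_mono) auto
    then have q: "(norm (u p - \<sigma>0))\<^sup>2 \<le> \<mu>\<^sup>2 / 16" by (simp add: power_divide)
    have "1/4 * (\<epsilon> * grad_sq ux uy p) + a / b * (0 * (V (u p) / \<epsilon>)) \<le> ?w \<sigma>0 p"
      by (rule weighted_density_lower[OF \<epsilon> \<tau>(1) \<tau>(3) \<tau>0]) (use q in auto)
    then have "\<epsilon> * grad_sq ux uy p / 4 \<le> ?w \<sigma>0 p" by simp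
    moreover have "0 \<le> ?C * (V (u p) / \<epsilon>)" using pos bernstein_const_pos V_nonneg \<epsilon> by simp
    ultimately show ?thesis unfolding sum by linarith
  next
    case False
    have "v0 \<le> V (u p)"
    proof (rule far)
      fix \<sigma> assume "\<sigma> \<in> Z"
      then have "\<not> norm (u p - \<sigma>) < \<mu> / 4" using False by blast
      then show "\<mu> / 8 \<le> norm (u p - \<sigma>)" using pos by linarith
    qed
    let ?g = "\<epsilon> * grad_sq ux uy p"
    have g0: "0 \<le> ?g" using \<epsilon> grad_sq_nonneg by simp
    \<comment> \<open>Far from the zeros both the scaled gradient and the potential are comparable
      to constants over \<epsilon>, so the pointwise bound converts gradient into potential.\<close>
    have "?g = (\<epsilon>\<^sup>2 * grad_sq ux uy p) / \<epsilon>" using \<epsilon> by (simp add: power2_eq_square)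
    also have "\<dots> \<le> bernstein_const / \<epsilon>" using bd[OF p] \<epsilon> by (intro divide_right_mono) auto
    also have "\<dots> = bernstein_const / v0 * (v0 / \<epsilon>)" using pos by simp
    also have "\<dots> \<le> bernstein_const / v0 * (V (u p) / \<epsilon>)"
      using \<open>v0 \<le> V (u p)\<close> bernstein_const_pos pos \<epsilon> by (intro mult_left_mono divide_right_mono) auto
    finally have g: "?g \<le> bernstein_const / v0 * (V (u p) / \<epsilon>)" .
    \<comment> \<open>Integration requires one integrand for all points, so the densities of all
      zeros are summed. Far from the zeros each may be as low as \<open>- ?g\<close>, and
      \<open>card Z + 1\<close> copies of the potential bound offset this and leave one
      \<open>?g\<close> over.\<close>
    have "- ?g \<le> ?w \<sigma> p" for \<sigma>
      using weighted_density_lower[OF \<epsilon> \<tau>(1) \<tau>(2) \<tau>0, where p = p and u = u and \<sigma> = \<sigma> and ux = ux and uy = uy] by simp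
    then have "(\<Sum>\<sigma>\<in>Z. - ?g) \<le> (\<Sum>\<sigma>\<in>Z. ?w \<sigma> p)" by (intro sum_mono)
    then have "- (card Z * ?g) \<le> (\<Sum>\<sigma>\<in>Z. ?w \<sigma> p)" by simp
    moreover have "(card Z + 1) * ?g \<le> (card Z + 1) * (bernstein_const / v0 * (V (u p) / \<epsilon>))"
      using g by (intro mult_left_mono) auto
    moreover have "(card Z + 1) * ?g = card Z * ?g + ?g" by (simp add: algebra_simps)
    ultimately show ?thesis using g0 by (simp only: mult.assoc)
  qed
  have cw: "continuous_on (square r) (\<lambda>p. cutoff r p * ?w \<sigma> p)" for \<sigma>
    by (intro continuous_intros cutoff_cont weighted_density_cont[OF sol \<tau>(1)])
  have cV: "continuous_on (square r) (\<lambda>p. cutoff r p * (V (u p) / \<epsilon>))"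
    unfolding divide_inverse by (intro continuous_intros cutoff_cont cont)
  have cg: "continuous_on (square r) (\<lambda>p. cutoff r p * (\<epsilon> * grad_sq ux uy p))"
    by (intro continuous_intros cutoff_cont cont)
  have "integral (square r) (\<lambda>p. 1/4 * (cutoff r p * (\<epsilon> * grad_sq ux uy p)))
     \<le> integral (square r) (\<lambda>p. (\<Sum>\<sigma>\<in>Z. cutoff r p * ?w \<sigma> p) + ?C * (cutoff r p * (V (u p) / \<epsilon>)))"
  proof (rule integral_le)
    fix p assume "p \<in> square r"
    from mult_left_mono[OF pw[OF this] cutoff_bounds(1)[of r p]]
    show "1/4 * (cutoff r p * (\<epsilon> * grad_sq ux uy p)) \<le> (\<Sum>\<sigma>\<in>Z. cutoff r p * ?w \<sigma> p) + ?C * (cutoff r p * (V (u p) / \<epsilon>))"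
      by (simp add: sum_distrib_left distrib_left mult_ac)
  qed (intro integrable_continuous continuous_intros cg cw cV)+
  also have "\<dots> = (\<Sum>\<sigma>\<in>Z. integral (square r) (\<lambda>p. cutoff r p * ?w \<sigma> p))
      + ?C * integral (square r) (\<lambda>p. cutoff r p * (V (u p) / \<epsilon>))"
  proof -
    have iw: "(\<lambda>p. cutoff r p * ?w \<sigma> p) integrable_on square r" for \<sigma> using cw by (rule integrable_continuous)
    have iV: "(\<lambda>p. cutoff r p * (V (u p) / \<epsilon>)) integrable_on square r" using cV by (rule integrable_continuous)
    show ?thesis
      by (subst integral_add[OF integrable_sum[OF finite_Z iw] integrable_on_mult_right[OF iV]],
          subst integral_sum[OF finite_Z iw]) (simp only: integral_mult_right)
  qed
  also have "\<dots> \<le> (\<Sum>\<sigma>\<in>Z. 4 / (r * sqrt a) * \<epsilon> * integral (square r) (energy \<epsilon> u ux uy))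
      + ?C * integral (square r) (\<lambda>p. cutoff r p * (V (u p) / \<epsilon>))"
    by (intro add_right_mono sum_mono weighted_density_estimate r \<epsilon> sol \<tau>(1))
  finally have "1/4 * integral (square r) (\<lambda>p. cutoff r p * (\<epsilon> * grad_sq ux uy p))
     \<le> card Z * (4 / (r * sqrt a) * \<epsilon> * integral (square r) (energy \<epsilon> u ux uy))
        + ?C * integral (square r) (\<lambda>p. cutoff r p * (V (u p) / \<epsilon>))"
    unfolding integral_mult_right sum_constant .
  moreover have "x \<le> 4 * y" if "1/4 * x \<le> y" for x y :: real using that by simp
  ultimately show ?thesis by blast
qed

text \<open>Close to a zero a weighted density is at least \<open>1/4\<close> of
  \<open>\<epsilon> * grad_sq\<close> plus \<open>a / (4 * b)\<close> of the potential term. As the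
  energy contains half of \<open>\<epsilon> * grad_sq\<close>, this minimum is the fraction of the
  energy that is controlled.\<close>

definition near_const :: real where
  "near_const = min (1/2) (a / (4 * b))"

lemma near_const_pos: "0 < near_const"
  using pos by (simp add: near_const_def)

text \<open>The inner variation is effective where both lines are bad, the truncated test field
  elsewhere; the two inequalities are added pointwise before integrating. The bound is
  \<open>E\<close> times quantities that can all be made small: \<open>E / \<eta>\<close> from the
  measure of the bad lines, \<epsilon> from the cutoff in space, and \<open>\<kappa> / \<mu>\<close>
  from the truncation.\<close>

lemma potential_estimate:
  fixes u ux uy :: "real \<times> real \<Rightarrow> 'a"
  assumes \<epsilon>: "0 < \<epsilon>" "\<epsilon> \<le> 1" and sol: "solves \<epsilon> (square 1) u ux uy" and r: "0 < r" "r < 1"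
    and \<kappa>: "0 < \<kappa>" "\<kappa> \<le> \<mu> / 4" and \<eta>: "0 < \<eta>" "\<eta> \<le> v0" "line_const * \<eta> \<le> \<kappa>\<^sup>2"
  defines "E \<equiv> integral (square 1) (energy \<epsilon> u ux uy)"
  assumes small: "E < 2 * \<eta>"
  shows "integral (square r) (\<lambda>p. cutoff r p * (V (u p) / \<epsilon>))
    \<le> E * (8 / r * (E / \<eta>) + 2 / near_const * (4 / (r * sqrt a) * \<epsilon> + 8 * \<kappa> / \<mu>))"
proof -
  obtain \<tau> \<tau>' where \<tau>: "admissible_weight \<tau> \<tau>'" "\<And>t. 0 \<le> t \<Longrightarrow> - (4 * \<kappa> / \<mu>) \<le> \<tau> t + 2 * t * \<tau>' t"
    "\<And>t. 0 \<le> t \<Longrightarrow> t \<le> \<kappa>\<^sup>2 \<Longrightarrow> 1/4 - 4 * \<kappa> / \<mu> \<le> \<tau> t + 2 * t * \<tau>' t"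
    "\<And>t. 0 \<le> t \<Longrightarrow> t \<le> \<kappa>\<^sup>2 \<Longrightarrow> 1/4 \<le> \<tau> t"
    by (rule truncated_weight[OF \<kappa>]) blast
  define e where "e = energy \<epsilon> u ux uy"
  define A where "A x = integral {-1..1} (\<lambda>y. e (x, y))" for x
  define B where "B y = integral {-1..1} (\<lambda>x. e (x, y))" for y
  have ce: "continuous_on (square 1) e" unfolding e_def by (rule solves_continuous[OF sol])
  have e0: "0 \<le> e p" for p unfolding e_def by (rule energy_nonneg[OF \<epsilon>(1)])
  note LI = continuous_on_line_integrals[OF ce, folded A_def B_def]
  have A0: "0 \<le> A x" "0 \<le> B x" for x
    unfolding A_def B_def by (intro integral_nonneg_real e0)+
  have "\<kappa>\<^sup>2 \<le> (\<mu> / 4)\<^sup>2" using \<kappa> by (intro power_mono) auto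
  also have "\<dots> < \<mu>\<^sup>2" using pos by (simp add: power_divide)
  finally have "line_const * \<eta> < \<mu>\<^sup>2" using \<eta>(3) by linarith
  from good_lines[OF \<epsilon> sol \<eta>(2) this small[unfolded E_def]] obtain \<sigma> where \<sigma>: "\<sigma> \<in> Z"
    "\<And>x y. (x, y) \<in> square 1 \<Longrightarrow> A x < \<eta> \<or> B y < \<eta> \<Longrightarrow> (norm (u (x, y) - \<sigma>))\<^sup>2 \<le> line_const * \<eta>"
    unfolding A_def B_def e_def by blast
  \<comment> \<open>A continuous substitute for the indicator of the bad lines: it equals 1 on all
    of them, and being below \<open>A x / \<eta>\<close> it has integral at most
    \<open>E / \<eta>\<close>.\<close>
  define p1 where "p1 x = min 1 (A x / \<eta>)" for x
  define p2 where "p2 y = min 1 (B y / \<eta>)" for y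
  have p1: "continuous_on {-1..1} p1" "continuous_on {-1..1} p2"
    unfolding p1_def p2_def divide_inverse by (intro continuous_intros LI(1,2))+
  have p0: "0 \<le> p1 x" "0 \<le> p2 x" "p1 x \<le> 1" "p2 x \<le> 1" for x using A0 \<eta> by (auto simp: p1_def p2_def)
  have "integral {-1..1} p1 \<le> integral {-1..1} (\<lambda>x. A x / \<eta>)"
    using p1 LI(1) \<eta> by (intro integral_le integrable_continuous_real continuous_intros) (auto simp: p1_def)
  then have i1: "integral {-1..1} p1 \<le> E / \<eta>" using LI(3) by (simp add: E_def e_def)
  have "integral {-1..1} p2 \<le> integral {-1..1} (\<lambda>x. B x / \<eta>)"
    using p1 LI(2) \<eta> by (intro integral_le integrable_continuous_real continuous_intros) (auto simp: p2_def)
  then have i2: "integral {-1..1} p2 \<le> E / \<eta>" using LI(4) by (simp add: E_def e_def)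
  have sub: "square r \<subseteq> square 1" using r by (auto simp: cbox_Pair_eq)
  note sol_r = solves_subset[OF sol sub]
  note cont = solves_continuous[OF sol_r]
  define J where "J p = weighted_density \<tau> \<tau>' \<sigma> \<epsilon> u ux uy p" for p
  define g where "g p = \<epsilon> * grad_sq ux uy p" for p
  let ?T1 = "T11 \<epsilon> u ux uy" and ?T2 = "T22 \<epsilon> u ux uy"
  have E0: "0 \<le> E" unfolding E_def by (intro integral_nonneg_real energy_nonneg \<epsilon>)
  have Er: "integral (square r) e \<le> E" unfolding E_def e_def
    using energy_integral_mono[OF \<epsilon>(1) sol] r by simp
  have Er0: "0 \<le> integral (square r) e" by (intro integral_nonneg_real e0)
  have \<tau>0: "0 \<le> \<tau> t" if "0 \<le> t" for t using \<tau>(1) that by (auto simp: admissible_weight_def)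
  have pw: "2 * (V (u p) / \<epsilon>) \<le> (p1 (fst p) * ?T1 p + p2 (snd p) * ?T2 p) + 4 / near_const * (J p + 4 * \<kappa> / \<mu> * g p)"
    if p: "p \<in> square r" for p
  proof -
    obtain x y where pxy: "p = (x, y)" by (cases p)
    have p': "(x, y) \<in> square 1" using p sub pxy by blast
    note sb = stress_bounds[OF \<epsilon>(1), where u = u and ux = ux and uy = uy and p = p]
    have Ve: "V (u p) / \<epsilon> \<le> e p" "0 \<le> V (u p) / \<epsilon>" using grad_sq_nonneg \<epsilon> V_nonneg by (simp_all add: e_def energy_def)
    have g0: "0 \<le> g p" using grad_sq_nonneg \<epsilon> by (simp add: g_def)
    \<comment> \<open>No information on \<open>u\<close> is used here, so the bound also holds on
      the bad set. The multiple of \<open>g\<close> added to \<open>J\<close> in the claim makes the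
      sum nonnegative there.\<close>
    have Jlow: "- (4 * \<kappa> / \<mu>) * g p \<le> J p"
      using weighted_density_lower[OF \<epsilon>(1) \<tau>(1) \<tau>(2) \<tau>0, where p = p and u = u and \<sigma> = \<sigma> and ux = ux and uy = uy]
      by (simp add: J_def g_def)
    show ?thesis
    proof (cases "A x < \<eta> \<or> B y < \<eta>")
      case True
      have q: "(norm (u p - \<sigma>))\<^sup>2 \<le> \<kappa>\<^sup>2" using \<sigma>(2)[OF p' True] \<eta>(3) pxy by simp
      have "(1/4 - 4 * \<kappa> / \<mu>) * g p + a / b * (1/4 * (V (u p) / \<epsilon>)) \<le> J p"
        unfolding J_def g_def by (rule weighted_density_lower[OF \<epsilon>(1) \<tau>(1) \<tau>(3) \<tau>(4)]) (use q in auto)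
      then have 1: "1/4 * g p + a / (4 * b) * (V (u p) / \<epsilon>) \<le> J p + 4 * \<kappa> / \<mu> * g p"
        by (simp add: algebra_simps)
      have "near_const * e p = near_const * (g p / 2) + near_const * (V (u p) / \<epsilon>)"
        by (simp add: e_def energy_def g_def distrib_left)
      also have "\<dots> \<le> 1/2 * (g p / 2) + a / (4 * b) * (V (u p) / \<epsilon>)"
        using g0 Ve by (intro add_mono mult_right_mono) (auto simp: near_const_def)
      finally have "near_const * e p \<le> J p + 4 * \<kappa> / \<mu> * g p" using 1 by linarith
      then have "4 / near_const * (near_const * e p) \<le> 4 / near_const * (J p + 4 * \<kappa> / \<mu> * g p)"
        using near_const_pos by (intro mult_left_mono) auto
      then have 2: "4 * e p \<le> 4 / near_const * (J p + 4 * \<kappa> / \<mu> * g p)" using near_const_pos by simp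
      \<comment> \<open>Here the stress term has no sign. It is at most \<open>2 * e p\<close> in
        absolute value and the potential on the left costs another \<open>2 * e p\<close>, hence the
        coefficient \<open>4 / near_const\<close>.\<close>
      have "\<bar>p1 (fst p) * ?T1 p\<bar> \<le> 1 * e p" "\<bar>p2 (snd p) * ?T2 p\<bar> \<le> 1 * e p"
        unfolding abs_mult e_def by (rule mult_mono; use p0 sb in simp)+
      then show ?thesis using 2 Ve by linarith
    next
      case False
      then have "p1 (fst p) = 1" "p2 (snd p) = 1" using \<eta> by (auto simp: p1_def p2_def pxy)
      \<comment> \<open>With both weights equal to 1 the gradient parts of the two diagonal entries
        cancel.\<close>
      then have "p1 (fst p) * ?T1 p + p2 (snd p) * ?T2 p = 2 * (V (u p) / \<epsilon>)"
        by (simp add: T11_def T22_def algebra_simps)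
      moreover have "0 \<le> 4 / near_const * (J p + 4 * \<kappa> / \<mu> * g p)"
        using Jlow near_const_pos by (intro mult_nonneg_nonneg) auto
      ultimately show ?thesis by linarith
    qed
  qed
  have cJ: "continuous_on (square r) J" unfolding J_def by (rule weighted_density_cont[OF sol_r \<tau>(1)])
  have cg: "continuous_on (square r) g" unfolding g_def by (intro continuous_intros cont)
  have cT: "continuous_on (square r) ?T1" "continuous_on (square r) ?T2"
    unfolding T11_def T22_def divide_inverse by (intro continuous_intros cont)+
  have cp: "continuous_on (square r) (\<lambda>p. p1 (fst p))" "continuous_on (square r) (\<lambda>p. p2 (snd p))"
    by (rule continuous_on_compose2[OF p1(1)] continuous_on_compose2[OF p1(2)];
        use r in \<open>auto intro!: continuous_intros simp: cbox_Pair_eq\<close>)+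
  have cV: "continuous_on (square r) (\<lambda>p. V (u p) / \<epsilon>)" unfolding divide_inverse by (intro continuous_intros cont)
  define S where "S p = cutoff r p * (p1 (fst p) * ?T1 p + p2 (snd p) * ?T2 p)" for p
  have cS: "continuous_on (square r) S" unfolding S_def by (intro continuous_intros cutoff_cont cp cT)
  have cJ': "continuous_on (square r) (\<lambda>p. cutoff r p * J p)" by (intro continuous_intros cutoff_cont cJ)
  have cg': "continuous_on (square r) (\<lambda>p. cutoff r p * g p)" by (intro continuous_intros cutoff_cont cg)
  have cV': "continuous_on (square r) (\<lambda>p. cutoff r p * (V (u p) / \<epsilon>))" by (intro continuous_intros cutoff_cont cV)
  have "2 * integral (square r) (\<lambda>p. cutoff r p * (V (u p) / \<epsilon>)) = integral (square r) (\<lambda>p. 2 * (cutoff r p * (V (u p) / \<epsilon>)))"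
    by simp
  also have "\<dots> \<le> integral (square r) (\<lambda>p. S p + 4 / near_const * (cutoff r p * J p + 4 * \<kappa> / \<mu> * (cutoff r p * g p)))"
  proof (rule integral_le)
    fix p assume "p \<in> square r"
    from mult_left_mono[OF pw[OF this] cutoff_bounds(1)[of r p]]
    show "2 * (cutoff r p * (V (u p) / \<epsilon>)) \<le> S p + 4 / near_const * (cutoff r p * J p + 4 * \<kappa> / \<mu> * (cutoff r p * g p))"
      unfolding S_def by (simp add: distrib_left mult_ac)
  qed (use near_const_pos pos in \<open>intro integrable_continuous continuous_intros cS cJ' cg' cV'; simp\<close>)+
  also have "\<dots> = integral (square r) S + 4 / near_const * (integral (square r) (\<lambda>p. cutoff r p * J p)
       + 4 * \<kappa> / \<mu> * integral (square r) (\<lambda>p. cutoff r p * g p))"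
  proof -
    have i: "S integrable_on square r" "(\<lambda>p. cutoff r p * J p) integrable_on square r"
      "(\<lambda>p. cutoff r p * g p) integrable_on square r"
      using cS cJ' cg' by (auto intro: integrable_continuous)
    have I: "integral (square r) (\<lambda>p. cutoff r p * J p + 4 * \<kappa> / \<mu> * (cutoff r p * g p))
        = integral (square r) (\<lambda>p. cutoff r p * J p) + 4 * \<kappa> / \<mu> * integral (square r) (\<lambda>p. cutoff r p * g p)"
      by (subst integral_add[OF i(2) integrable_on_mult_right[OF i(3)]]) simp
    show ?thesis
      by (subst integral_add[OF i(1) integrable_on_mult_right[OF integrable_add[OF i(2) integrable_on_mult_right[OF i(3)]]]])
        (simp only: integral_mult_right I)
  qed
  also have "\<dots> \<le> 16 / r * (E / \<eta>) * E + 4 / near_const * (4 / (r * sqrt a) * \<epsilon> * E + 4 * \<kappa> / \<mu> * (2 * E))"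
  proof -
    have "integral (square r) S \<le> 16 / r * (E / \<eta>) * integral (square r) e"
      using stress_estimate[OF \<epsilon>(1) r sol_r p1(1) p0(1) i1 p1(2) p0(2) i2] by (simp add: S_def[abs_def] e_def)
    also have "\<dots> \<le> 16 / r * (E / \<eta>) * E" using r E0 \<eta> by (intro mult_left_mono Er) auto
    finally have 1: "integral (square r) S \<le> 16 / r * (E / \<eta>) * E" .
    have "integral (square r) (\<lambda>p. cutoff r p * J p) \<le> 4 / (r * sqrt a) * \<epsilon> * integral (square r) e"
      unfolding J_def e_def by (rule weighted_density_estimate[OF r(1) \<epsilon>(1) sol_r \<sigma>(1) \<tau>(1)])
    also have "\<dots> \<le> 4 / (r * sqrt a) * \<epsilon> * E" using r pos \<epsilon> by (intro mult_left_mono Er) auto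
    finally have 2: "integral (square r) (\<lambda>p. cutoff r p * J p) \<le> 4 / (r * sqrt a) * \<epsilon> * E" .
    have "integral (square r) (\<lambda>p. cutoff r p * g p) \<le> integral (square r) (\<lambda>p. 2 * e p)"
    proof (rule integral_le)
      fix p
      have g0: "0 \<le> g p" using grad_sq_nonneg \<epsilon> by (simp add: g_def)
      have "cutoff r p * g p \<le> 1 * g p" using g0 cutoff_bounds by (intro mult_right_mono) auto
      also have "\<dots> \<le> 2 * e p" using V_nonneg[of "u p"] \<epsilon> by (simp add: g_def e_def energy_def)
      finally show "cutoff r p * g p \<le> 2 * e p" .
    qed (use cg' cont(6) in \<open>auto intro!: integrable_continuous continuous_intros simp: e_def\<close>)
    also have "\<dots> \<le> 2 * E" using Er by simp
    finally have 3: "integral (square r) (\<lambda>p. cutoff r p * g p) \<le> 2 * E" .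
    show ?thesis using 1 2 3 near_const_pos pos \<kappa> by (intro add_mono mult_left_mono) auto
  qed
  also have "\<dots> = 2 * (E * (8 / r * (E / \<eta>) + 2 / near_const * (4 / (r * sqrt a) * \<epsilon> + 8 * \<kappa> / \<mu>)))"
    by (simp add: field_simps)
  finally show ?thesis by simp
qed

lemma cutoff_energy_lower:
  assumes \<epsilon>: "0 < \<epsilon>" and sol: "solves \<epsilon> (square r) u ux uy" and s: "0 < s" "s < r"
  shows "(1 - (s / r)\<^sup>2) ^ 4 * integral (square s) (energy \<epsilon> u ux uy)
     \<le> integral (square r) (\<lambda>p. cutoff r p * energy \<epsilon> u ux uy p)"
proof -
  have sub: "square s \<subseteq> square r" using s by (auto simp: cbox_Pair_eq)
  note c = solves_continuous(6)[OF sol]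
  have c': "continuous_on (square r) (\<lambda>p. cutoff r p * energy \<epsilon> u ux uy p)"
    by (intro continuous_intros cutoff_cont c)
  have "(1 - (s / r)\<^sup>2) ^ 4 * integral (square s) (energy \<epsilon> u ux uy)
     = integral (square s) (\<lambda>p. (1 - (s / r)\<^sup>2) ^ 4 * energy \<epsilon> u ux uy p)" by simp
  also have "\<dots> \<le> integral (square s) (\<lambda>p. cutoff r p * energy \<epsilon> u ux uy p)"
    using c c' continuous_on_subset[OF _ sub] s
    by (intro integral_le mult_right_mono cutoff_lower energy_nonneg[OF \<epsilon>] integrable_continuous continuous_intros cutoff_cont) auto
  also have "\<dots> \<le> integral (square r) (\<lambda>p. cutoff r p * energy \<epsilon> u ux uy p)"
    using c' continuous_on_subset[OF c' sub] sub cutoff_bounds(1) energy_nonneg[OF \<epsilon>]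
    by (intro integral_subset_le integrable_continuous) auto
  finally show ?thesis .
qed

text \<open>The energy has a gradient part, which \<open>gradient_by_potential\<close> reduces to
  the potential, and the potential part, bounded by \<open>potential_estimate\<close>. The constants
  give each of three error terms at most an eighth of the cutoff loss \<open>c0\<close>. The
  gradient bound is part of the conclusion because the last zoom of the iteration needs it
  pointwise.\<close>

lemma energy_decay:
  "\<exists>\<eta>>0. \<exists>\<epsilon>0>0. \<epsilon>0 \<le> 1/8 \<and> (\<forall>\<epsilon> u ux uy. 0 < \<epsilon> \<longrightarrow> \<epsilon> \<le> \<epsilon>0 \<longrightarrow> solves \<epsilon> (square 1) u ux uy \<longrightarrow>
     integral (square 1) (energy \<epsilon> u ux uy) \<le> \<eta> \<longrightarrow>
     integral (square (1/2)) (energy \<epsilon> u ux uy) \<le> integral (square 1) (energy \<epsilon> u ux uy) / 2 \<and>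
     (\<forall>p\<in>square (5/8). \<epsilon>\<^sup>2 * grad_sq ux uy p \<le> bernstein_const))"
proof -
  define c0 :: real where "c0 = (1 - ((1/2) / (5/8))\<^sup>2) ^ 4"
  have c0: "0 < c0" by (simp add: c0_def power2_eq_square)
  define k where "k = 4 / (5/8 * sqrt a)"
  have k: "0 < k" using pos by (simp add: k_def)
  define N where "N = real (card Z)"
  have N: "0 \<le> N" by (simp add: N_def)
  \<comment> \<open>The coefficient of \<open>PV\<close> in the bound of
    \<open>1/2 * PG + PV\<close>: the 2 is half of the 4 in \<open>gradient_by_potential\<close>,
    and the 1 is the potential term itself.\<close>
  define G where "G = 2 * ((N + 1) * (bernstein_const / v0)) + 1"
  have G: "0 < G" using N bernstein_const_pos pos unfolding G_def by (intro add_nonneg_pos mult_nonneg_nonneg) auto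
  note nc = near_const_pos
  \<comment> \<open>The number 128 makes the truncation error
    \<open>G * (2 / near_const * (8 * \<kappa> / \<mu>))\<close> at most \<open>c0 / 8\<close>.
    Next, \<open>\<eta>'\<close> is taken so small that good lines stay within \<kappa> of their
    zero.\<close>
  define \<kappa> where "\<kappa> = min (\<mu> / 4) (c0 * near_const * \<mu> / (128 * G))"
  have \<kappa>: "0 < \<kappa>" "\<kappa> \<le> \<mu> / 4" "\<kappa> \<le> c0 * near_const * \<mu> / (128 * G)" using pos c0 nc G by (auto simp: \<kappa>_def)
  define \<eta>' where "\<eta>' = min v0 (\<kappa>\<^sup>2 / line_const)"
  have \<eta>': "0 < \<eta>'" "\<eta>' \<le> v0" using pos \<kappa> line_const_pos by (auto simp: \<eta>'_def)
  have "\<eta>' \<le> \<kappa>\<^sup>2 / line_const" by (simp add: \<eta>'_def)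
  then have l\<eta>': "line_const * \<eta>' \<le> \<kappa>\<^sup>2" using line_const_pos by (simp add: field_simps)
  define \<eta> where "\<eta> = min (\<eta>' / 8) (c0 * \<eta>' * (5/8) / (64 * G))"
  have \<eta>: "0 < \<eta>" "\<eta> \<le> \<eta>' / 8" "\<eta> \<le> c0 * \<eta>' * (5/8) / (64 * G)" using \<eta>' c0 G by (auto simp: \<eta>_def)
  define Q where "Q = k * (N + G / near_const)"
  have Q: "0 < Q" using k N G nc unfolding Q_def by (intro mult_pos_pos add_nonneg_pos) auto
  define \<epsilon>0 where "\<epsilon>0 = min (1/8) (c0 / (16 * Q))"
  have \<epsilon>0: "0 < \<epsilon>0" "\<epsilon>0 \<le> 1/8" "\<epsilon>0 \<le> c0 / (16 * Q)" using c0 Q by (auto simp: \<epsilon>0_def)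
  have k1: "G * (2 / near_const * (8 * \<kappa> / \<mu>)) \<le> c0 / 8"
  proof -
    have "\<kappa> * (128 * G) \<le> c0 * near_const * \<mu>" using \<kappa>(3) G by (simp add: pos_le_divide_eq)
    then show ?thesis using nc pos by (simp add: field_simps)
  qed
  have main: "integral (square (1/2)) (energy \<epsilon> u ux uy) \<le> integral (square 1) (energy \<epsilon> u ux uy) / 2 \<and>
     (\<forall>p\<in>square (5/8). \<epsilon>\<^sup>2 * grad_sq ux uy p \<le> bernstein_const)"
    if \<epsilon>: "0 < \<epsilon>" "\<epsilon> \<le> \<epsilon>0" and sol: "solves \<epsilon> (square 1) u ux uy"
      and small: "integral (square 1) (energy \<epsilon> u ux uy) \<le> \<eta>" for \<epsilon> u ux uy
  proof -
    define E where "E = integral (square 1) (energy \<epsilon> u ux uy)"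
    have E0: "0 \<le> E" unfolding E_def by (intro integral_nonneg_real energy_nonneg \<epsilon>)
    have \<epsilon>1: "\<epsilon> \<le> 1" "\<epsilon> \<le> 1/8" using \<epsilon> \<epsilon>0 by auto
    have "\<kappa>\<^sup>2 \<le> (\<mu> / 4)\<^sup>2" using \<kappa> by (intro power_mono) auto
    also have "\<dots> < \<mu>\<^sup>2" using pos by (simp add: power_divide)
    finally have l: "line_const * \<eta>' < \<mu>\<^sup>2" using l\<eta>' by linarith
    have E4: "E < \<eta>' / 4" using small \<eta> \<eta>' unfolding E_def by linarith
    have uM: "norm (u p) \<le> M" if "p \<in> square (3/4)" for p
      by (rule solution_bounded[OF \<epsilon>(1) \<epsilon>1(1) sol \<eta>'(2) l E4[unfolded E_def] that])
    have sub: "square (3/4) \<subseteq> square 1" "square (5/8) \<subseteq> square 1" by (auto simp: cbox_Pair_eq)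
    have gb: "\<epsilon>\<^sup>2 * grad_sq ux uy p \<le> bernstein_const" if "p \<in> square (5/8)" for p
      by (rule gradient_bound[OF \<epsilon>(1) \<epsilon>1(2) solves_subset[OF sol sub(1)] uM that])
    note sol' = solves_subset[OF sol sub(2)]
    note cont = solves_continuous[OF sol']
    define PV where "PV = integral (square (5/8)) (\<lambda>p. cutoff (5/8) p * (V (u p) / \<epsilon>))"
    define PG where "PG = integral (square (5/8)) (\<lambda>p. cutoff (5/8) p * (\<epsilon> * grad_sq ux uy p))"
    define E' where "E' = integral (square (5/8)) (energy \<epsilon> u ux uy)"
    have E': "E' \<le> E" unfolding E_def E'_def by (rule energy_integral_mono[OF \<epsilon>(1) sol]) simp
    have "PG \<le> 4 * (N * (k * \<epsilon> * E') + (N + 1) * (bernstein_const / v0) * PV)"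
      unfolding PG_def PV_def E'_def N_def k_def using gradient_by_potential[OF _ \<epsilon>(1) sol' gb] by (simp add: mult.assoc add.commute)
    also have "\<dots> \<le> 4 * (N * (k * \<epsilon> * E) + (N + 1) * (bernstein_const / v0) * PV)"
      using E' N k \<epsilon> by (intro mult_left_mono add_right_mono) auto
    finally have PG: "PG \<le> 4 * (N * (k * \<epsilon> * E) + (N + 1) * (bernstein_const / v0) * PV)" .
    have small': "integral (square 1) (energy \<epsilon> u ux uy) < 2 * \<eta>'" using E4 \<eta>' unfolding E_def by linarith
    have PV: "PV \<le> E * (8 / (5/8) * (E / \<eta>') + 2 / near_const * (k * \<epsilon> + 8 * \<kappa> / \<mu>))"
      using potential_estimate[OF \<epsilon>(1) \<epsilon>1(1) sol _ _ \<kappa>(1,2) \<eta>' l\<eta>' small', of "5/8"]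
      unfolding PV_def E_def k_def by simp
    have ce: "continuous_on (square (5/8)) (\<lambda>p. cutoff (5/8) p * (\<epsilon> * grad_sq ux uy p))"
      "continuous_on (square (5/8)) (\<lambda>p. cutoff (5/8) p * (V (u p) / \<epsilon>))"
      unfolding divide_inverse[of "V _"] by (intro continuous_intros cutoff_cont cont)+
    have "c0 * integral (square (1/2)) (energy \<epsilon> u ux uy) \<le> integral (square (5/8)) (\<lambda>p. cutoff (5/8) p * energy \<epsilon> u ux uy p)"
      unfolding c0_def by (rule cutoff_energy_lower[OF \<epsilon>(1) sol']) auto
    also have "\<dots> = integral (square (5/8)) (\<lambda>p. 1/2 * (cutoff (5/8) p * (\<epsilon> * grad_sq ux uy p)) + cutoff (5/8) p * (V (u p) / \<epsilon>))"
      by (rule arg_cong[where f = "integral _"]) (auto simp: fun_eq_iff energy_def algebra_simps)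
    also have "\<dots> = 1/2 * PG + PV"
      unfolding PG_def PV_def
      by (subst integral_add[OF integrable_on_mult_right[OF integrable_continuous[OF ce(1)]] integrable_continuous[OF ce(2)]])
        (simp only: integral_mult_right)
    also have "\<dots> \<le> 2 * (N * (k * \<epsilon> * E)) + G * PV" using PG by (simp add: G_def algebra_simps)
    also have "\<dots> \<le> 2 * (N * (k * \<epsilon> * E)) + G * (E * (8 / (5/8) * (E / \<eta>') + 2 / near_const * (k * \<epsilon> + 8 * \<kappa> / \<mu>)))"
      using PV G by (intro add_left_mono mult_left_mono) auto
    also have "\<dots> = E * (2 * Q * \<epsilon> + G * (8 / (5/8) * (E / \<eta>')) + G * (2 / near_const * (8 * \<kappa> / \<mu>)))"
      unfolding Q_def using nc by (simp add: field_simps)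
    \<comment> \<open>The three shares belong, in this order, to the smallness of \<epsilon>, of the
      energy relative to \<open>\<eta>'\<close>, and of \<kappa>. Their sum 3/8 stays below the
      required 1/2.\<close>
    also have "\<dots> \<le> E * (c0 / 8 + c0 / 8 + c0 / 8)"
    proof (intro mult_left_mono add_mono E0 k1)
      have "\<epsilon> * (16 * Q) \<le> c0" using \<epsilon>(2) \<epsilon>0(3) Q by (simp add: pos_le_divide_eq) (meson mult_right_mono less_imp_le order_trans zero_less_mult_iff zero_less_numeral)
      then show "2 * Q * \<epsilon> \<le> c0 / 8" by (simp add: algebra_simps)
      have "E \<le> c0 * \<eta>' * (5/8) / (64 * G)" using small \<eta>(3) unfolding E_def by linarith
      then have "E * (64 * G) \<le> c0 * \<eta>' * (5/8)" using G by (simp add: pos_le_divide_eq)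
      then show "G * (8 / (5/8) * (E / \<eta>')) \<le> c0 / 8" using \<eta>' by (simp add: field_simps)
    qed
    also have "\<dots> \<le> c0 * (E / 2)" using E0 c0 by simp
    finally have "integral (square (1/2)) (energy \<epsilon> u ux uy) \<le> E / 2" using c0 by (simp add: mult_le_cancel_left_pos)
    then show ?thesis using gb by (simp add: E_def)
  qed
  show ?thesis
    by (intro exI[of _ \<eta>] exI[of _ \<epsilon>0] conjI allI impI \<eta> \<epsilon>0) (use main in auto)
qed

section \<open>Iteration over scales and the estimate near one zero\<close>

lemma energy_affine:
  assumes "0 < R" "0 < \<epsilon>"
  shows "energy (\<epsilon> / R) (\<lambda>p. u (c + R *\<^sub>R p)) (\<lambda>p. R *\<^sub>R ux (c + R *\<^sub>R p)) (\<lambda>p. R *\<^sub>R uy (c + R *\<^sub>R p)) p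
     = R * energy \<epsilon> u ux uy (c + R *\<^sub>R p)"
  using assms by (simp add: energy_def grad_sq_def power_mult_distrib power2_eq_square field_simps)

text \<open>The density gains a factor \<open>R\<close> and the area element the inverse of its
  square. Energy and \<epsilon> thus scale alike, both by \<open>1 / R\<close>.\<close>

lemma energy_integral_affine:
  assumes R: "0 < R" and \<epsilon>: "0 < \<epsilon>" and cont: "continuous_on (cbox (c - (R, R)) (c + (R, R))) (energy \<epsilon> u ux uy)"
  shows "integral (square 1) (energy (\<epsilon> / R) (\<lambda>p. u (c + R *\<^sub>R p)) (\<lambda>p. R *\<^sub>R ux (c + R *\<^sub>R p)) (\<lambda>p. R *\<^sub>R uy (c + R *\<^sub>R p)))
     = integral (cbox (c - (R, R)) (c + (R, R))) (energy \<epsilon> u ux uy) / R"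
proof -
  define I where "I = integral (cbox (c - (R, R)) (c + (R, R))) (energy \<epsilon> u ux uy)"
  have "(energy \<epsilon> u ux uy has_integral I) (cbox (c - (R, R)) (c + (R, R)))"
    unfolding I_def using cont by (intro integrable_integral integrable_continuous)
  from has_integral_affinity'[OF this R, of c]
  have "((\<lambda>p. energy \<epsilon> u ux uy (R *\<^sub>R p + c)) has_integral I /\<^sub>R R\<^sup>2) (square 1)"
    using R by (simp add: scaleR_Pair power2_eq_square)
  from has_integral_mult_right[OF this, of R]
  have "((\<lambda>p. R * energy \<epsilon> u ux uy (c + R *\<^sub>R p)) has_integral I / R) (square 1)"
    using R by (simp add: power2_eq_square add.commute field_simps)
  then show ?thesis
    unfolding energy_affine[OF R \<epsilon>, abs_def] I_def by (rule integral_unique)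
qed

lemma oscillation_bound:
  assumes \<epsilon>: "0 < \<epsilon>" and sol: "solves \<epsilon> (square (5/8)) u ux uy"
    and gb: "\<And>p. p \<in> square (5/8) \<Longrightarrow> \<epsilon>\<^sup>2 * grad_sq ux uy p \<le> bernstein_const"
    and \<rho>: "0 \<le> \<rho>" "\<rho> \<le> 5/8" and p: "p \<in> square \<rho>"
  shows "norm (u p - u (0, 0)) \<le> 4 * sqrt bernstein_const / \<epsilon> * \<rho>"
proof -
  define G where "G = sqrt bernstein_const / \<epsilon>"
  have G: "0 \<le> G" using \<epsilon> bernstein_const_pos by (simp add: G_def)
  have sub: "square \<rho> \<subseteq> square (5/8)" using \<rho> by (auto simp: cbox_Pair_eq)
  have hp: "has_partials u ux uy (square (5/8))" using sol unfolding solves_def by blast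
  have g: "norm (ux z) \<le> G" "norm (uy z) \<le> G" if "z \<in> square (5/8)" for z
  proof -
    have "(\<epsilon> * norm (ux z))\<^sup>2 \<le> bernstein_const" "(\<epsilon> * norm (uy z))\<^sup>2 \<le> bernstein_const"
      using gb[OF that] zero_le_power2[of "\<epsilon> * norm (ux z)"] zero_le_power2[of "\<epsilon> * norm (uy z)"]
      unfolding grad_sq_def power_mult_distrib distrib_left by linarith+
    then have "\<epsilon> * norm (ux z) \<le> sqrt bernstein_const" "\<epsilon> * norm (uy z) \<le> sqrt bernstein_const"
      by (auto intro: real_le_rsqrt)
    then show "norm (ux z) \<le> G" "norm (uy z) \<le> G" using \<epsilon> by (simp_all add: G_def pos_le_divide_eq mult.commute)
  qed
  have "norm (u p - u (0, 0)) \<le> 2 * G * norm (p - (0, 0))"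
  proof (rule differentiable_bound[of "square \<rho>" u])
    show "convex (square \<rho>)" by (rule convex_box)
    fix z assume "z \<in> square \<rho>"
    then have z: "z \<in> square (5/8)" using sub by blast
    then show "(u has_derivative (\<lambda>h. fst h *\<^sub>R ux z + snd h *\<^sub>R uy z)) (at z within square \<rho>)"
      using hp unfolding has_partials_def by (blast intro: has_derivative_at_withinI)
    show "onorm (\<lambda>h. fst h *\<^sub>R ux z + snd h *\<^sub>R uy z) \<le> 2 * G"
    proof (rule onorm_le)
      fix h :: "real \<times> real"
      have "norm (fst h *\<^sub>R ux z + snd h *\<^sub>R uy z) \<le> \<bar>fst h\<bar> * norm (ux z) + \<bar>snd h\<bar> * norm (uy z)"
        using norm_triangle_ineq[of "fst h *\<^sub>R ux z" "snd h *\<^sub>R uy z"] by simp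
      also have "\<dots> \<le> norm h * G + norm h * G"
        using g[OF z] G norm_fst_le[of "fst h" "snd h"] norm_snd_le[of "snd h" "fst h"] by (intro add_mono mult_mono) auto
      finally show "norm (fst h *\<^sub>R ux z + snd h *\<^sub>R uy z) \<le> 2 * G * norm h" by (simp add: algebra_simps)
    qed
  qed (use p \<rho> in \<open>auto simp: mem_square\<close>)
  also have "norm (p - (0, 0)) \<le> 2 * \<rho>"
  proof -
    obtain x y where pxy: "p = (x, y)" by (cases p)
    have "norm p \<le> \<bar>x\<bar> + \<bar>y\<bar>" unfolding pxy norm_Pair
      by (intro real_le_lsqrt) (auto simp: power2_eq_square algebra_simps)
    also have "\<dots> \<le> 2 * \<rho>" using p unfolding pxy mem_square by linarith
    finally show ?thesis by (simp add: zero_prod_def[symmetric])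
  qed
  then have "2 * G * norm (p - (0, 0)) \<le> 2 * G * (2 * \<rho>)" using G by (intro mult_left_mono) auto
  finally show ?thesis by (simp add: G_def)
qed

text \<open>Clearing out: the scale-invariant energy is halved repeatedly until the scale reaches
  \<open>\<epsilon>\<close>, where the gradient bound turns small energy into pointwise closeness to \<open>Z\<close>.\<close>

lemma clearing_out:
  "\<exists>\<eta>>0. \<exists>\<epsilon>0>0. \<forall>\<epsilon> u ux uy. 0 < \<epsilon> \<longrightarrow> \<epsilon> \<le> \<epsilon>0 \<longrightarrow> solves \<epsilon> (square 1) u ux uy \<longrightarrow>
     integral (square 1) (energy \<epsilon> u ux uy) \<le> \<eta> \<longrightarrow> (\<exists>\<sigma>\<in>Z. norm (u (0, 0) - \<sigma>) < \<mu> / 4)"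
proof -
  obtain \<eta>1 \<epsilon>0 where \<eta>1: "0 < \<eta>1" and \<epsilon>0: "0 < \<epsilon>0" "\<epsilon>0 \<le> 1/8" and decay:
    "\<And>\<epsilon> u ux uy. 0 < \<epsilon> \<Longrightarrow> \<epsilon> \<le> \<epsilon>0 \<Longrightarrow> solves \<epsilon> (square 1) u ux uy \<Longrightarrow>
     integral (square 1) (energy \<epsilon> u ux uy) \<le> \<eta>1 \<Longrightarrow>
     integral (square (1/2)) (energy \<epsilon> u ux uy) \<le> integral (square 1) (energy \<epsilon> u ux uy) / 2 \<and>
     (\<forall>p\<in>square (5/8). \<epsilon>\<^sup>2 * grad_sq ux uy p \<le> bernstein_const)"
    using energy_decay by blast
  define s where "s = sqrt bernstein_const"
  have s: "0 < s" using bernstein_const_pos by (simp add: s_def)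
  \<comment> \<open>On a square of half side \<open>c * \<epsilon>\<close> the oscillation bound
    becomes \<open>4 * s * c\<close>, and 32 makes this at most \<open>\<mu> / 8\<close>.\<close>
  define c where "c = min 1 (\<mu> / (32 * s))"
  have c: "0 < c" "c \<le> 1" "c \<le> \<mu> / (32 * s)" using pos s by (auto simp: c_def)
  define \<eta> where "\<eta> = min \<eta>1 (2 * c\<^sup>2 * v0 * \<epsilon>0)"
  have \<eta>: "0 < \<eta>" "\<eta> \<le> \<eta>1" "\<eta> \<le> 2 * c\<^sup>2 * v0 * \<epsilon>0" using \<eta>1 c pos \<epsilon>0 by (auto simp: \<eta>_def)
  have base: "\<exists>\<sigma>\<in>Z. norm (u (0, 0) - \<sigma>) < \<mu> / 4"
    if \<epsilon>: "\<epsilon>0 / 2 < \<epsilon>" "\<epsilon> \<le> \<epsilon>0" and sol: "solves \<epsilon> (square 1) u ux uy"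
      and E: "integral (square 1) (energy \<epsilon> u ux uy) \<le> \<eta>" for \<epsilon> u ux uy
  proof (rule ccontr)
    assume not: "\<not> ?thesis"
    have \<epsilon>p: "0 < \<epsilon>" using \<epsilon> \<epsilon>0 by linarith
    have gb: "\<epsilon>\<^sup>2 * grad_sq ux uy p \<le> bernstein_const" if "p \<in> square (5/8)" for p
      using decay[OF \<epsilon>p \<epsilon>(2) sol] E \<eta>(2) that by auto
    define \<rho> where "\<rho> = c * \<epsilon>"
    have "\<rho> \<le> 1 * (1/8)" unfolding \<rho>_def using c \<epsilon> \<epsilon>0 \<epsilon>p by (intro mult_mono) auto
    then have \<rho>: "0 < \<rho>" "\<rho> \<le> 5/8" using c \<epsilon>p by (auto simp: \<rho>_def)
    have sub: "square \<rho> \<subseteq> square 1" "square (5/8) \<subseteq> square 1" using \<rho> by (auto simp: cbox_Pair_eq)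
    have low: "v0 / \<epsilon> \<le> energy \<epsilon> u ux uy p" if p: "p \<in> square \<rho>" for p
    proof -
      have "norm (u p - u (0, 0)) \<le> 4 * s / \<epsilon> * \<rho>"
        unfolding s_def by (rule oscillation_bound[OF \<epsilon>p solves_subset[OF sol sub(2)] gb _ \<rho>(2) p]) (use \<rho> in auto)
      also have "\<dots> = 4 * s * c" using \<epsilon>p by (simp add: \<rho>_def)
      also have "\<dots> \<le> 4 * s * (\<mu> / (32 * s))" using c s by (intro mult_left_mono) auto
      also have "\<dots> = \<mu> / 8" using s by simp
      finally have d: "norm (u p - u (0, 0)) \<le> \<mu> / 8" .
      have "v0 \<le> V (u p)"
      proof (rule far)
        fix \<sigma> assume "\<sigma> \<in> Z"
        then have "\<mu> / 4 \<le> norm (u (0, 0) - \<sigma>)" using not by auto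
        also have "\<dots> \<le> norm (u p - \<sigma>) + norm (u p - u (0, 0))"
          using norm_triangle_ineq4[of "u p - \<sigma>" "u p - u (0, 0)"] by simp
        finally show "\<mu> / 8 \<le> norm (u p - \<sigma>)" using d by linarith
      qed
      then have "v0 / \<epsilon> \<le> V (u p) / \<epsilon>" using \<epsilon>p by (intro divide_right_mono) auto
      also have "\<dots> \<le> energy \<epsilon> u ux uy p" using \<epsilon>p grad_sq_nonneg by (simp add: energy_def)
      finally show ?thesis .
    qed
    \<comment> \<open>The area \<open>4 * (c * \<epsilon>)\<^sup>2\<close> times the lower bound
      \<open>v0 / \<epsilon>\<close> of the density. As \<epsilon> exceeds half of
      \<open>\<epsilon>0\<close>, this is more than \<eta> allows.\<close>
    have "4 * c\<^sup>2 * v0 * \<epsilon> = integral (square \<rho>) (\<lambda>p. v0 / \<epsilon>)"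
      using \<rho> \<epsilon>p by (simp add: content_Pair \<rho>_def power2_eq_square)
    also have "\<dots> \<le> integral (square \<rho>) (energy \<epsilon> u ux uy)"
      using low continuous_on_subset[OF solves_continuous(6)[OF sol] sub(1)]
      by (intro integral_le integrable_continuous) auto
    also have "\<dots> \<le> integral (square 1) (energy \<epsilon> u ux uy)"
      using \<rho> by (intro energy_integral_mono[OF \<epsilon>p sol]) auto
    also have "\<dots> \<le> 2 * c\<^sup>2 * v0 * \<epsilon>0" using E \<eta> by linarith
    also have "\<dots> < 2 * c\<^sup>2 * v0 * (2 * \<epsilon>)" using c pos \<epsilon> by (intro mult_strict_left_mono) auto
    finally show False by simp
  qed
  \<comment> \<open>The induction runs over the number of doublings that bring \<epsilon> into the
    window between \<open>\<epsilon>0 / 2\<close> and \<open>\<epsilon>0\<close>. All zooms are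
    centred at the origin, so the value there is the same at every scale.\<close>
  have step: "\<exists>\<sigma>\<in>Z. norm (u (0, 0) - \<sigma>) < \<mu> / 4"
    if "\<epsilon>0 / 2 < \<epsilon> * 2 ^ n" "\<epsilon> * 2 ^ n \<le> \<epsilon>0" "0 < \<epsilon>" "solves \<epsilon> (square 1) u ux uy"
      "integral (square 1) (energy \<epsilon> u ux uy) \<le> \<eta>" for n \<epsilon> u ux uy
    using that
  proof (induction n arbitrary: \<epsilon> u ux uy)
    case 0
    then show ?case by (intro base) auto
  next
    case (Suc n)
    have "\<epsilon> * 1 \<le> \<epsilon> * 2 ^ Suc n" using Suc.prems(3) by (intro mult_left_mono one_le_power) auto
    then have le: "\<epsilon> \<le> \<epsilon>0" using Suc.prems(2) by linarith
    have d: "integral (square (1/2)) (energy \<epsilon> u ux uy) \<le> integral (square 1) (energy \<epsilon> u ux uy) / 2"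
      using decay[OF Suc.prems(3) le Suc.prems(4)] Suc.prems(5) \<eta> by auto
    let ?u = "\<lambda>p. u ((0, 0) + (1/2) *\<^sub>R p)" and ?ux = "\<lambda>p. (1/2) *\<^sub>R ux ((0, 0) + (1/2) *\<^sub>R p)"
      and ?uy = "\<lambda>p. (1/2) *\<^sub>R uy ((0, 0) + (1/2) *\<^sub>R p)"
    have "solves (\<epsilon> / (1/2)) (square 1) ?u ?ux ?uy"
      by (rule solves_affine[OF Suc.prems(4)]) (auto simp: cbox_Pair_eq)
    moreover have "integral (square 1) (energy (\<epsilon> / (1/2)) ?u ?ux ?uy) \<le> \<eta>"
    proof -
      have sub: "square (1/2) \<subseteq> square 1" by (auto simp: cbox_Pair_eq)
      have "integral (square 1) (energy (\<epsilon> / (1/2)) ?u ?ux ?uy)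
         = integral (cbox ((0, 0) - (1/2, 1/2)) ((0, 0) + (1/2, 1/2))) (energy \<epsilon> u ux uy) / (1/2)"
        by (rule energy_integral_affine)
          (use Suc.prems(3) continuous_on_subset[OF solves_continuous(6)[OF Suc.prems(4)] sub] in auto)
      also have "\<dots> = 2 * integral (square (1/2)) (energy \<epsilon> u ux uy)" by simp
      finally show ?thesis using d Suc.prems(5) by linarith
    qed
    ultimately have "\<exists>\<sigma>\<in>Z. norm (?u (0, 0) - \<sigma>) < \<mu> / 4"
      using Suc.prems(1-3) by (intro Suc.IH[of "\<epsilon> / (1/2)"]) (auto simp: mult_ac)
    then show ?case by simp
  qed
  have "\<exists>\<sigma>\<in>Z. norm (u (0, 0) - \<sigma>) < \<mu> / 4"
    if \<epsilon>: "0 < \<epsilon>" "\<epsilon> \<le> \<epsilon>0" and sol: "solves \<epsilon> (square 1) u ux uy"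
      and E: "integral (square 1) (energy \<epsilon> u ux uy) \<le> \<eta>" for \<epsilon> u ux uy
  proof -
    obtain n0 where "\<epsilon>0 / 2 / \<epsilon> < 2 ^ n0" using real_arch_pow[of 2 "\<epsilon>0 / 2 / \<epsilon>"] by auto
    then have ex: "\<epsilon>0 / 2 < \<epsilon> * 2 ^ n0" using \<epsilon> by (simp add: divide_less_eq mult.commute)
    \<comment> \<open>The least exponent that passes \<open>\<epsilon>0 / 2\<close>; by minimality
      the previous power did not, so one doubling cannot exceed \<open>\<epsilon>0\<close>.\<close>
    define n where "n = (LEAST n. \<epsilon>0 / 2 < \<epsilon> * 2 ^ n)"
    have n: "\<epsilon>0 / 2 < \<epsilon> * 2 ^ n" unfolding n_def by (rule LeastI[of "\<lambda>n. \<epsilon>0 / 2 < \<epsilon> * 2 ^ n", OF ex])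
    have "\<epsilon> * 2 ^ n \<le> \<epsilon>0"
    proof (cases n)
      case 0 then show ?thesis using \<epsilon> by simp
    next
      case (Suc m)
      then have "\<not> \<epsilon>0 / 2 < \<epsilon> * 2 ^ m" using not_less_Least[of m "\<lambda>n. \<epsilon>0 / 2 < \<epsilon> * 2 ^ n"] by (simp add: n_def)
      then show ?thesis unfolding Suc by simp
    qed
    then show ?thesis using n \<epsilon> sol E by (intro step)
  qed
  then show ?thesis using \<eta>(1) \<epsilon>0(1) by (intro exI[of _ \<eta>] exI[of _ \<epsilon>0] conjI allI impI)
qed

text \<open>Squares of half side 1/10 around points of \<open>square (3/5)\<close> stay in
  \<open>square (7/10)\<close>. Magnifying them multiplies \<epsilon> by 10 and the energy by at
  most 10, hence the thresholds divided by 10. With one zero for the whole square, the quadratic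
  weight controls the energy at every point and no error of order one is left.\<close>

lemma small_energy_estimate:
  "\<exists>C>0. \<exists>\<eta>>0. \<exists>\<epsilon>0>0. \<forall>\<epsilon> u ux uy. 0 < \<epsilon> \<longrightarrow> \<epsilon> \<le> \<epsilon>0 \<longrightarrow> solves \<epsilon> (square (7/10)) u ux uy \<longrightarrow>
     integral (square (7/10)) (energy \<epsilon> u ux uy) \<le> \<eta> \<longrightarrow>
     integral (square (9/16)) (energy \<epsilon> u ux uy) \<le> C * (\<epsilon> * integral (square (7/10)) (energy \<epsilon> u ux uy))"
proof -
  obtain \<eta> \<epsilon>0 where \<eta>: "0 < \<eta>" and \<epsilon>0: "0 < \<epsilon>0" and clear:
    "\<And>\<epsilon> u ux uy. 0 < \<epsilon> \<Longrightarrow> \<epsilon> \<le> \<epsilon>0 \<Longrightarrow> solves \<epsilon> (square 1) u ux uy \<Longrightarrow>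
     integral (square 1) (energy \<epsilon> u ux uy) \<le> \<eta> \<Longrightarrow> \<exists>\<sigma>\<in>Z. norm (u (0, 0) - \<sigma>) < \<mu> / 4"
    using clearing_out by blast
  obtain \<tau> \<tau>' where \<tau>: "admissible_weight \<tau> \<tau>'"
    "\<And>t. 0 \<le> t \<Longrightarrow> t \<le> \<mu>\<^sup>2 / 16 \<Longrightarrow> 1/4 \<le> \<tau> t + 2 * t * \<tau>' t"
    "\<And>t. 0 \<le> t \<Longrightarrow> t \<le> \<mu>\<^sup>2 / 16 \<Longrightarrow> 1/4 \<le> \<tau> t"
    by (rule quadratic_weight) blast
  define c0 :: real where "c0 = (1 - ((9/16) / (3/5))\<^sup>2) ^ 4"
  have c0: "0 < c0" by (simp add: c0_def power2_eq_square)
  define k where "k = 4 / (3/5 * sqrt a)"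
  have k: "0 < k" using pos by (simp add: k_def)
  have main: "integral (square (9/16)) (energy \<epsilon> u ux uy)
      \<le> k / (near_const * c0) * (\<epsilon> * integral (square (7/10)) (energy \<epsilon> u ux uy))"
    if \<epsilon>: "0 < \<epsilon>" "\<epsilon> \<le> \<epsilon>0 / 10" and sol: "solves \<epsilon> (square (7/10)) u ux uy"
      and E: "integral (square (7/10)) (energy \<epsilon> u ux uy) \<le> \<eta> / 10" for \<epsilon> u ux uy
  proof -
    have near: "\<exists>\<sigma>\<in>Z. norm (u p - \<sigma>) < \<mu> / 4" if p: "p \<in> square (3/5)" for p
    proof -
      obtain x y where pxy: "p = (x, y)" by (cases p)
      have xy: "\<bar>x\<bar> \<le> 3/5" "\<bar>y\<bar> \<le> 3/5" using p unfolding pxy mem_square by auto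
      have sub: "cbox (p - (1/10, 1/10)) (p + (1/10, 1/10)) \<subseteq> square (7/10)"
        using xy by (auto simp: pxy cbox_Pair_eq)
      have sub': "p + (1/10) *\<^sub>R q \<in> square (7/10)" if "q \<in> square 1" for q
        using that xy by (cases q) (auto simp: pxy cbox_Pair_eq)
      note ce = solves_continuous(6)[OF sol]
      have "integral (square 1) (energy (\<epsilon> / (1/10)) (\<lambda>q. u (p + (1/10) *\<^sub>R q)) (\<lambda>q. (1/10) *\<^sub>R ux (p + (1/10) *\<^sub>R q)) (\<lambda>q. (1/10) *\<^sub>R uy (p + (1/10) *\<^sub>R q)))
         = integral (cbox (p - (1/10, 1/10)) (p + (1/10, 1/10))) (energy \<epsilon> u ux uy) / (1/10)"
        by (rule energy_integral_affine) (use \<epsilon> continuous_on_subset[OF ce sub] in auto)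
      also have "\<dots> \<le> integral (square (7/10)) (energy \<epsilon> u ux uy) / (1/10)"
        using sub continuous_on_subset[OF ce sub] ce energy_nonneg[OF \<epsilon>(1)]
        by (intro divide_right_mono integral_subset_le integrable_continuous) auto
      also have "\<dots> \<le> \<eta>" using E by simp
      finally have small: "integral (square 1) (energy (\<epsilon> / (1/10)) (\<lambda>q. u (p + (1/10) *\<^sub>R q)) (\<lambda>q. (1/10) *\<^sub>R ux (p + (1/10) *\<^sub>R q)) (\<lambda>q. (1/10) *\<^sub>R uy (p + (1/10) *\<^sub>R q))) \<le> \<eta>" .
      have "\<exists>\<sigma>\<in>Z. norm ((\<lambda>q. u (p + (1/10) *\<^sub>R q)) (0, 0) - \<sigma>) < \<mu> / 4"
        by (rule clear[OF _ _ solves_affine[OF sol _ sub'] small]) (use \<epsilon> in auto)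
      then show ?thesis by (simp add: zero_prod_def[symmetric])
    qed
    have sub: "square (3/5) \<subseteq> square (7/10)" by (auto simp: cbox_Pair_eq)
    note sol' = solves_subset[OF sol sub]
    note cont = solves_continuous[OF sol']
    have z0: "(0, 0) \<in> square (3/5)" by (simp add: mem_square)
    obtain \<sigma> where \<sigma>: "\<sigma> \<in> Z" "norm (u (0, 0) - \<sigma>) < \<mu> / 4" using near[OF z0] by blast
    \<comment> \<open>The distance to \<sigma> never lies between \<open>\<mu> / 4\<close> and
      \<mu>: another zero would then be within \<open>\<mu> / 4\<close>, against the separation. As
      the square is connected and the distance is small at the origin, it is small
      everywhere.\<close>
    have all: "norm (u p - \<sigma>) < \<mu> / 4" if p: "p \<in> square (3/5)" for p
    proof (rule ccontr)
      assume *: "\<not> ?thesis"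
      obtain \<sigma>' where \<sigma>': "\<sigma>' \<in> Z" "norm (u p - \<sigma>') < \<mu> / 4" using near[OF p] by blast
      have big: "\<mu> < norm (u p - \<sigma>)"
        using zero_unique[OF \<sigma>(1) \<sigma>'(1), of "u p"] * \<sigma>'(2) pos(1) by force
      have "connected ((\<lambda>p. norm (u p - \<sigma>)) ` square (3/5))"
        by (intro connected_continuous_image continuous_intros cont convex_connected convex_box)
      then have "\<mu> / 2 \<in> (\<lambda>p. norm (u p - \<sigma>)) ` square (3/5)"
        by (rule connectedD_interval[OF _ imageI[OF z0] imageI[OF p]]) (use \<sigma>(2) big pos(1) in auto)
      then obtain q where q: "q \<in> square (3/5)" "norm (u q - \<sigma>) = \<mu> / 2" by auto
      obtain \<sigma>'' where \<sigma>'': "\<sigma>'' \<in> Z" "norm (u q - \<sigma>'') < \<mu> / 4" using near[OF q(1)] by blast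
      have "\<sigma> = \<sigma>''" by (rule zero_unique[OF \<sigma>(1) \<sigma>''(1), of "u q"]) (use q(2) \<sigma>''(2) pos(1) in auto)
      then show False using q(2) \<sigma>''(2) pos(1) by simp
    qed
    let ?w = "weighted_density \<tau> \<tau>' \<sigma> \<epsilon> u ux uy"
    have pw: "near_const * energy \<epsilon> u ux uy p \<le> ?w p" if p: "p \<in> square (3/5)" for p
    proof -
      have "(norm (u p - \<sigma>))\<^sup>2 \<le> (\<mu> / 4)\<^sup>2" using all[OF p] by (intro power_mono) auto
      then have q: "(norm (u p - \<sigma>))\<^sup>2 \<le> \<mu>\<^sup>2 / 16" by (simp add: power_divide)
      have g0: "0 \<le> \<epsilon> * grad_sq ux uy p" "0 \<le> V (u p) / \<epsilon>" using \<epsilon> grad_sq_nonneg V_nonneg by auto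
      have "near_const * energy \<epsilon> u ux uy p
          = near_const * (\<epsilon> * grad_sq ux uy p / 2) + near_const * (V (u p) / \<epsilon>)"
        by (simp add: energy_def distrib_left)
      also have "\<dots> \<le> 1/2 * (\<epsilon> * grad_sq ux uy p / 2) + a / (4 * b) * (V (u p) / \<epsilon>)"
        using g0 by (intro add_mono mult_right_mono) (auto simp: near_const_def)
      also have "\<dots> = 1/4 * (\<epsilon> * grad_sq ux uy p) + a / b * (1/4 * (V (u p) / \<epsilon>))" by simp
      also have "\<dots> \<le> ?w p"
        by (rule weighted_density_lower[OF \<epsilon>(1) \<tau>]) (use q in auto)
      finally show ?thesis .
    qed
    have cw: "continuous_on (square (3/5)) (\<lambda>p. cutoff (3/5) p * ?w p)"
      by (intro continuous_intros cutoff_cont weighted_density_cont[OF sol' \<tau>(1)])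
    have "near_const * (c0 * integral (square (9/16)) (energy \<epsilon> u ux uy))
        \<le> near_const * integral (square (3/5)) (\<lambda>p. cutoff (3/5) p * energy \<epsilon> u ux uy p)"
      unfolding c0_def using near_const_pos
      by (intro mult_left_mono cutoff_energy_lower[OF \<epsilon>(1) sol']) auto
    also have "\<dots> = integral (square (3/5)) (\<lambda>p. near_const * (cutoff (3/5) p * energy \<epsilon> u ux uy p))" by simp
    also have "\<dots> \<le> integral (square (3/5)) (\<lambda>p. cutoff (3/5) p * ?w p)"
    proof (rule integral_le)
      fix p assume "p \<in> square (3/5)"
      from mult_left_mono[OF pw[OF this] cutoff_bounds(1)[of "3/5" p]]
      show "near_const * (cutoff (3/5) p * energy \<epsilon> u ux uy p) \<le> cutoff (3/5) p * ?w p" by (simp add: mult_ac)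
    qed (intro integrable_continuous continuous_intros cutoff_cont cont cw)+
    also have "\<dots> \<le> k * \<epsilon> * integral (square (3/5)) (energy \<epsilon> u ux uy)"
      unfolding k_def by (rule weighted_density_estimate[OF _ \<epsilon>(1) sol' \<sigma>(1) \<tau>(1)]) simp
    also have "\<dots> \<le> k * \<epsilon> * integral (square (7/10)) (energy \<epsilon> u ux uy)"
      using k \<epsilon> by (intro mult_left_mono energy_integral_mono[OF \<epsilon>(1) sol]) auto
    finally have "integral (square (9/16)) (energy \<epsilon> u ux uy) * (near_const * c0)
        \<le> k * \<epsilon> * integral (square (7/10)) (energy \<epsilon> u ux uy)" by (simp add: mult_ac)
    then have "integral (square (9/16)) (energy \<epsilon> u ux uy)
        \<le> k * \<epsilon> * integral (square (7/10)) (energy \<epsilon> u ux uy) / (near_const * c0)"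
      using near_const_pos c0 by (simp only: pos_le_divide_eq mult_pos_pos)
    then show ?thesis by simp
  qed
  have "0 < k / (near_const * c0)" "0 < \<eta> / 10" "0 < \<epsilon>0 / 10"
    using k near_const_pos c0 \<eta> \<epsilon>0 by auto
  then show ?thesis using main by blast
qed

text \<open>The exponent 3/2 enters only through large energies: \<open>\<eta> < E\<close> gives
  \<open>E \<le> E powr (3/2) / sqrt \<eta>\<close>. Large \<epsilon> is covered by the linear term
  with the factor \<open>1 / \<epsilon>0\<close>.\<close>

lemma interior_energy_estimate:
  "\<exists>C>0. \<forall>\<epsilon> u ux uy. 0 < \<epsilon> \<longrightarrow> solves \<epsilon> (square (7/10)) u ux uy \<longrightarrow>
     integral (square (9/16)) (energy \<epsilon> u ux uy)
       \<le> C * (integral (square (7/10)) (energy \<epsilon> u ux uy) powr (3/2)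
            + \<epsilon> * integral (square (7/10)) (energy \<epsilon> u ux uy))"
proof -
  obtain C \<eta> \<epsilon>0 where C: "0 < C" and \<eta>: "0 < \<eta>" and \<epsilon>0: "0 < \<epsilon>0" and est:
    "\<And>\<epsilon> u ux uy. 0 < \<epsilon> \<Longrightarrow> \<epsilon> \<le> \<epsilon>0 \<Longrightarrow> solves \<epsilon> (square (7/10)) u ux uy \<Longrightarrow>
     integral (square (7/10)) (energy \<epsilon> u ux uy) \<le> \<eta> \<Longrightarrow>
     integral (square (9/16)) (energy \<epsilon> u ux uy) \<le> C * (\<epsilon> * integral (square (7/10)) (energy \<epsilon> u ux uy))"
    using small_energy_estimate by blast
  define K where "K = C + 1 / \<epsilon>0 + 1 / sqrt \<eta>"
  have K: "C \<le> K" "1 / \<epsilon>0 \<le> K" "1 / sqrt \<eta> \<le> K" "0 < K"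
    using C \<eta> \<epsilon>0 by (auto simp: K_def add_pos_pos)
  have "integral (square (9/16)) (energy \<epsilon> u ux uy)
       \<le> K * (integral (square (7/10)) (energy \<epsilon> u ux uy) powr (3/2)
            + \<epsilon> * integral (square (7/10)) (energy \<epsilon> u ux uy))"
    if \<epsilon>: "0 < \<epsilon>" and sol: "solves \<epsilon> (square (7/10)) u ux uy" for \<epsilon> u ux uy
  proof -
    define E where "E = integral (square (7/10)) (energy \<epsilon> u ux uy)"
    have E0: "0 \<le> E" unfolding E_def by (intro integral_nonneg_real energy_nonneg \<epsilon>)
    have le: "integral (square (9/16)) (energy \<epsilon> u ux uy) \<le> E"
      unfolding E_def by (rule energy_integral_mono[OF \<epsilon> sol]) simp
    have p0: "0 \<le> E powr (3/2)" "0 \<le> \<epsilon> * E" using E0 \<epsilon> by auto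
    consider "\<eta> < E" | "\<epsilon>0 < \<epsilon>" | "E \<le> \<eta>" "\<epsilon> \<le> \<epsilon>0" by linarith
    then have "integral (square (9/16)) (energy \<epsilon> u ux uy) \<le> K * E powr (3/2) \<or>
        integral (square (9/16)) (energy \<epsilon> u ux uy) \<le> K * (\<epsilon> * E)"
    proof cases
      case 1
      have "E powr (3/2) = E powr (1 + 1/2)" by simp
      also have "\<dots> = E * sqrt E" using E0 1 \<eta> by (subst powr_add) (simp add: powr_half_sqrt)
      finally have pw: "E powr (3/2) = E * sqrt E" .
      have "E = 1 / sqrt \<eta> * (E * sqrt \<eta>)" using \<eta> by simp
      also have "\<dots> \<le> 1 / sqrt \<eta> * (E * sqrt E)"
        using 1 \<eta> E0 by (intro mult_left_mono) auto
      also have "\<dots> \<le> K * (E * sqrt E)" using K E0 by (intro mult_right_mono) auto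
      finally show ?thesis using le pw by simp
    next
      case 2
      have "E = 1 / \<epsilon>0 * (\<epsilon>0 * E)" using \<epsilon>0 by simp
      also have "\<dots> \<le> 1 / \<epsilon>0 * (\<epsilon> * E)"
        using 2 \<epsilon>0 E0 by (intro mult_left_mono mult_right_mono) auto
      also have "\<dots> \<le> K * (\<epsilon> * E)" using K p0 by (intro mult_right_mono) auto
      finally show ?thesis using le by simp
    next
      case 3
      have "integral (square (9/16)) (energy \<epsilon> u ux uy) \<le> C * (\<epsilon> * E)"
        using est[OF \<epsilon> 3(2) sol] 3(1) by (simp add: E_def)
      also have "\<dots> \<le> K * (\<epsilon> * E)" using K p0 by (intro mult_right_mono) auto
      finally show ?thesis by simp
    qed
    moreover have "0 \<le> K * E powr (3/2)" "0 \<le> K * (\<epsilon> * E)" using K p0 by auto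
    ultimately show ?thesis unfolding E_def[symmetric] distrib_left by linarith
  qed
  then show ?thesis using K(4) by blast
qed

end

section \<open>Transfer to the plane\<close>

text \<open>The estimates are proved on pairs, where a box is a product and integrals can be
  iterated; this linear map, which preserves area, carries them to \<open>real^2\<close>.\<close>

definition plane :: "real \<times> real \<Rightarrow> real^2" where
  "plane p = fst p *\<^sub>R axis 1 1 + snd p *\<^sub>R axis 2 1"

lemma plane_nth [simp]: "plane p $ 1 = fst p" "plane p $ 2 = snd p"
  by (simp_all add: plane_def axis_def)

lemma plane_inverse: "plane (v $ 1, v $ 2) = v" "(plane p $ 1, plane p $ 2) = p"
  by (simp_all add: vec_eq_iff forall_2)

lemma bounded_linear_plane: "bounded_linear plane"
  unfolding plane_def by (intro bounded_linear_intros)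

lemma mem_plane_cbox: "plane p \<in> cbox (plane a) (plane b) \<longleftrightarrow> p \<in> cbox a b"
  by (cases p; cases a; cases b) (auto simp: mem_box_cart forall_2 cbox_Pair_eq)

lemma plane_image_cbox: "plane ` cbox a b = cbox (plane a) (plane b)"
proof -
  have "v \<in> plane ` cbox a b" if "v \<in> cbox (plane a) (plane b)" for v
    using that mem_plane_cbox[of "(v $ 1, v $ 2)" a b] by (metis imageI plane_inverse(1))
  then show ?thesis using mem_plane_cbox by blast
qed

text \<open>A change of variables by a bijection that maps boxes to boxes of the same
  content.\<close>

lemma integral_plane:
  fixes f :: "real^2 \<Rightarrow> real"
  assumes "f integrable_on cbox (plane a) (plane b)"
  shows "integral (cbox a b) (\<lambda>p. f (plane p)) = integral (cbox (plane a) (plane b)) f"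
proof -
  define h where "h v = (v $ 1, v $ 2)" for v :: "real^2"
  have hp: "h (plane p) = p" "plane (h v) = v" for p v unfolding h_def by (rule plane_inverse)+
  have h_box: "h ` cbox u v = cbox (h u) (h v)" for u v
  proof -
    have "h ` cbox u v = h ` (plane ` cbox (h u) (h v))" by (simp add: plane_image_cbox hp)
    then show ?thesis by (simp add: image_image hp)
  qed
  have "((\<lambda>p. f (plane p)) has_integral (1 / 1) *\<^sub>R integral (cbox (plane a) (plane b)) f) (h ` cbox (plane a) (plane b))"
  proof (rule has_integral_twiddle)
    show "continuous (at p) plane" for p
      by (rule linear_continuous_at[OF bounded_linear_plane])
    show "\<exists>w z. plane ` cbox u v = cbox w z" for u v using plane_image_cbox by blast
    show "\<exists>w z. h ` cbox u v = cbox w z" for u v using h_box by blast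
    show "measure lborel (plane ` cbox u v) = 1 * measure lborel (cbox u v)" for u v
    proof (cases "cbox u v = {}")
      case False
      obtain u1 u2 v1 v2 where uv: "u = (u1, u2)" "v = (v1, v2)" by (metis surj_pair)
      have ne: "cbox (plane u) (plane v) \<noteq> {}" using False by (simp add: plane_image_cbox[symmetric])
      have le: "u1 \<le> v1" "u2 \<le> v2" using False by (auto simp: uv cbox_Pair_eq)
      have "measure lborel (plane ` cbox u v) = (v1 - u1) * (v2 - u2)"
        unfolding plane_image_cbox content_cbox_cart[OF ne] by (simp add: UNIV_2 uv)
      then show ?thesis using le by (simp add: uv content_Pair)
    qed simp
    show "(f has_integral integral (cbox (plane a) (plane b)) f) (cbox (plane a) (plane b))"
      using assms by (rule integrable_integral)
  qed (auto simp: hp)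
  then show ?thesis by (simp add: h_box hp integral_unique)
qed

lemma smooth_on_imp_differentiable: "smooth_on S f \<Longrightarrow> x \<in> S \<Longrightarrow> f differentiable (at x)"
  unfolding smooth_on_def by (meson Ck_on.simps(2))

lemma smooth_on_imp_continuous: "smooth_on S f \<Longrightarrow> continuous_on S f"
  unfolding smooth_on_def by (meson Ck_on.simps(1))

lemma smooth_on_partial_deriv:
  assumes "smooth_on S f" shows "smooth_on S (partial_deriv i f)"
proof -
  have "Ck_on n S (\<lambda>x. frechet_derivative f (at x) (axis i 1))" for n
    using assms[unfolded smooth_on_def, rule_format, of "Suc n"] by simp
  moreover have "partial_deriv i f = (\<lambda>x. frechet_derivative f (at x) (axis i 1))"
    by (simp add: fun_eq_iff partial_deriv_def)
  ultimately show ?thesis by (simp add: smooth_on_def)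
qed

lemma has_partials_plane:
  fixes f :: "real^2 \<Rightarrow> 'a::real_normed_vector"
  assumes "smooth_on S f" and "\<And>p. p \<in> U \<Longrightarrow> plane p \<in> S"
  shows "has_partials (\<lambda>p. f (plane p)) (\<lambda>p. partial_deriv 1 f (plane p)) (\<lambda>p. partial_deriv 2 f (plane p)) U"
  unfolding has_partials_def
proof
  fix p assume "p \<in> U"
  let ?D = "frechet_derivative f (at (plane p))"
  have D: "(f has_derivative ?D) (at (plane p))"
    using smooth_on_imp_differentiable[OF assms(1) assms(2)[OF \<open>p \<in> U\<close>]] frechet_derivative_works by blast
  have "((\<lambda>p. f (plane p)) has_derivative (\<lambda>h. ?D (plane h))) (at p)"
    using diff_chain_at[OF bounded_linear_imp_has_derivative[OF bounded_linear_plane] D] by (simp add: o_def)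
  moreover have "?D (plane h) = fst h *\<^sub>R partial_deriv 1 f (plane p) + snd h *\<^sub>R partial_deriv 2 f (plane p)" for h
    using has_derivative_linear[OF D] by (simp add: plane_def partial_deriv_def linear_add linear_cmul)
  ultimately show "((\<lambda>p. f (plane p)) has_derivative
     (\<lambda>h. fst h *\<^sub>R partial_deriv 1 f (plane p) + snd h *\<^sub>R partial_deriv 2 f (plane p))) (at p)"
    by simp
qed

lemma has_partials_unique:
  assumes U: "open U" and f: "has_partials f fx fy U" and g: "has_partials g gx gy U"
    and eq: "\<And>p. p \<in> U \<Longrightarrow> f p = g p" and p: "p \<in> U"
  shows "fx p = gx p" "fy p = gy p"
proof -
  have "(f has_derivative (\<lambda>h. fst h *\<^sub>R fx p + snd h *\<^sub>R fy p)) (at p)" using f p by (auto simp: has_partials_def)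
  then have "(g has_derivative (\<lambda>h. fst h *\<^sub>R fx p + snd h *\<^sub>R fy p)) (at p)"
    by (rule has_derivative_transform_within_open[OF _ U p eq])
  moreover have "(g has_derivative (\<lambda>h. fst h *\<^sub>R gx p + snd h *\<^sub>R gy p)) (at p)" using g p by (auto simp: has_partials_def)
  ultimately have "(\<lambda>h. fst h *\<^sub>R fx p + snd h *\<^sub>R fy p) = (\<lambda>h. fst h *\<^sub>R gx p + snd h *\<^sub>R gy p)"
    by (rule has_derivative_unique)
  from fun_cong[OF this, of "(1, 0)"] fun_cong[OF this, of "(0, 1)"]
  show "fx p = gx p" "fy p = gy p" by simp_all
qed

lemma has_partials_cong:
  assumes "has_partials f fx fy S" "\<And>p. p \<in> S \<Longrightarrow> fx p = gx p" "\<And>p. p \<in> S \<Longrightarrow> fy p = gy p"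
  shows "has_partials f gx gy S"
  using assms by (simp add: has_partials_def)

lemma mixed_partial_deriv_eq:
  fixes f :: "real^2 \<Rightarrow> 'a::euclidean_space"
  assumes U: "open U" and f: "smooth_on S f" and US: "\<And>p. p \<in> U \<Longrightarrow> plane p \<in> S" and p: "p \<in> U"
  shows "partial_deriv 1 (partial_deriv 2 f) (plane p) = partial_deriv 2 (partial_deriv 1 f) (plane p)"
proof -
  note s = smooth_on_partial_deriv[OF f] smooth_on_partial_deriv[OF smooth_on_partial_deriv[OF f]]
  note hp = has_partials_plane[OF f US, of U] has_partials_plane[OF s(1) US, of U]
  have c: "continuous_on U (\<lambda>p. partial_deriv i (partial_deriv j f) (plane p))" for i j
    by (rule has_partials_continuous[OF has_partials_plane[OF s(2) US]])
  show ?thesis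
    by (rule mixed_partials_eq[OF U p hp(1) hp(2) hp(2) c c, symmetric])
qed

context potential
begin

text \<open>All partials up to order three are brought to the order in which the first variable is
  differentiated first, since \<open>solves\<close> admits one function for each mixed
  partial.\<close>

lemma smooth_solution_solves:
  fixes u :: "real^2 \<Rightarrow> 'a"
  assumes S: "open S" "smooth_on S u" and pde: "\<And>x. x \<in> S \<Longrightarrow> laplacian u x = (1 / \<epsilon>\<^sup>2) *\<^sub>R gV (u x)"
  shows "solves \<epsilon> (plane -` S) (\<lambda>p. u (plane p)) (\<lambda>p. partial_deriv 1 u (plane p)) (\<lambda>p. partial_deriv 2 u (plane p))"
proof -
  define U where "U = plane -` S"
  have US: "plane p \<in> S" if "p \<in> U" for p using that by (simp add: U_def)
  have U: "open U" unfolding U_def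
    by (rule open_vimage[OF S(1)]) (simp add: linear_continuous_on bounded_linear_plane)
  let ?D = "partial_deriv :: 2 \<Rightarrow> (real^2 \<Rightarrow> 'a) \<Rightarrow> real^2 \<Rightarrow> 'a"
  note s1 = smooth_on_partial_deriv[OF S(2)] note s2 = smooth_on_partial_deriv[OF s1]
  note hp0 = has_partials_plane[OF S(2) US, of U] and hp1 = has_partials_plane[OF s1 US, of U]
    and hp2 = has_partials_plane[OF s2 US, of U]
  have mixed: "?D 1 (?D 2 u) (plane p) = ?D 2 (?D 1 u) (plane p)"
    "?D 1 (?D 2 (?D i u)) (plane p) = ?D 2 (?D 1 (?D i u)) (plane p)" if "p \<in> U" for p i
    using mixed_partial_deriv_eq[OF U S(2) US that] mixed_partial_deriv_eq[OF U s1 US that] by blast+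
  \<comment> \<open>Two exchanges: \<open>mixed(2)\<close> swaps the outer pair, and differentiating
    \<open>mixed(1)\<close> in the second variable on the open set swaps the inner pair.\<close>
  have m2: "?D 1 (?D 2 (?D 2 u)) (plane p) = ?D 2 (?D 2 (?D 1 u)) (plane p)" if "p \<in> U" for p
    using has_partials_unique(2)[OF U hp2[of 1 2] hp2[of 2 1] mixed(1) that] mixed(2)[OF that, of 2] by simp
  have "has_partials (\<lambda>p. ?D 2 u (plane p)) (\<lambda>p. ?D 2 (?D 1 u) (plane p)) (\<lambda>p. ?D 2 (?D 2 u) (plane p)) U"
    by (rule has_partials_cong[OF hp1[of 2]]) (use mixed(1) in auto)
  moreover have "has_partials (\<lambda>p. ?D 2 (?D 1 u) (plane p)) (\<lambda>p. ?D 2 (?D 1 (?D 1 u)) (plane p)) (\<lambda>p. ?D 2 (?D 2 (?D 1 u)) (plane p)) U"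
    by (rule has_partials_cong[OF hp2[of 2 1]]) (use mixed(2) in auto)
  moreover have "has_partials (\<lambda>p. ?D 2 (?D 2 u) (plane p)) (\<lambda>p. ?D 2 (?D 2 (?D 1 u)) (plane p)) (\<lambda>p. ?D 2 (?D 2 (?D 2 u)) (plane p)) U"
    by (rule has_partials_cong[OF hp2[of 2 2]]) (use m2 in auto)
  moreover have "\<forall>p\<in>U. ?D 1 (?D 1 u) (plane p) + ?D 2 (?D 2 u) (plane p) = (1 / \<epsilon>\<^sup>2) *\<^sub>R gV (u (plane p))"
    using pde US by (auto simp: laplacian_def sum_2)
  ultimately show ?thesis
    unfolding solves_def U_def[symmetric] using hp0 hp1[of 1] hp2[of 1 1] by blast
qed

end

section \<open>Constants of an admissible potential\<close>

lemma linear_eq_sum_axis: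
  fixes f :: "real^'n \<Rightarrow> 'a::real_vector"
  assumes "linear f" shows "f h = (\<Sum>i\<in>UNIV. h $ i *\<^sub>R f (axis i 1))"
proof -
  have "f h = f (\<Sum>i\<in>UNIV. h $ i *\<^sub>R axis i 1)"
    using basis_expansion[of h] by (simp add: scalar_mult_eq_scaleR)
  also have "\<dots> = (\<Sum>i\<in>UNIV. h $ i *\<^sub>R f (axis i 1))"
    using assms by (simp add: linear_sum linear_cmul)
  finally show ?thesis .
qed

lemma has_derivative_gradient:
  fixes V :: "real^'k \<Rightarrow> real"
  assumes "smooth_on UNIV V"
  shows "(V has_derivative (\<lambda>h. gradient V y \<bullet> h)) (at y)"
proof -
  have D: "(V has_derivative frechet_derivative V (at y)) (at y)"
    using smooth_on_imp_differentiable[OF assms] frechet_derivative_works by blast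
  have "frechet_derivative V (at y) h = gradient V y \<bullet> h" for h
    using linear_eq_sum_axis[OF has_derivative_linear[OF D], of h]
    by (simp add: gradient_def partial_deriv_def inner_vec_def mult.commute)
  then have "frechet_derivative V (at y) = (\<lambda>h. gradient V y \<bullet> h)" by (rule ext)
  with D show ?thesis by simp
qed

text \<open>The derivative of the gradient in direction \<open>h\<close>. Its matrix is the
  transpose of \<open>hessian\<close>, whose indices come in the other order; the two have the same
  quadratic form.\<close>

definition hessian_map :: "(real^'k \<Rightarrow> real) \<Rightarrow> real^'k \<Rightarrow> real^'k \<Rightarrow> real^'k" where
  "hessian_map V y h = (\<chi> i. \<Sum>j\<in>UNIV. h $ j * partial_deriv j (partial_deriv i V) y)"

lemma gradient_has_derivative:
  fixes V :: "real^'k \<Rightarrow> real"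
  assumes "smooth_on UNIV V"
  shows "(gradient V has_derivative hessian_map V y) (at y)"
proof -
  have "((\<lambda>x. gradient V x \<bullet> e) has_derivative (\<lambda>h. hessian_map V y h \<bullet> e)) (at y)" if eB: "e \<in> Basis" for e
  proof -
    obtain i where e: "e = axis i 1" using eB by (auto simp: Basis_vec_def)
    have s: "smooth_on UNIV (partial_deriv i V)" by (rule smooth_on_partial_deriv[OF assms])
    have "hessian_map V y h $ i = gradient (partial_deriv i V) y \<bullet> h" for h
      by (simp add: hessian_map_def gradient_def inner_vec_def mult.commute)
    then show ?thesis
      using has_derivative_gradient[OF s, of y]
      by (simp add: e inner_axis gradient_def[of V] cart_eq_inner_axis[symmetric])
  qed
  then show ?thesis by (subst has_derivative_componentwise_within) blast
qed

lemma hessian_map_quadratic: "h \<bullet> hessian_map V y h = h \<bullet> (hessian V y *v h)"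
proof -
  have "h \<bullet> hessian_map V y h = (\<Sum>i\<in>UNIV. \<Sum>j\<in>UNIV. h $ i * (h $ j * partial_deriv j (partial_deriv i V) y))"
    by (simp add: inner_vec_def hessian_map_def sum_distrib_left)
  also have "\<dots> = (\<Sum>j\<in>UNIV. \<Sum>i\<in>UNIV. h $ i * (h $ j * partial_deriv j (partial_deriv i V) y))"
    by (rule sum.swap)
  also have "\<dots> = h \<bullet> (hessian V y *v h)"
    by (simp add: inner_vec_def hessian_def matrix_vector_mult_def sum_distrib_left mult_ac)
  finally show ?thesis .
qed

lemma hessian_map_bound:
  fixes V :: "real^'k \<Rightarrow> real"
  assumes "smooth_on UNIV V" "compact K"
  obtains L where "0 < L" "\<And>y h. y \<in> K \<Longrightarrow> norm (hessian_map V y h) \<le> L * norm h"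
proof -
  define g where "g y = (\<Sum>i\<in>UNIV. \<Sum>j\<in>UNIV. \<bar>partial_deriv j (partial_deriv i V) y\<bar>)" for y
  have "continuous_on K (partial_deriv j (partial_deriv i V))" for i j
    using smooth_on_imp_continuous[OF smooth_on_partial_deriv[OF smooth_on_partial_deriv[OF assms(1)]]]
      continuous_on_subset by blast
  then have "continuous_on K g" unfolding g_def by (intro continuous_intros)
  from compact_continuous_image[OF this assms(2)] have "bounded (g ` K)" by (rule compact_imp_bounded)
  then obtain B where B: "\<And>y. y \<in> K \<Longrightarrow> \<bar>g y\<bar> \<le> B" unfolding bounded_iff by auto
  have "norm (hessian_map V y h) \<le> max B 1 * norm h" if "y \<in> K" for y h
  proof -
    have "norm (hessian_map V y h) \<le> (\<Sum>i\<in>UNIV. \<bar>\<Sum>j\<in>UNIV. h $ j * partial_deriv j (partial_deriv i V) y\<bar>)"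
      using norm_le_l1_cart[of "hessian_map V y h"] by (simp add: hessian_map_def)
    also have "\<dots> \<le> (\<Sum>i\<in>UNIV. \<Sum>j\<in>UNIV. norm h * \<bar>partial_deriv j (partial_deriv i V) y\<bar>)"
    proof (rule sum_mono)
      fix i
      have "\<bar>\<Sum>j\<in>UNIV. h $ j * partial_deriv j (partial_deriv i V) y\<bar> \<le> (\<Sum>j\<in>UNIV. \<bar>h $ j * partial_deriv j (partial_deriv i V) y\<bar>)"
        by (rule sum_abs)
      also have "\<dots> \<le> (\<Sum>j\<in>UNIV. norm h * \<bar>partial_deriv j (partial_deriv i V) y\<bar>)"
        unfolding abs_mult by (intro sum_mono mult_right_mono component_le_norm_cart) auto
      finally show "\<bar>\<Sum>j\<in>UNIV. h $ j * partial_deriv j (partial_deriv i V) y\<bar> \<le> (\<Sum>j\<in>UNIV. norm h * \<bar>partial_deriv j (partial_deriv i V) y\<bar>)" .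
    qed
    also have "\<dots> = norm h * g y" by (simp add: g_def sum_distrib_left)
    also have "\<dots> \<le> norm h * max B 1" using B[OF that] by (intro mult_left_mono) auto
    finally show ?thesis by (simp add: mult.commute)
  qed
  then show thesis by (intro that[of "max B 1"]) auto
qed

text \<open>The quadratic form attains a positive minimum on the unit sphere, which is compact;
  homogeneity extends the bound.\<close>

lemma positive_definite_coercive:
  fixes A :: "real^'n^'n"
  assumes "positive_definite A"
  obtains l where "0 < l" "\<And>h. l * (norm h)\<^sup>2 \<le> h \<bullet> (A *v h)"
proof -
  have c: "continuous_on (sphere 0 1) (\<lambda>h. h \<bullet> (A *v h))"
    by (intro continuous_intros linear_continuous_on) (simp add: linear_linear)
  have "axis undefined 1 \<in> sphere (0 :: real^'n) 1" by simp
  then have ne: "sphere (0 :: real^'n) 1 \<noteq> {}" by blast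
  obtain h0 where h0: "h0 \<in> sphere 0 1" "\<And>h. h \<in> sphere 0 1 \<Longrightarrow> h0 \<bullet> (A *v h0) \<le> h \<bullet> (A *v h)"
    using continuous_attains_inf[OF compact_sphere ne c] by blast
  define l where "l = h0 \<bullet> (A *v h0)"
  have "h0 \<noteq> 0" using h0(1) by auto
  then have l: "0 < l" using assms unfolding positive_definite_def l_def by blast
  have "l * (norm h)\<^sup>2 \<le> h \<bullet> (A *v h)" for h
  proof (cases "h = 0")
    case False
    define k where "k = (1 / norm h) *\<^sub>R h"
    have "k \<in> sphere 0 1" using False by (simp add: k_def)
    then have "l \<le> k \<bullet> (A *v k)" unfolding l_def by (rule h0(2))
    also have "\<dots> = (h \<bullet> (A *v h)) / (norm h)\<^sup>2"
      by (simp add: k_def matrix_vector_mult_scaleR power2_eq_square)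
    finally show ?thesis using False by (simp add: pos_le_divide_eq)
  qed simp
  with l show thesis by (rule that)
qed

text \<open>A second-order expansion at the minimum. One number \<open>t\<close> is at the same time
  the radius and, itself or inverted, every constant, so the bounds persist when \<open>t\<close>
  shrinks and can be made common to all zeros.\<close>

lemma local_potential_bounds:
  fixes V :: "real^'k \<Rightarrow> real"
  assumes V: "smooth_on UNIV V" "\<And>y. 0 \<le> V y" and \<sigma>: "V \<sigma> = 0" and pd: "positive_definite (hessian V \<sigma>)"
  obtains t where "0 < t" "\<And>y. norm (y - \<sigma>) \<le> t \<Longrightarrow> t * (norm (y - \<sigma>))\<^sup>2 \<le> (y - \<sigma>) \<bullet> gradient V y"
    "\<And>y. norm (y - \<sigma>) \<le> t \<Longrightarrow> t * (norm (y - \<sigma>))\<^sup>2 \<le> V y"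
    "\<And>y. norm (y - \<sigma>) \<le> t \<Longrightarrow> V y \<le> (1 / t) * (norm (y - \<sigma>))\<^sup>2"
proof -
  obtain l where l: "0 < l" "\<And>h. l * (norm h)\<^sup>2 \<le> h \<bullet> (hessian V \<sigma> *v h)"
    by (rule positive_definite_coercive[OF pd]) blast
  obtain B where B: "0 < B" "\<And>h. norm (hessian_map V \<sigma> h) \<le> B * norm h"
    by (rule hessian_map_bound[OF V(1), of "{\<sigma>}"]) auto
  have "(\<lambda>h. gradient V \<sigma> \<bullet> h) = (\<lambda>h. 0)"
    by (rule differential_zero_maxmin[OF _ _ has_derivative_gradient[OF V(1)], of \<sigma> UNIV]) (use V(2) \<sigma> in auto)
  then have "gradient V \<sigma> \<bullet> gradient V \<sigma> = 0" by metis
  then have g0: "gradient V \<sigma> = 0" by simp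
  \<comment> \<open>The gradient vanishes at the zero, so near it the gradient is the Hessian map up
    to an error of half the coercivity constant.\<close>
  have "\<exists>d>0. \<forall>y. norm (y - \<sigma>) < d \<longrightarrow> norm (gradient V y - gradient V \<sigma> - hessian_map V \<sigma> (y - \<sigma>)) \<le> l / 2 * norm (y - \<sigma>)"
    using gradient_has_derivative[OF V(1), of \<sigma>] l(1) unfolding has_derivative_at_alt by (metis half_gt_zero)
  then obtain d where d: "0 < d" "\<And>y. norm (y - \<sigma>) < d \<Longrightarrow> norm (gradient V y - hessian_map V \<sigma> (y - \<sigma>)) \<le> l / 2 * norm (y - \<sigma>)"
    unfolding g0 by auto
  have G: "l / 2 * (norm (y - \<sigma>))\<^sup>2 \<le> (y - \<sigma>) \<bullet> gradient V y" "(y - \<sigma>) \<bullet> gradient V y \<le> (B + l) * (norm (y - \<sigma>))\<^sup>2"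
    if "norm (y - \<sigma>) < d" for y
  proof -
    let ?p = "y - \<sigma>"
    have e: "\<bar>?p \<bullet> (gradient V y - hessian_map V \<sigma> ?p)\<bar> \<le> l / 2 * (norm ?p)\<^sup>2"
    proof -
      have "\<bar>?p \<bullet> (gradient V y - hessian_map V \<sigma> ?p)\<bar> \<le> norm ?p * norm (gradient V y - hessian_map V \<sigma> ?p)"
        by (rule Cauchy_Schwarz_ineq2)
      also have "\<dots> \<le> norm ?p * (l / 2 * norm ?p)" by (intro mult_left_mono d that) auto
      finally show ?thesis by (simp add: power2_eq_square mult_ac)
    qed
    have h: "l * (norm ?p)\<^sup>2 \<le> ?p \<bullet> hessian_map V \<sigma> ?p" unfolding hessian_map_quadratic by (rule l)
    have "?p \<bullet> hessian_map V \<sigma> ?p \<le> norm ?p * norm (hessian_map V \<sigma> ?p)" by (rule norm_cauchy_schwarz)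
    also have "\<dots> \<le> norm ?p * (B * norm ?p)" by (intro mult_left_mono B) auto
    finally have h': "?p \<bullet> hessian_map V \<sigma> ?p \<le> B * (norm ?p)\<^sup>2" by (simp add: power2_eq_square mult_ac)
    have s: "?p \<bullet> (gradient V y - hessian_map V \<sigma> ?p) = ?p \<bullet> gradient V y - ?p \<bullet> hessian_map V \<sigma> ?p"
      by (rule inner_diff_right)
    have "l * (norm ?p)\<^sup>2 = l / 2 * (norm ?p)\<^sup>2 + l / 2 * (norm ?p)\<^sup>2" by simp
    then show "l / 2 * (norm ?p)\<^sup>2 \<le> ?p \<bullet> gradient V y" using e h s by linarith
    have "0 \<le> l / 2 * (norm ?p)\<^sup>2" using l by simp
    then have "l / 2 * (norm ?p)\<^sup>2 \<le> l * (norm ?p)\<^sup>2" by simp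
    then have "?p \<bullet> gradient V y \<le> B * (norm ?p)\<^sup>2 + l * (norm ?p)\<^sup>2" using e h' s by linarith
    then show "?p \<bullet> gradient V y \<le> (B + l) * (norm ?p)\<^sup>2" by (simp only: distrib_right)
  qed
  have W: "l / 4 * (norm (y - \<sigma>))\<^sup>2 \<le> V y" "V y \<le> (B + l) * (norm (y - \<sigma>))\<^sup>2" if y: "norm (y - \<sigma>) < d" for y
  proof -
    define p where "p = y - \<sigma>"
    define f where "f s = V (\<sigma> + s *\<^sub>R p)" for s
    have f: "(f has_real_derivative gradient V (\<sigma> + s *\<^sub>R p) \<bullet> p) (at s)" for s
    proof -
      have "((\<lambda>s. \<sigma> + s *\<^sub>R p) has_derivative (\<lambda>s. s *\<^sub>R p)) (at s)" by (auto intro!: derivative_eq_intros)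
      from diff_chain_at[OF this has_derivative_gradient[OF V(1)]]
      show ?thesis by (simp add: o_def has_field_derivative_def f_def[abs_def] mult_commute_abs)
    qed
    have sd: "norm ((\<sigma> + s *\<^sub>R p) - \<sigma>) < d" if "0 \<le> s" "s \<le> 1" for s
    proof -
      have "\<bar>s\<bar> * norm p \<le> 1 * norm p" using that by (intro mult_right_mono) auto
      then show ?thesis using y by (simp add: p_def)
    qed
    have lo: "l / 2 * s * (norm p)\<^sup>2 \<le> gradient V (\<sigma> + s *\<^sub>R p) \<bullet> p" if s: "0 \<le> s" "s \<le> 1" for s
    proof (cases "s = 0")
      case False
      have "l / 2 * (s\<^sup>2 * (norm p)\<^sup>2) \<le> s * (p \<bullet> gradient V (\<sigma> + s *\<^sub>R p))"
        using G(1)[OF sd[OF s]] by (simp add: power_mult_distrib)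
      then have "s * (l / 2 * s * (norm p)\<^sup>2) \<le> s * (gradient V (\<sigma> + s *\<^sub>R p) \<bullet> p)"
        by (simp add: power2_eq_square inner_commute mult_ac)
      then show ?thesis using False s by (simp add: mult_le_cancel_left)
    qed (simp add: g0)
    have hi: "gradient V (\<sigma> + s *\<^sub>R p) \<bullet> p \<le> (B + l) * s * (norm p)\<^sup>2" if s: "0 \<le> s" "s \<le> 1" for s
    proof (cases "s = 0")
      case False
      have "s * (p \<bullet> gradient V (\<sigma> + s *\<^sub>R p)) \<le> (B + l) * (s\<^sup>2 * (norm p)\<^sup>2)"
        using G(2)[OF sd[OF s]] by (simp add: power_mult_distrib)
      then have "s * (gradient V (\<sigma> + s *\<^sub>R p) \<bullet> p) \<le> s * ((B + l) * s * (norm p)\<^sup>2)"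
        by (simp add: power2_eq_square inner_commute mult_ac)
      then show ?thesis using False s by (simp add: mult_le_cancel_left)
    qed (simp add: g0)
    have q: "((\<lambda>s. c / 2 * (norm p)\<^sup>2 * s\<^sup>2) has_real_derivative c * s * (norm p)\<^sup>2) (at s)" for c s
      by (rule derivative_eq_intros refl)+ simp
    \<comment> \<open>Along the segment from the zero to \<open>y\<close>, the difference between
      the potential and a parabola is monotone, by the radial gradient bounds. Integrating halves
      the constant \<open>l / 2\<close> to \<open>l / 4\<close>.\<close>
    have "f 0 - l / 2 / 2 * (norm p)\<^sup>2 * 0\<^sup>2 \<le> f 1 - l / 2 / 2 * (norm p)\<^sup>2 * 1\<^sup>2"
    proof (rule DERIV_nonneg_imp_nondecreasing[where a = 0 and b = 1 and f = "\<lambda>s. f s - l / 2 / 2 * (norm p)\<^sup>2 * s\<^sup>2"])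
      fix s :: real assume "0 \<le> s" "s \<le> 1"
      then show "\<exists>y. ((\<lambda>s. f s - l / 2 / 2 * (norm p)\<^sup>2 * s\<^sup>2) has_real_derivative y) (at s) \<and> 0 \<le> y"
        using lo by (intro exI[of _ "gradient V (\<sigma> + s *\<^sub>R p) \<bullet> p - l / 2 * s * (norm p)\<^sup>2"] conjI DERIV_diff f q) auto
    qed simp
    then show "l / 4 * (norm (y - \<sigma>))\<^sup>2 \<le> V y" by (simp add: f_def p_def \<sigma>)
    have "(B + l) / 2 * (norm p)\<^sup>2 * 0\<^sup>2 - f 0 \<le> (B + l) / 2 * (norm p)\<^sup>2 * 1\<^sup>2 - f 1"
    proof (rule DERIV_nonneg_imp_nondecreasing[where a = 0 and b = 1 and f = "\<lambda>s. (B + l) / 2 * (norm p)\<^sup>2 * s\<^sup>2 - f s"])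
      fix s :: real assume "0 \<le> s" "s \<le> 1"
      then show "\<exists>y. ((\<lambda>s. (B + l) / 2 * (norm p)\<^sup>2 * s\<^sup>2 - f s) has_real_derivative y) (at s) \<and> 0 \<le> y"
        using hi by (intro exI[of _ "(B + l) * s * (norm p)\<^sup>2 - gradient V (\<sigma> + s *\<^sub>R p) \<bullet> p"] conjI DERIV_diff f q) auto
    qed simp
    then have "V y \<le> (B + l) * (norm (y - \<sigma>))\<^sup>2 / 2" by (simp add: f_def p_def \<sigma>)
    moreover have "0 \<le> (B + l) * (norm (y - \<sigma>))\<^sup>2" using B l by simp
    ultimately show "V y \<le> (B + l) * (norm (y - \<sigma>))\<^sup>2" by linarith
  qed
  \<comment> \<open>The bound \<open>1 / (B + l)\<close> is there for the upper estimate: it turns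
    the factor \<open>B + l\<close> into \<open>1 / t\<close>.\<close>
  define t where "t = min (d / 2) (min (l / 4) (1 / (B + l)))"
  have t: "0 < t" "t \<le> d / 2" "t \<le> l / 4" "t \<le> 1 / (B + l)" using d l B by (auto simp: t_def add_pos_pos)
  have bl: "B + l \<le> 1 / t" using t B l by (simp add: pos_le_divide_eq mult.commute add_pos_pos)
  show thesis
  proof (rule that[OF t(1)])
    fix y assume y: "norm (y - \<sigma>) \<le> t"
    then have yd: "norm (y - \<sigma>) < d" using t d by linarith
    have n: "0 \<le> (norm (y - \<sigma>))\<^sup>2" by simp
    show "t * (norm (y - \<sigma>))\<^sup>2 \<le> (y - \<sigma>) \<bullet> gradient V y"
      using G(1)[OF yd] mult_right_mono[OF _ n, of t "l / 2"] t l by linarith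
    show "t * (norm (y - \<sigma>))\<^sup>2 \<le> V y"
      using W(1)[OF yd] mult_right_mono[OF _ n, of t "l / 4"] t by linarith
    show "V y \<le> (1 / t) * (norm (y - \<sigma>))\<^sup>2"
      using W(2)[OF yd] mult_right_mono[OF bl n] by linarith
  qed
qed

lemma eventually_at_right_0I:
  assumes "0 < (t0::real)" "\<And>t. 0 < t \<Longrightarrow> t \<le> t0 \<Longrightarrow> P t"
  shows "eventually P (at_right 0)"
  unfolding eventually_at_right_field using assms by (intro exI[of _ t0]) auto

lemma admissible_potential_locale:
  fixes V :: "real^'k \<Rightarrow> real"
  assumes adm: "admissible_potential V"
  shows "\<exists>HV Z \<mu> a b v0 M L. potential V (gradient V) HV Z \<mu> a b v0 M L"
proof -
  define Z where "Z = {y. V y = 0}"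
  have sm: "smooth_on UNIV V" and bdd: "bdd_below (range V)" and inf: "Inf (range V) = 0" and fin: "finite Z"
    and pd: "\<And>\<sigma>. V \<sigma> = 0 \<Longrightarrow> positive_definite (hessian V \<sigma>)"
    and rad: "\<exists>\<alpha>>0. \<exists>R>0. \<forall>y. norm y > R \<longrightarrow> y \<bullet> gradient V y \<ge> \<alpha> * (norm y)\<^sup>2"
    and lim: "filterlim V at_top at_infinity"
    using adm unfolding admissible_potential_def Z_def by simp_all
  have V0: "0 \<le> V y" for y using cInf_lower[of "V y" "range V"] bdd inf by auto
  have cV: "continuous_on S V" for S
    using smooth_on_imp_continuous[OF sm] continuous_on_subset by blast
  \<comment> \<open>This property passes from \<open>t\<close> to every smaller positive number, so
    it holds eventually at \<open>0\<close> from the right for all of the finitely many zeros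
    together. The resulting \<mu> also serves as \<open>a\<close>, and its inverse as
    \<open>b\<close>.\<close>
  define P where "P t \<sigma> \<longleftrightarrow> (\<forall>y. norm (y - \<sigma>) \<le> t \<longrightarrow> t * (norm (y - \<sigma>))\<^sup>2 \<le> (y - \<sigma>) \<bullet> gradient V y \<and>
      t * (norm (y - \<sigma>))\<^sup>2 \<le> V y \<and> V y \<le> (1 / t) * (norm (y - \<sigma>))\<^sup>2)" for t \<sigma>
  have "\<forall>\<sigma>\<in>Z. eventually (\<lambda>t. P t \<sigma>) (at_right 0)"
  proof
    fix \<sigma> assume "\<sigma> \<in> Z"
    then have "V \<sigma> = 0" by (simp add: Z_def)
    obtain t0 where t0: "0 < t0" "\<And>y. norm (y - \<sigma>) \<le> t0 \<Longrightarrow> t0 * (norm (y - \<sigma>))\<^sup>2 \<le> (y - \<sigma>) \<bullet> gradient V y"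
      "\<And>y. norm (y - \<sigma>) \<le> t0 \<Longrightarrow> t0 * (norm (y - \<sigma>))\<^sup>2 \<le> V y"
      "\<And>y. norm (y - \<sigma>) \<le> t0 \<Longrightarrow> V y \<le> (1 / t0) * (norm (y - \<sigma>))\<^sup>2"
      by (rule local_potential_bounds[OF sm V0 \<open>V \<sigma> = 0\<close> pd[OF \<open>V \<sigma> = 0\<close>]]) blast
    show "eventually (\<lambda>t. P t \<sigma>) (at_right 0)"
    proof (rule eventually_at_right_0I[OF t0(1)])
      fix t assume t: "0 < t" "t \<le> t0"
      show "P t \<sigma>" unfolding P_def
      proof (intro allI impI conjI)
        fix y assume "norm (y - \<sigma>) \<le> t"
        then have y: "norm (y - \<sigma>) \<le> t0" using t by linarith
        have n: "0 \<le> (norm (y - \<sigma>))\<^sup>2" by simp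
        have 1: "t * (norm (y - \<sigma>))\<^sup>2 \<le> t0 * (norm (y - \<sigma>))\<^sup>2" using t n by (intro mult_right_mono) auto
        have 2: "1 / t0 * (norm (y - \<sigma>))\<^sup>2 \<le> 1 / t * (norm (y - \<sigma>))\<^sup>2"
          using t n by (intro mult_right_mono divide_left_mono) auto
        show "t * (norm (y - \<sigma>))\<^sup>2 \<le> (y - \<sigma>) \<bullet> gradient V y" using 1 t0(2)[OF y] by linarith
        show "t * (norm (y - \<sigma>))\<^sup>2 \<le> V y" using 1 t0(3)[OF y] by linarith
        show "V y \<le> (1 / t) * (norm (y - \<sigma>))\<^sup>2" using 2 t0(4)[OF y] by linarith
      qed
    qed
  qed
  then have e1: "eventually (\<lambda>t. \<forall>\<sigma>\<in>Z. P t \<sigma>) (at_right 0)" by (rule eventually_ball_finite[OF fin])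
  have "\<forall>\<sigma>\<in>Z. eventually (\<lambda>t. \<forall>\<sigma>'\<in>Z. \<sigma> \<noteq> \<sigma>' \<longrightarrow> 2 * t < norm (\<sigma> - \<sigma>')) (at_right 0)"
  proof (intro ballI eventually_ball_finite[OF fin])
    fix \<sigma> \<sigma>' assume "\<sigma> \<in> Z" "\<sigma>' \<in> Z"
    show "eventually (\<lambda>t. \<sigma> \<noteq> \<sigma>' \<longrightarrow> 2 * t < norm (\<sigma> - \<sigma>')) (at_right 0)"
    proof (cases "\<sigma> = \<sigma>'")
      case False
      then have n: "0 < norm (\<sigma> - \<sigma>')" by simp
      then show ?thesis by (intro eventually_at_right_0I[of "norm (\<sigma> - \<sigma>') / 3"]) auto
    qed simp
  qed
  then have "eventually (\<lambda>t. \<forall>\<sigma>\<in>Z. \<forall>\<sigma>'\<in>Z. \<sigma> \<noteq> \<sigma>' \<longrightarrow> 2 * t < norm (\<sigma> - \<sigma>')) (at_right 0)"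
    by (rule eventually_ball_finite[OF fin])
  with e1 have "eventually (\<lambda>t. (\<forall>\<sigma>\<in>Z. P t \<sigma>) \<and> (\<forall>\<sigma>\<in>Z. \<forall>\<sigma>'\<in>Z. \<sigma> \<noteq> \<sigma>' \<longrightarrow> 2 * t < norm (\<sigma> - \<sigma>'))) (at_right 0)"
    by (rule eventually_conj)
  then obtain t0 where "0 < t0" "\<And>t. 0 < t \<Longrightarrow> t < t0 \<Longrightarrow> (\<forall>\<sigma>\<in>Z. P t \<sigma>) \<and> (\<forall>\<sigma>\<in>Z. \<forall>\<sigma>'\<in>Z. \<sigma> \<noteq> \<sigma>' \<longrightarrow> 2 * t < norm (\<sigma> - \<sigma>'))"
    unfolding eventually_at_right_field by blast
  from this(1) this(2)[of "t0 / 2"] obtain \<mu> where \<mu>: "0 < \<mu>" "\<And>\<sigma>. \<sigma> \<in> Z \<Longrightarrow> P \<mu> \<sigma>"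
    "\<And>\<sigma> \<sigma>'. \<sigma> \<in> Z \<Longrightarrow> \<sigma>' \<in> Z \<Longrightarrow> \<sigma> \<noteq> \<sigma>' \<Longrightarrow> 2 * \<mu> < norm (\<sigma> - \<sigma>')"
    by (metis half_gt_zero field_sum_of_halves less_add_same_cancel1)
  have "eventually (\<lambda>y. 1 \<le> V y) at_infinity" using lim by (simp add: filterlim_at_top)
  then obtain R1 where R1: "\<And>y. R1 \<le> norm y \<Longrightarrow> 1 \<le> V y" unfolding eventually_at_infinity by blast
  \<comment> \<open>Outside the ball of radius \<open>R1\<close> the potential is at least 1. The
    remaining points away from the zeros form a compact set, on which it has a positive minimum if
    the set is nonempty.\<close>
  define K where "K = cball 0 R1 \<inter> (\<Inter>\<sigma>\<in>Z. {y. \<mu> / 8 \<le> norm (y - \<sigma>)})"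
  have "closed (\<Inter>\<sigma>\<in>Z. {y. \<mu> / 8 \<le> norm (y - \<sigma>)})"
    by (intro closed_INT ballI closed_Collect_le continuous_intros)
  then have K: "compact K" unfolding K_def by (intro compact_Int_closed compact_cball)
  obtain v0 where v0: "0 < v0" "\<And>y. (\<And>\<sigma>. \<sigma> \<in> Z \<Longrightarrow> \<mu> / 8 \<le> norm (y - \<sigma>)) \<Longrightarrow> v0 \<le> V y"
  proof (cases "K = {}")
    case True
    have "1 \<le> V y" if "\<And>\<sigma>. \<sigma> \<in> Z \<Longrightarrow> \<mu> / 8 \<le> norm (y - \<sigma>)" for y
    proof (rule R1)
      have "y \<notin> cball 0 R1" using True that by (auto simp: K_def)
      then show "R1 \<le> norm y" by simp
    qed
    then show thesis by (intro that[of 1]) auto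
  next
    case False
    obtain y0 where y0: "y0 \<in> K" "\<And>y. y \<in> K \<Longrightarrow> V y0 \<le> V y"
      using continuous_attains_inf[OF K False cV] by blast
    have "V y0 \<noteq> 0"
    proof
      assume "V y0 = 0"
      then have "y0 \<in> Z" by (simp add: Z_def)
      then show False using y0(1) \<mu>(1) unfolding K_def by fastforce
    qed
    then have p: "0 < V y0" using V0[of y0] by linarith
    have "min 1 (V y0) \<le> V y" if "\<And>\<sigma>. \<sigma> \<in> Z \<Longrightarrow> \<mu> / 8 \<le> norm (y - \<sigma>)" for y
    proof (cases "R1 \<le> norm y")
      case True then show ?thesis using R1[of y] by linarith
    next
      case False
      then have "y \<in> K" using that by (auto simp: K_def)
      then show ?thesis using y0(2)[of y] by linarith
    qed
    then show thesis using p by (intro that[of "min 1 (V y0)"]) auto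
  qed
  obtain \<alpha> R where R: "0 < \<alpha>" "0 < R" "\<And>y. norm y > R \<Longrightarrow> y \<bullet> gradient V y \<ge> \<alpha> * (norm y)\<^sup>2" using rad by blast
  \<comment> \<open>The sum of the norms is a crude bound for the largest one; adding \<mu> puts the
    neighbourhoods of the zeros into the ball, and adding \<open>R\<close> makes the radial
    condition valid outside.\<close>
  define M where "M = R + (\<Sum>\<sigma>\<in>Z. norm \<sigma>) + \<mu>"
  have s0: "0 \<le> (\<Sum>\<sigma>\<in>Z. norm \<sigma>)" by (intro sum_nonneg) auto
  then have M: "0 < M" "R \<le> M" using R \<mu> by (auto simp: M_def)
  have MZ: "norm \<sigma> + \<mu> \<le> M" if "\<sigma> \<in> Z" for \<sigma>
    using member_le_sum[OF that, of norm] fin R by (auto simp: M_def)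
  have "continuous_on (cball 0 M) (gradient V)"
    using gradient_has_derivative[OF sm] by (meson continuous_at_imp_continuous_on has_derivative_continuous)
  from compact_continuous_image[OF this compact_cball] have "bounded (gradient V ` cball 0 M)" by (rule compact_imp_bounded)
  then obtain L1 where L1: "\<And>y. norm y \<le> M \<Longrightarrow> norm (gradient V y) \<le> L1"
    unfolding bounded_iff by (metis imageI mem_cball_0)
  obtain L2 where L2: "0 < L2" "\<And>y h. y \<in> cball 0 M \<Longrightarrow> norm (hessian_map V y h) \<le> L2 * norm h"
    by (rule hessian_map_bound[OF sm compact_cball]) blast
  have "potential V (gradient V) (hessian_map V) Z \<mu> \<mu> (1 / \<mu>) v0 M (max L1 L2)"
  proof
    show "(V has_derivative (\<lambda>h. gradient V y \<bullet> h)) (at y)" for y by (rule has_derivative_gradient[OF sm])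
    show "(gradient V has_derivative hessian_map V y) (at y)" for y by (rule gradient_has_derivative[OF sm])
    show "0 < y \<bullet> gradient V y" if "M < norm y" for y
    proof -
      have "R < norm y" "0 < norm y" using that M by linarith+
      then have "0 < \<alpha> * (norm y)\<^sup>2" using R(1) by simp
      also have "\<dots> \<le> y \<bullet> gradient V y" using R(3) \<open>R < norm y\<close> by blast
      finally show ?thesis .
    qed
    show "norm (hessian_map V y h) \<le> max L1 L2 * norm h" if "norm y \<le> M" for y h
    proof -
      have "norm (hessian_map V y h) \<le> L2 * norm h" using L2(2) that by simp
      also have "\<dots> \<le> max L1 L2 * norm h" by (intro mult_right_mono) auto
      finally show ?thesis .
    qed
    show "norm (gradient V y) \<le> max L1 L2" if "norm y \<le> M" for y using L1[OF that] by simp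
  qed (use V0 fin \<mu> v0 M MZ L2(1) in \<open>auto simp: P_def\<close>)
  then show ?thesis by blast
qed

text \<open>The corners have squared norm 98/100. This fixes the outer half side 7/10 of the
  estimates on squares, while the inner one is the radius 9/16 of the given disk.\<close>

lemma plane_square_subset_ball: "plane ` square (7/10) \<subseteq> ball 0 1"
proof
  fix v assume "v \<in> plane ` square (7/10)"
  then obtain x y where v: "v = plane (x, y)" "\<bar>x\<bar> \<le> 7/10" "\<bar>y\<bar> \<le> 7/10" by (auto simp: cbox_Pair_eq abs_le_iff)
  have "x\<^sup>2 \<le> (7/10)\<^sup>2" "y\<^sup>2 \<le> (7/10)\<^sup>2"
    using power_mono[OF v(2), of 2] power_mono[OF v(3), of 2] by simp_all
  then have "x\<^sup>2 + y\<^sup>2 < 1" by (simp add: power_divide)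
  then have "norm v < 1" by (simp add: v(1) norm_vec_def L2_set_def sum_2)
  then show "v \<in> ball 0 1" by simp
qed

lemma ball_subset_plane_square: "ball 0 r \<subseteq> plane ` square r"
proof
  fix v :: "real^2" assume "v \<in> ball 0 r"
  then have "\<bar>v $ 1\<bar> \<le> r" "\<bar>v $ 2\<bar> \<le> r"
    using component_le_norm_cart[of v 1] component_le_norm_cart[of v 2] by auto
  then have "(v $ 1, v $ 2) \<in> square r" unfolding mem_square by simp
  then show "v \<in> plane ` square r" by (metis imageI plane_inverse(1))
qed

theorem proposition1:
  fixes V :: "real^'k \<Rightarrow> real"
  assumes "admissible_potential V"
  shows "\<exists>C>0. \<forall>\<epsilon> u. 0 < \<epsilon> \<and> \<epsilon> \<le> 1 \<and> solution V \<epsilon> u \<longrightarrow>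
           (LINT x:ball 0 (9/16)|lebesgue. energy_density V \<epsilon> u x)
             \<le> C * ((LINT x:ball 0 1|lebesgue. energy_density V \<epsilon> u x) powr (3/2)
                  + \<epsilon> * (LINT x:ball 0 1|lebesgue. energy_density V \<epsilon> u x))"
proof -
  obtain HV Z \<mu> a b v0 M L where "potential V (gradient V) HV Z \<mu> a b v0 M L"
    using admissible_potential_locale[OF assms] by blast
  then interpret P: potential V "gradient V" HV Z \<mu> a b v0 M L .
  obtain C where C: "0 < C" and est: "\<And>\<epsilon> u ux uy. 0 < \<epsilon> \<Longrightarrow> P.solves \<epsilon> (square (7/10)) u ux uy \<Longrightarrow>
     integral (square (9/16)) (P.energy \<epsilon> u ux uy)
       \<le> C * (integral (square (7/10)) (P.energy \<epsilon> u ux uy) powr (3/2)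
            + \<epsilon> * integral (square (7/10)) (P.energy \<epsilon> u ux uy))"
    using P.interior_energy_estimate by blast
  have "(LINT x:ball 0 (9/16)|lebesgue. energy_density V \<epsilon> u x)
             \<le> C * ((LINT x:ball 0 1|lebesgue. energy_density V \<epsilon> u x) powr (3/2)
                  + \<epsilon> * (LINT x:ball 0 1|lebesgue. energy_density V \<epsilon> u x))"
    if \<epsilon>: "0 < \<epsilon>" and sol: "solution V \<epsilon> u" for \<epsilon> u
  proof -
    define e where "e = energy_density V \<epsilon> u"
    have int: "set_integrable lebesgue (ball 0 1) e" and sm: "smooth_on (ball 0 1) u"
      and pde: "\<And>x. x \<in> ball 0 1 \<Longrightarrow> laplacian u x = (1 / \<epsilon>\<^sup>2) *\<^sub>R gradient V (u x)"
      using sol unfolding solution_def e_def by auto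
    let ?u = "\<lambda>p. u (plane p)" and ?ux = "\<lambda>p. partial_deriv 1 u (plane p)" and ?uy = "\<lambda>p. partial_deriv 2 u (plane p)"
    have sub: "plane ` square (7/10) \<subseteq> ball 0 1" by (rule plane_square_subset_ball)
    have sol': "P.solves \<epsilon> (square (7/10)) ?u ?ux ?uy"
      by (rule P.solves_subset[OF P.smooth_solution_solves[OF open_ball sm pde]]) (use sub in auto)
    have ee: "P.energy \<epsilon> ?u ?ux ?uy = (\<lambda>p. e (plane p))"
      by (simp add: fun_eq_iff e_def energy_density_def P.energy_def P.grad_sq_def sum_2)
    have e0: "0 \<le> e x" for x
      using \<epsilon> P.V_nonneg by (auto simp: e_def energy_density_def intro!: add_nonneg_nonneg mult_nonneg_nonneg sum_nonneg)
    have i: "e absolutely_integrable_on K" "e integrable_on K" if "K \<in> sets lebesgue" "K \<subseteq> ball 0 1" for K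
      using set_integrable_subset[OF int that] set_lebesgue_integral_eq_integral(1) by blast+
    have box: "plane ` square r = cbox (plane (- r, - r)) (plane (r, r))" for r by (rule plane_image_cbox)
    have sub9: "plane ` square (9/16) \<subseteq> plane ` square (7/10)" by (intro image_mono) (auto simp: cbox_Pair_eq)
    have i7: "e integrable_on plane ` square (7/10)" by (rule i(2)) (use sub in \<open>auto simp: box\<close>)
    have i9: "e integrable_on plane ` square (9/16)" by (rule i(2)) (use sub sub9 in \<open>auto simp: box\<close>)
    define E where "E = (LINT x:ball 0 1|lebesgue. e x)"
    define F where "F = integral (square (7/10)) (P.energy \<epsilon> ?u ?ux ?uy)"
    have "F = integral (plane ` square (7/10)) e"
      unfolding F_def ee box by (rule integral_plane) (use i7 in \<open>simp add: box\<close>)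
    also have "\<dots> \<le> integral (ball 0 1) e"
      using sub i7 i(2)[of "ball 0 1"] e0 by (intro integral_subset_le) auto
    also have "\<dots> = E" unfolding E_def using set_lebesgue_integral_eq_integral(2)[OF int] by simp
    finally have FE: "F \<le> E" .
    have F0: "0 \<le> F" unfolding F_def ee by (rule integral_nonneg_real[OF e0])
    have b9: "ball 0 (9/16) \<subseteq> (ball 0 1 :: (real^2) set)" by (intro subset_ball) simp
    have "(LINT x:ball 0 (9/16)|lebesgue. e x) = integral (ball 0 (9/16)) e"
      using i(1)[of "ball 0 (9/16)"] b9 by (intro set_lebesgue_integral_eq_integral(2)) auto
    \<comment> \<open>The nonnegative density lets the inner disk be enlarged to its square, just as
      the outer square was enlarged to the unit disk in \<open>FE\<close>.\<close>
    also have "\<dots> \<le> integral (plane ` square (9/16)) e"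
      using ball_subset_plane_square[of "9/16"] i(2)[of "ball 0 (9/16)"] b9 i9 e0 by (intro integral_subset_le) auto
    also have "\<dots> = integral (square (9/16)) (P.energy \<epsilon> ?u ?ux ?uy)"
      unfolding ee box by (rule integral_plane[symmetric]) (use i9 in \<open>simp add: box\<close>)
    also have "\<dots> \<le> C * (F powr (3/2) + \<epsilon> * F)" unfolding F_def by (rule est[OF \<epsilon> sol'])
    also have "\<dots> \<le> C * (E powr (3/2) + \<epsilon> * E)"
      using FE F0 C \<epsilon> by (intro mult_left_mono add_mono powr_mono2) auto
    finally show ?thesis by (simp add: E_def e_def)
  qed
  then show ?thesis using C by blast
qed

end
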